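(* Let $k,m\in\mathbb{N}_0$ and $l:=\min\{k,m\}$. For $j\in\{1,\dots,l\}$ define \[W^j_{k,m}=\prod_{i=1}^{j}\frac{1}{\sqrt{\mu_{k-j+i}}}\Big(1-\frac{d_{k-j}\,d_{m-j-1}}{d_{k-j+i}\,d_{m-j+i-1}}\Big)^{-1/2}\,\sigma^j\,\iota_{k-j,m-j}:E_{k+m-2j}\to E_k\otimes E_m,\] where $\sigma^j:=\sigma_{k-1,m-1}\circ\cdots\circ\sigma_{k-j,m-j}:E_{k-j}\otimes E_{m-j}\to E_k\otimes E_m$, and put $W^0_{k,m}:=\iota_{k,m}$. Then \[W_{k,m}=\begin{pmatrix}W^0_{k,m}&W^1_{k,m}&\cdots&W^l_{k,m}\end{pmatrix}:\bigoplus_{j=0}^l E_{k+m-2j}\to E_k\otimes E_m\] is an $SU(2)$-equivariant unitary isomorphism.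
   Context: Fix $n\in\mathbb{N}$. Let $f_0,f_1$ be the standard basis of $\mathbb{C}^2$, $L_n\subseteq(\mathbb{C}^2)^{\otimes n}$ the symmetric tensors, $p_n$ the orthogonal projection onto $L_n$, and $\rho_n$ the restriction of the $n$-fold tensor power of the fundamental representation of $SU(2)$ to $L_n$. For $k=0,\dots,n$ let $e_k=\sqrt{n!/(k!(n-k)!)}\,p_n(f_0^{\otimes k}\otimes f_1^{\otimes(n-k)})$, an orthonormal basis of $L_n$, and $\delta=(n+1)^{-1/2}\sum_{k=0}^n(-1)^ke_k\otimes e_{n-k}$; the space of $\rho_n\otimes\rho_n$-invariant vectors in $L_n\otimes L_n$ is $\mathbb{C}\delta$. For $m\ge2$ let $K_m=\sum_{i=1}^{m-1}L_n^{\otimes(i-1)}\otimes\mathbb{C}\delta\otimes L_n^{\otimes(m-i-1)}$, $E_m=K_m^\perp\subseteq L_n^{\otimes m}$, $E_1=L_n$, $E_0=\mathbb{C}$, with $SU(2)$ acting via $\rho_n^{\otimes m}$; $1_m$ is the identity of $E_m$. For $k,m\in\mathbb{N}_0$, $\iota_{k,m}:E_{k+m}\to E_k\otimes E_m$ is the isometric inclusion induced by $L_n^{\otimes(k+m)}=L_n^{\otimes k}\otimes L_n^{\otimes m}$ (with $E_0\otimes E_m=E_m=E_m\otimes E_0$). Define integers $d_{-1}=0,d_0=1,d_1=n+1$, $d_m=d_1d_{m-1}-d_{m-2}$ ($m\ge2$), and $\mu_m=d_md_{m-1}/d_1$ for $m\ge1$. Define linear maps $G_m:E_{m-1}\to L_n^{\otimes(m+1)}$,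 $m\ge1$, recursively by $G_1(1)=\delta$ and $G_m(\xi)=(G_{m-1}\otimes 1)(\iota_{m-2,1}\xi)+(-1)^{(n+1)(m-1)}d_{m-1}\,\xi\otimes\delta$ for $m\ge2$; it is known that $G_m$ takes values in $E_m\otimes E_1$. For $k,m\in\mathbb{N}_0$ define $\sigma_{k,m}:=(1_{k+1}\otimes\iota_{1,m}^* )(G_{k+1}\otimes 1_m):E_k\otimes E_m\to E_{k+1}\otimes E_{m+1}$. *)

theory Defs
  imports Complex_Main "HOL-Combinatorics.Permutations"
begin

(* Model: (C^2)^{\<otimes>N} is the space of functions  f :: nat list \<Rightarrow> complex
   supported on the words of length N over {0,1}; the word w corresponds to the
   basis vector f_{w!0} \<otimes> ... \<otimes> f_{w!(N-1)}.  Tensor product of vectors = concatenation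
   of words.  Hence L_n^{\<otimes>m} \<subseteq> (C^2)^{\<otimes>nm}, and all identifications
   L_n^{\<otimes>(k+m)} = L_n^{\<otimes>k} \<otimes> L_n^{\<otimes>m} are literal equalities; the inclusions
   \<iota>_{k,m} are the identity map. *)

type_synonym vec = "nat list \<Rightarrow> complex"

definition words :: "nat \<Rightarrow> nat list set" where
  "words N = {w. length w = N \<and> set w \<subseteq> {0,1}}"

definition Vec :: "nat \<Rightarrow> vec set" where
  "Vec N = {f. \<forall>w. w \<notin> words N \<longrightarrow> f w = 0}"

definition ip :: "vec \<Rightarrow> vec \<Rightarrow> complex" where
  "ip f g = (\<Sum>w\<in>{w. f w \<noteq> 0}. f w * cnj (g w))"

definition cspan :: "vec set \<Rightarrow> vec set" where
  "cspan S = {h. \<exists>F c. finite F \<and> F \<subseteq> S \<and> h = (\<lambda>w. \<Sum>g\<in>F. c g * g w)}"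

definition tens :: "nat \<Rightarrow> vec \<Rightarrow> vec \<Rightarrow> vec" where
  "tens a f g = (\<lambda>w. f (take a w) * g (drop a w))"

definition tensS :: "nat \<Rightarrow> vec set \<Rightarrow> vec set \<Rightarrow> vec set" where
  "tensS a A B = cspan {tens a f g | f g. f \<in> A \<and> g \<in> B}"

definition oproj :: "vec set \<Rightarrow> vec \<Rightarrow> vec" where
  "oproj S f = (THE g. g \<in> S \<and> (\<forall>h\<in>S. ip (\<lambda>w. f w - g w) h = 0))"

(* A \<otimes> 1 : A maps (C^2)^{\<otimes>c} to (C^2)^{\<otimes>c'} *)
definition opL :: "nat \<Rightarrow> nat \<Rightarrow> (vec \<Rightarrow> vec) \<Rightarrow> vec \<Rightarrow> vec" where
  "opL c c' A f = (\<lambda>w. if c' \<le> length w then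
      A (\<lambda>u. if length u = c then f (u @ drop c' w) else 0) (take c' w) else 0)"

(* 1 \<otimes> B : identity on the first a tensor factors, B acts on (C^2)^{\<otimes>b} *)
definition opR :: "nat \<Rightarrow> nat \<Rightarrow> (vec \<Rightarrow> vec) \<Rightarrow> vec \<Rightarrow> vec" where
  "opR a b B f = (\<lambda>w. if a \<le> length w then
      B (\<lambda>v. if length v = b then f (take a w @ v) else 0) (drop a w) else 0)"

definition Lsym :: "nat \<Rightarrow> vec set" where
  "Lsym n = {f \<in> Vec n. \<forall>p w. p permutes {..<n} \<and> w \<in> words n \<longrightarrow>
              f (map (\<lambda>i. w ! p i) [0..<n]) = f w}"

definition ebasis :: "nat \<Rightarrow> nat \<Rightarrow> vec" where
  "ebasis n k = (\<lambda>w. complex_of_real (sqrt (real (n choose k))) *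
      oproj (Lsym n) (\<lambda>v. if v = replicate k 0 @ replicate (n - k) 1 then 1 else 0) w)"

definition delta :: "nat \<Rightarrow> vec" where
  "delta n = (\<lambda>w. complex_of_real (1 / sqrt (real (n + 1))) *
      (\<Sum>k\<le>n. (-1) ^ k * tens n (ebasis n k) (ebasis n (n - k)) w))"

definition Cdelta :: "nat \<Rightarrow> vec set" where
  "Cdelta n = {(\<lambda>w. c * delta n w) | c. True}"

fun Lpow :: "nat \<Rightarrow> nat \<Rightarrow> vec set" where
  "Lpow n 0 = Vec 0"
| "Lpow n (Suc j) = tensS (n * j) (Lpow n j) (Lsym n)"

definition Kspace :: "nat \<Rightarrow> nat \<Rightarrow> vec set" where
  "Kspace n m = cspan (\<Union>i\<in>{1..m-1}.
      tensS (n * (i - 1)) (Lpow n (i - 1)) (tensS (2 * n) (Cdelta n) (Lpow n (m - i - 1))))"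

definition E :: "nat \<Rightarrow> nat \<Rightarrow> vec set" where
  "E n m = (if m = 0 then Vec 0 else if m = 1 then Lsym n
            else {f \<in> Lpow n m. \<forall>h\<in>Kspace n m. ip f h = 0})"

(* d_{i-1}: dnat n i = d_{i-1}, so dnat n 0 = d_{-1} = 0 *)
fun dnat :: "nat \<Rightarrow> nat \<Rightarrow> int" where
  "dnat n 0 = 0"
| "dnat n (Suc 0) = 1"
| "dnat n (Suc (Suc i)) = int (n + 1) * dnat n (Suc i) - dnat n i"

definition d :: "nat \<Rightarrow> int \<Rightarrow> int" where
  "d n i = dnat n (nat (i + 1))"

definition mu :: "nat \<Rightarrow> int \<Rightarrow> real" where
  "mu n i = real_of_int (d n i * d n (i - 1)) / real_of_int (d n 1)"

(* G_m : E_{m-1} \<rightarrow> L_n^{\<otimes>(m+1)} *)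
fun G :: "nat \<Rightarrow> nat \<Rightarrow> vec \<Rightarrow> vec" where
  "G n 0 f = (\<lambda>w. 0)"
| "G n (Suc 0) f = (\<lambda>w. f [] * delta n w)"
| "G n (Suc (Suc m)) f = (\<lambda>w.
      opL (n * m) (n * (m + 2)) (G n (Suc m)) f w
      + (-1) ^ ((n + 1) * (m + 1)) * of_int (d n (int (m + 1))) * tens (n * (m + 1)) f (delta n) w)"

(* \<sigma>_{k,m} = (1_{k+1} \<otimes> \<iota>_{1,m}^* ) (G_{k+1} \<otimes> 1_m) *)
definition sigma :: "nat \<Rightarrow> nat \<Rightarrow> nat \<Rightarrow> vec \<Rightarrow> vec" where
  "sigma n k m f = opR (n * (k + 1)) (n * (1 + m)) (oproj (E n (m + 1)))
                     (opL (n * k) (n * (k + 2)) (G n (k + 1)) f)"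

fun sigpow :: "nat \<Rightarrow> nat \<Rightarrow> nat \<Rightarrow> nat \<Rightarrow> vec \<Rightarrow> vec" where
  "sigpow n k m 0 = id"
| "sigpow n k m (Suc j) = sigpow n k m j \<circ> sigma n (k - Suc j) (m - Suc j)"

definition Wcoef :: "nat \<Rightarrow> nat \<Rightarrow> nat \<Rightarrow> nat \<Rightarrow> real" where
  "Wcoef n k m j = (\<Prod>i\<in>{1..j}.
      (1 / sqrt (mu n (int k - int j + int i))) *
      (1 / sqrt (1 - real_of_int (d n (int k - int j) * d n (int m - int j - 1))
                   / real_of_int (d n (int k - int j + int i) * d n (int m - int j + int i - 1)))))"

(* W^j_{k,m}; \<iota>_{k-j,m-j} and \<iota>_{k,m} are the identity in this model *)
definition Wj :: "nat \<Rightarrow> nat \<Rightarrow> nat \<Rightarrow> nat \<Rightarrow> vec \<Rightarrow> vec" where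
  "Wj n k m j f = (if j = 0 then f
      else (\<lambda>w. complex_of_real (Wcoef n k m j) * sigpow n k m j f w))"

definition DS :: "nat \<Rightarrow> nat \<Rightarrow> nat \<Rightarrow> (nat \<Rightarrow> vec) set" where
  "DS n k m = {x. \<forall>j. (j \<le> min k m \<longrightarrow> x j \<in> E n (k + m - 2 * j))
                     \<and> (min k m < j \<longrightarrow> x j = (\<lambda>w. 0))}"

definition DSip :: "nat \<Rightarrow> nat \<Rightarrow> (nat \<Rightarrow> vec) \<Rightarrow> (nat \<Rightarrow> vec) \<Rightarrow> complex" where
  "DSip k m x y = (\<Sum>j\<le>min k m. ip (x j) (y j))"

definition Wmap :: "nat \<Rightarrow> nat \<Rightarrow> nat \<Rightarrow> (nat \<Rightarrow> vec) \<Rightarrow> vec" where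
  "Wmap n k m x = (\<lambda>w. \<Sum>j\<le>min k m. Wj n k m j (x j) w)"

definition SU2 :: "(nat \<Rightarrow> nat \<Rightarrow> complex) \<Rightarrow> bool" where
  "SU2 U \<longleftrightarrow> (\<forall>i<2. \<forall>j<2. (\<Sum>r<2. cnj (U r i) * U r j) = (if i = j then 1 else 0))
            \<and> U 0 0 * U 1 1 - U 0 1 * U 1 0 = 1"

definition act :: "(nat \<Rightarrow> nat \<Rightarrow> complex) \<Rightarrow> nat \<Rightarrow> vec \<Rightarrow> vec" where
  "act U N f = (\<lambda>w. if w \<in> words N then
      (\<Sum>v\<in>words N. (\<Prod>i<N. U (w ! i) (v ! i)) * f v) else 0)"

end

(* Insert the invariant vector \<delta> after i tensor legs (operator ins i) and let con i be the adjoint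
   contraction.  They satisfy the Temperley-Lieb relations con i (ins i) = 1,
   con i (ins (i+1)) = con (i+1) (ins i) = (-1)^n/(n+1), and commute when far apart; E_m is the
   common kernel of the con i, and E_k \<otimes> E_m is cut out by all con i except the one across the
   boundary between the two factors.  Writing the projection V \<otimes> E_m \<longrightarrow> E_{m+1} as a mirrored copy
   of G makes \<sigma>_{k,m} an explicit combination of ins and con, with adjoint a multiple of the boundary
   contraction.  The relations then give
     con \<sigma>_{k,m} = a + b \<sigma>_{k-1,m-1} con
   with explicit scalars a, b, so on E_{k+m-2j} each con \<sigma>^i is a scalar multiple of \<sigma>^{i-1}.  This
   yields orthogonality of the ranges and the norms.  Surjectivity: the orthogonal complement of the
   range of \<sigma>_{k-1,m-1} in E_k \<otimes> E_m is the kernel of the boundary contraction, that is E_{k+m}.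
   Equivariance reduces to invariance of \<delta>, which holds because pairing \<delta> with x^{\<otimes>n} \<otimes> y^{\<otimes>n}
   gives a multiple of det(x,y)^n. *)

theory Submission
  imports Defs
begin

section \<open>Orthogonal projections and slices of tensors\<close>

text \<open>The obstacle is the orthogonal projection inside \<open>sigma\<close>: it is given only
  by a definite description, and powers of \<sigma> would multiply such projections. The projected
  vector is therefore written down explicitly and then verified. After G_(k+1) \<otimes> 1, the
  contractions vanish except at the boundary position k and at k+1. Subtracting insertions placed
  behind the first k+1 legs does not change the projection, since these are orthogonal to every
  vector whose last m+1 legs lie in E_(m+1); their coefficients are forced by making the
  contractions behind the boundary vanish. On coefficient sequences, contraction acts by a
  tridiagonal matrix with diagonal 1 and off-diagonal entries (-1)^n/(n+1). Once the sign
  (-1)^((n+1)i) is split off, its kernel equation is exactly d_(j+1) = d_1 d_j - d_(j-1). This is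
  the origin of the signs and integers in G, and of the descending integers in the mirrored copy.
  The quotient of four d's in the normalization arises because the scalars in con \<sigma>^i
  telescope: only the first and last products survive.\<close>

lemma wordsD: "w \<in> words N \<Longrightarrow> length w = N"
  by (simp add: words_def)

lemma finite_words [simp]: "finite (words N)"
proof -
  have "words N = {w. set w \<subseteq> {0,1} \<and> length w = N}" by (auto simp: words_def)
  then show ?thesis by (simp add: finite_lists_length_eq)
qed

lemma words_append:
  assumes "length x = a"
  shows "x @ y \<in> words (a + b) \<longleftrightarrow> x \<in> words a \<and> y \<in> words b"
  using assms by (auto simp: words_def)

lemma words_0 [simp]: "words 0 = {[]}"
  by (auto simp: words_def)

lemma sum_words_append:
  "(\<Sum>w\<in>words (a + b). F w) = (\<Sum>u\<in>words a. \<Sum>v\<in>words b. F (u @ v))"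
proof -
  have "(\<Sum>u\<in>words a. \<Sum>v\<in>words b. F (u @ v)) = (\<Sum>(u,v)\<in>words a \<times> words b. F (u @ v))"
    by (simp add: sum.cartesian_product)
  also have "\<dots> = (\<Sum>w\<in>words (a + b). F w)"
    by (rule sum.reindex_bij_witness[where i = "\<lambda>w. (take a w, drop a w)" and j = "\<lambda>(u,v). u @ v"])
       (auto simp: words_def dest: in_set_takeD in_set_dropD)
  finally show ?thesis by simp
qed

lemma split_list_at:
  assumes "a \<le> length w"
  obtains x y where "w = x @ y" "length x = a" "length y = length w - a"
proof -
  have "w = take a w @ drop a w" "length (take a w) = a" "length (drop a w) = length w - a"
    using assms by auto
  then show ?thesis by (rule that)
qed

lemma split_word_at:
  assumes "w \<in> words (a + b)"
  obtains x y where "w = x @ y" "x \<in> words a" "y \<in> words b"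
proof -
  obtain x y where xy: "w = x @ y" "length x = a"
    using split_list_at[of a w] assms by (auto simp: words_def)
  with assms have "x \<in> words a" "y \<in> words b" by (auto simp: words_append)
  with xy show ?thesis using that by blast
qed

lemma Vec_eqI:
  assumes "f \<in> Vec N" "g \<in> Vec N" "\<And>w. w \<in> words N \<Longrightarrow> f w = g w"
  shows "f = g"
proof
  fix w show "f w = g w" using assms by (cases "w \<in> words N") (auto simp: Vec_def)
qed

lemma VecD: "f \<in> Vec N \<Longrightarrow> w \<notin> words N \<Longrightarrow> f w = 0"
  by (simp add: Vec_def)

lemma Vec_length: "f \<in> Vec N \<Longrightarrow> length w \<noteq> N \<Longrightarrow> f w = 0"
  by (auto simp: Vec_def words_def)

text \<open>\<open>ip\<close> sums over the support of its first argument; on \<open>Vec N\<close>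
  the range can be enlarged to all words, which makes linearity accessible.\<close>

lemma ip_eq:
  assumes "f \<in> Vec N"
  shows "ip f g = (\<Sum>w\<in>words N. f w * cnj (g w))"
  unfolding ip_def
  by (rule sum.mono_neutral_left) (use assms in \<open>auto simp: Vec_def\<close>)

lemma ip_cnj:
  assumes "f \<in> Vec N" "g \<in> Vec N"
  shows "ip g f = cnj (ip f g)"
  using assms by (simp add: ip_eq[where N = N] mult.commute)

lemma ip_self_eq_0:
  assumes "f \<in> Vec N" "ip f f = 0"
  shows "f = (\<lambda>w. 0)"
proof -
  have "ip f f = of_real (\<Sum>w\<in>words N. (cmod (f w))\<^sup>2)"
    unfolding ip_eq[OF assms(1)] of_real_sum by (intro sum.cong refl) (rule complex_norm_square[symmetric])
  with assms(2) have "(\<Sum>w\<in>words N. (cmod (f w))\<^sup>2) = 0" by (metis of_real_eq_0_iff)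
  then have "\<forall>w\<in>words N. (cmod (f w))\<^sup>2 = 0"
    by (subst (asm) sum_nonneg_eq_0_iff) auto
  then show ?thesis using assms(1) by (intro ext) (auto simp: Vec_def)
qed

section \<open>Complex subspaces, spans and orthogonal projections\<close>

definition csub :: "vec set \<Rightarrow> bool" where
  "csub S \<longleftrightarrow> (\<lambda>w. 0) \<in> S \<and>
     (\<forall>f\<in>S. \<forall>g\<in>S. \<forall>a b. (\<lambda>w. a * f w + b * g w) \<in> S)"

lemma csub0: "csub S \<Longrightarrow> (\<lambda>w. 0) \<in> S"
  by (simp add: csub_def)

lemma csub_lin: "csub S \<Longrightarrow> f \<in> S \<Longrightarrow> g \<in> S \<Longrightarrow> (\<lambda>w. a * f w + b * g w) \<in> S"
  by (simp add: csub_def)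

lemma csub_scale: "csub S \<Longrightarrow> f \<in> S \<Longrightarrow> (\<lambda>w. a * f w) \<in> S"
  using csub_lin[of S f f a 0] by simp

lemma csub_diff: "csub S \<Longrightarrow> f \<in> S \<Longrightarrow> g \<in> S \<Longrightarrow> (\<lambda>w. f w - g w) \<in> S"
  using csub_lin[of S f g 1 "-1"] by simp

lemma csub_sum:
  assumes "csub S" "\<And>i. i \<in> I \<Longrightarrow> f i \<in> S"
  shows "(\<lambda>w. \<Sum>i\<in>I. c i * f i w) \<in> S"
  using assms(2)
proof (induction I rule: infinite_finite_induct)
  case (insert i I)
  have "(\<lambda>w. \<Sum>i\<in>I. c i * f i w) \<in> S" using insert by auto
  from csub_lin[OF assms(1) insert.prems[of i] this, of "c i" 1] insert.hyps show ?case by simp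
qed (use csub0[OF assms(1)] in auto)

lemma csub_Vec: "csub (Vec N)"
  by (auto simp: csub_def Vec_def)

lemma cspan_subset:
  assumes "csub S" "T \<subseteq> S"
  shows "cspan T \<subseteq> S"
proof
  fix h assume "h \<in> cspan T"
  then obtain F c where "finite F" "F \<subseteq> T" "h = (\<lambda>w. \<Sum>g\<in>F. c g * g w)"
    by (auto simp: cspan_def)
  then show "h \<in> S" using csub_sum[OF assms(1), of F "\<lambda>g. g" c] assms(2) by auto
qed

lemma cspan_incl: "T \<subseteq> cspan T"
proof
  fix f assume "f \<in> T"
  then show "f \<in> cspan T"
    by (auto simp: cspan_def intro!: exI[of _ "{f}"] exI[of _ "\<lambda>_. 1"])
qed

lemma csub_cspan: "csub (cspan T)"
  unfolding csub_def
proof (intro conjI ballI allI)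
  show "(\<lambda>w. 0) \<in> cspan T" by (auto simp: cspan_def intro!: exI[of _ "{}"])
next
  fix f g a b assume "f \<in> cspan T" "g \<in> cspan T"
  then obtain F c F' c' where F: "finite F" "F \<subseteq> T" "f = (\<lambda>w. \<Sum>g\<in>F. c g * g w)"
    and F': "finite F'" "F' \<subseteq> T" "g = (\<lambda>w. \<Sum>g\<in>F'. c' g * g w)"
    by (auto simp: cspan_def)
  let ?c = "\<lambda>g. (if g \<in> F then a * c g else 0) + (if g \<in> F' then b * c' g else 0)"
  have "a * f w + b * g w = (\<Sum>h\<in>F \<union> F'. ?c h * h w)" for w
  proof -
    have "a * f w = (\<Sum>h\<in>F. (if h \<in> F then a * c h else 0) * h w)"
      unfolding F(3) sum_distrib_left by (intro sum.cong) auto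
    also have "\<dots> = (\<Sum>h\<in>F \<union> F'. (if h \<in> F then a * c h else 0) * h w)"
      by (rule sum.mono_neutral_left) (use F F' in auto)
    finally have 1: "a * f w = (\<Sum>h\<in>F \<union> F'. (if h \<in> F then a * c h else 0) * h w)" .
    have "b * g w = (\<Sum>h\<in>F'. (if h \<in> F' then b * c' h else 0) * h w)"
      unfolding F'(3) sum_distrib_left by (intro sum.cong) auto
    also have "\<dots> = (\<Sum>h\<in>F \<union> F'. (if h \<in> F' then b * c' h else 0) * h w)"
      by (rule sum.mono_neutral_left) (use F F' in auto)
    finally show ?thesis unfolding 1 by (simp add: ring_distribs sum.distrib)
  qed
  then show "(\<lambda>w. a * f w + b * g w) \<in> cspan T"
    unfolding cspan_def using F F' by (auto intro!: exI[of _ "F \<union> F'"] exI[of _ ?c])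
qed

text \<open>Gram-Schmidt one coordinate at a time, without choosing a basis. The vectors of
  \<open>S\<close> vanishing at \<open>w0\<close> form a subspace \<open>S0\<close> of codimension
  at most one, to which the induction hypothesis applies; if \<open>S\<close> is larger, one further
  direction orthogonal to \<open>S0\<close> completes the projection.\<close>

lemma orth_proj_ex:
  assumes "finite W" "csub S" "\<And>h w. h \<in> S \<Longrightarrow> w \<notin> W \<Longrightarrow> h w = 0"
  shows "\<exists>g\<in>S. \<forall>h\<in>S. (\<Sum>w\<in>W. (f w - g w) * cnj (h w)) = 0"
  using assms
proof (induction W arbitrary: S f rule: finite_induct)
  case empty
  then show ?case using csub0 by auto
next
  case (insert w0 W)
  define S0 where "S0 = {h\<in>S. h w0 = 0}"
  have sub0: "csub S0" using insert.prems(1) by (auto simp: S0_def csub_def)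
  have "\<exists>g\<in>S0. \<forall>h\<in>S0. (\<Sum>w\<in>W. (f w - g w) * cnj (h w)) = 0" for f
  proof (rule insert.IH[OF sub0])
    fix h w assume "h \<in> S0" "w \<notin> W"
    then show "h w = 0" using insert.prems(2)[of h w] by (cases "w = w0") (auto simp: S0_def)
  qed
  then have ex0: "\<exists>g\<in>S0. \<forall>h\<in>S0. (\<Sum>w\<in>insert w0 W. (f w - g w) * cnj (h w)) = 0" for f
    using insert.hyps by (simp add: S0_def)
  show ?case
  proof (cases "S = S0")
    case True
    then show ?thesis using ex0 by simp
  next
    case False
    then obtain h0 where h0: "h0 \<in> S" "h0 w0 \<noteq> 0" by (auto simp: S0_def)
    obtain p0 where p0: "p0 \<in> S0"
      "\<And>h. h \<in> S0 \<Longrightarrow> (\<Sum>w\<in>insert w0 W. (h0 w - p0 w) * cnj (h w)) = 0"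
      using ex0[of h0] by blast
    \<comment> \<open>\<open>h1\<close> spans the orthogonal complement of \<open>S0\<close> in
      \<open>S\<close>: since its coordinate at \<open>w0\<close> is nonzero, a suitable multiple of
      it brings any member of \<open>S\<close> into \<open>S0\<close>.\<close>
    define h1 where "h1 = (\<lambda>w. h0 w - p0 w)"
    have h1: "h1 \<in> S" "h1 w0 \<noteq> 0"
      using csub_diff[OF insert.prems(1) h0(1), of p0] p0(1) h0(2) by (auto simp: h1_def S0_def)
    have orth: "(\<Sum>w\<in>insert w0 W. h1 w * cnj (h w)) = 0" if "h \<in> S0" for h
      using p0(2)[OF that] by (simp add: h1_def)
    have orth': "(\<Sum>w\<in>insert w0 W. h w * cnj (h1 w)) = 0" if "h \<in> S0" for h
    proof -
      have "(\<Sum>w\<in>insert w0 W. h w * cnj (h1 w)) = cnj (\<Sum>w\<in>insert w0 W. h1 w * cnj (h w))"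
        unfolding cnj_sum by (rule sum.cong) (auto simp: mult.commute)
      with orth[OF that] show ?thesis by simp
    qed
    define N where "N = (\<Sum>w\<in>insert w0 W. h1 w * cnj (h1 w))"
    have "N = of_real (\<Sum>w\<in>insert w0 W. (cmod (h1 w))\<^sup>2)"
      unfolding N_def of_real_sum by (intro sum.cong refl) (simp add: complex_norm_square[symmetric])
    moreover have "(\<Sum>w\<in>insert w0 W. (cmod (h1 w))\<^sup>2) > 0"
      using insert.hyps h1(2) by (intro sum_pos2[where i = w0]) auto
    ultimately have N: "N \<noteq> 0" by (metis less_irrefl of_real_eq_0_iff)
    obtain q where q: "q \<in> S0"
      "\<And>h. h \<in> S0 \<Longrightarrow> (\<Sum>w\<in>insert w0 W. (f w - q w) * cnj (h w)) = 0"
      using ex0[of f] by blast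
    define c where "c = (\<Sum>w\<in>insert w0 W. f w * cnj (h1 w)) / N"
    define g where "g = (\<lambda>w. 1 * q w + c * h1 w)"
    have gS: "g \<in> S" unfolding g_def
      by (rule csub_lin[OF insert.prems(1)]) (use q h1 in \<open>auto simp: S0_def\<close>)
    moreover have "(\<Sum>w\<in>insert w0 W. (f w - g w) * cnj (h w)) = 0" if h: "h \<in> S" for h
    proof -
      define t where "t = h w0 / h1 w0"
      define h' where "h' = (\<lambda>w. h w - t * h1 w)"
      have h': "h' \<in> S0"
        using csub_lin[OF insert.prems(1) h h1(1), of 1 "- t"] h1(2)
        by (simp add: h'_def S0_def t_def)
      have 1: "(\<Sum>w\<in>insert w0 W. (f w - g w) * cnj (h' w)) = 0"
      proof -
        have "(\<Sum>w\<in>insert w0 W. (f w - g w) * cnj (h' w))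
           = (\<Sum>w\<in>insert w0 W. (f w - q w) * cnj (h' w)) - c * (\<Sum>w\<in>insert w0 W. h1 w * cnj (h' w))"
          unfolding sum_distrib_left sum_subtractf[symmetric]
          by (rule sum.cong) (auto simp: g_def algebra_simps)
        then show ?thesis using q(2)[OF h'] orth[OF h'] by simp
      qed
      have 2: "(\<Sum>w\<in>insert w0 W. (f w - g w) * cnj (h1 w)) = 0"
      proof -
        have "(\<Sum>w\<in>insert w0 W. (f w - g w) * cnj (h1 w))
           = (\<Sum>w\<in>insert w0 W. f w * cnj (h1 w)) - (\<Sum>w\<in>insert w0 W. q w * cnj (h1 w)) - c * N"
          unfolding N_def sum_distrib_left sum_subtractf[symmetric]
          by (rule sum.cong) (auto simp: g_def algebra_simps)
        then show ?thesis using orth'[OF q(1)] N by (simp add: c_def)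
      qed
      have "(\<Sum>w\<in>insert w0 W. (f w - g w) * cnj (h w))
          = (\<Sum>w\<in>insert w0 W. (f w - g w) * cnj (h' w)) + cnj t * (\<Sum>w\<in>insert w0 W. (f w - g w) * cnj (h1 w))"
        unfolding sum_distrib_left sum.distrib[symmetric]
        by (rule sum.cong) (auto simp: h'_def algebra_simps)
      then show ?thesis using 1 2 by simp
    qed
    ultimately show ?thesis by blast
  qed
qed

lemma orth_decomp:
  assumes "csub S" "S \<subseteq> Vec N" "f \<in> Vec N"
  obtains g where "g \<in> S" "\<And>h. h \<in> S \<Longrightarrow> ip (\<lambda>w. f w - g w) h = 0"
proof -
  have "\<exists>g\<in>S. \<forall>h\<in>S. (\<Sum>w\<in>words N. (f w - g w) * cnj (h w)) = 0"
    by (rule orth_proj_ex[OF finite_words assms(1)]) (use assms(2) VecD in blast)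
  then obtain g where
    g: "g \<in> S" "\<And>h. h \<in> S \<Longrightarrow> (\<Sum>w\<in>words N. (f w - g w) * cnj (h w)) = 0"
    by blast
  have "(\<lambda>w. f w - g w) \<in> Vec N" using csub_diff[OF csub_Vec assms(3)] g(1) assms(2) by auto
  then show ?thesis using g that by (simp add: ip_eq)
qed

text \<open>\<open>oproj\<close> is a definite description, so a candidate can be substituted only
  after uniqueness is known: the difference of two candidates lies in \<open>S\<close> and is
  orthogonal to itself.\<close>

lemma oproj_eqI:
  assumes "csub S" "S \<subseteq> Vec N" "f \<in> Vec N" "g \<in> S"
    and "\<And>h. h \<in> S \<Longrightarrow> ip (\<lambda>w. f w - g w) h = 0"
  shows "oproj S f = g"
  unfolding oproj_def
proof (rule the_equality)
  show "g \<in> S \<and> (\<forall>h\<in>S. ip (\<lambda>w. f w - g w) h = 0)" using assms by blast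
next
  fix g' assume g': "g' \<in> S \<and> (\<forall>h\<in>S. ip (\<lambda>w. f w - g' w) h = 0)"
  define h where "h = (\<lambda>w. g w - g' w)"
  have hS: "h \<in> S" unfolding h_def using csub_diff[OF assms(1)] assms(4) g' by blast
  have V: "f \<in> Vec N" "g \<in> Vec N" "g' \<in> Vec N" "h \<in> Vec N" using assms g' hS by auto
  have "ip h h = ip (\<lambda>w. f w - g' w) h - ip (\<lambda>w. f w - g w) h"
    using csub_diff[OF csub_Vec V(1) V(2)] csub_diff[OF csub_Vec V(1) V(3)] V(4)
    by (simp add: ip_eq h_def sum_subtractf[symmetric] algebra_simps)
  also have "\<dots> = 0" using assms(5)[OF hS] g' hS by simp
  finally have "h = (\<lambda>w. 0)" using ip_self_eq_0 V(4) by blast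
  then show "g' = g" by (auto simp: h_def fun_eq_iff)
qed

text \<open>\<open>P u\<close> is the orthogonal projection of the basis vector at \<open>u\<close>.
  This reproducing kernel expands every member of \<open>S\<close> in members of \<open>S\<close>,
  replacing a choice of basis.\<close>

lemma oproj_ex_kernel:
  assumes "csub S" "S \<subseteq> Vec N"
  obtains P where "\<And>u. P u \<in> S"
    and "\<And>f w. f \<in> S \<Longrightarrow> f w = (\<Sum>u\<in>words N. f u * P u w)"
proof -
  define e where "e u = (\<lambda>w. if w = u \<and> u \<in> words N then 1 else (0::complex))" for u
  have "\<exists>g. g \<in> S \<and> (\<forall>h\<in>S. ip (\<lambda>w. e u w - g w) h = 0)" for u
    by (rule orth_decomp[OF assms, of "e u"]) (auto simp: e_def Vec_def)
  then obtain P where P: "\<And>u. P u \<in> S" "\<And>u h. h \<in> S \<Longrightarrow> ip (\<lambda>w. e u w - P u w) h = 0"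
    by metis
  have "f = (\<lambda>w. \<Sum>u\<in>words N. f u * P u w)" if f: "f \<in> S" for f
  proof -
    define h where "h = (\<lambda>w. f w - (\<Sum>u\<in>words N. f u * P u w))"
    have hS: "h \<in> S" unfolding h_def
      by (intro csub_diff[OF assms(1)] csub_sum[OF assms(1)] f P)
    have fe: "f w = (\<Sum>u\<in>words N. f u * e u w)" for w
    proof -
      have "(\<Sum>u\<in>words N. f u * e u w) = (\<Sum>u\<in>words N. if u = w then f u else 0)"
        by (intro sum.cong) (auto simp: e_def)
      then show ?thesis using f assms(2) by (auto simp: Vec_def)
    qed
    have eV: "(\<lambda>w. e u w - P u w) \<in> Vec N" for u
      using P(1)[of u] assms(2) by (intro csub_diff[OF csub_Vec]) (auto simp: e_def Vec_def)
    have "ip h h = (\<Sum>w\<in>words N. h w * cnj (h w))" using hS assms(2) by (intro ip_eq) auto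
    also have "\<dots> = (\<Sum>w\<in>words N. \<Sum>u\<in>words N. f u * ((e u w - P u w) * cnj (h w)))"
    proof (rule sum.cong[OF refl])
      fix w
      have "h w = (\<Sum>u\<in>words N. f u * (e u w - P u w))"
        unfolding h_def by (subst fe) (simp add: sum_subtractf algebra_simps)
      then show "h w * cnj (h w) = (\<Sum>u\<in>words N. f u * ((e u w - P u w) * cnj (h w)))"
        by (simp add: sum_distrib_right mult.assoc)
    qed
    also have "\<dots> = (\<Sum>u\<in>words N. f u * ip (\<lambda>w. e u w - P u w) h)"
      unfolding ip_eq[OF eV] sum_distrib_left by (rule sum.swap)
    also have "\<dots> = 0" using P(2)[OF hS] by simp
    finally have "ip h h = 0" .
    moreover have "h \<in> Vec N" using hS assms(2) by blast
    ultimately have "h = (\<lambda>w. 0)" by (intro ip_self_eq_0)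
    then have "h w = 0" for w by simp
    then show ?thesis unfolding h_def by (intro ext) (rule eq_iff_diff_eq_0[THEN iffD2])
  qed
  then have "f w = (\<Sum>u\<in>words N. f u * P u w)" if "f \<in> S" for f w
    by (rule fun_cong) (rule that)
  with P(1) show ?thesis by (rule that)
qed

section \<open>Slices of tensors and tensor products of subspaces\<close>

definition lslice :: "nat list \<Rightarrow> vec \<Rightarrow> vec" where
  "lslice x f = (\<lambda>v. f (x @ v))"

text \<open>The guard on the length keeps the slice inside \<open>Vec a\<close> for every list
  \<open>y\<close>, also for one of the wrong length.\<close>

definition rslice :: "nat \<Rightarrow> nat list \<Rightarrow> vec \<Rightarrow> vec" where
  "rslice a y f = (\<lambda>u. if length u = a then f (u @ y) else 0)"

lemma rslice_Vec:
  assumes "f \<in> Vec (a + b)"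
  shows "rslice a y f \<in> Vec a"
proof -
  have "f (u @ y) = 0" if "length u = a" "u \<notin> words a" for u
    using that by (intro VecD[OF assms]) (auto simp: words_def)
  then show ?thesis by (auto simp: Vec_def rslice_def)
qed

lemma lslice_Vec:
  assumes "f \<in> Vec (a + b)" "length x = a"
  shows "lslice x f \<in> Vec b"
  using assms by (auto simp: Vec_def lslice_def words_append)

lemma tens_app: "length u = a \<Longrightarrow> tens a f g (u @ v) = f u * g v"
  by (simp add: tens_def)

lemma tens_Vec:
  assumes "f \<in> Vec a" "g \<in> Vec b"
  shows "tens a f g \<in> Vec (a + b)"
proof -
  have "tens a f g w = 0" if "w \<notin> words (a + b)" for w
  proof (rule ccontr)
    assume "tens a f g w \<noteq> 0"
    then have "take a w \<in> words a" "drop a w \<in> words b"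
      using assms by (auto simp: tens_def Vec_def)
    then have "take a w @ drop a w \<in> words (a + b)" by (subst words_append) (auto simp: words_def)
    with that show False by simp
  qed
  then show ?thesis by (simp add: Vec_def)
qed

text \<open>This is A \<otimes> B = (A \<otimes> V) \<inter> (V \<otimes> B), tested on slices. It
  replaces spans of elementary tensors by pointwise conditions everywhere below. One inclusion holds
  because the right side is a subspace containing the elementary tensors; the other applies the
  reproducing kernels of both factors.\<close>

lemma tensS_iff:
  assumes A: "csub A" "A \<subseteq> Vec a" and B: "csub B" "B \<subseteq> Vec b"
  shows "f \<in> tensS a A B \<longleftrightarrow> f \<in> Vec (a + b)
     \<and> (\<forall>y\<in>words b. rslice a y f \<in> A) \<and> (\<forall>x\<in>words a. lslice x f \<in> B)"
proof
  let ?R' = "{f \<in> Vec (a + b). (\<forall>y\<in>words b. rslice a y f \<in> A) \<and> (\<forall>x\<in>words a. lslice x f \<in> B)}"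
  assume f: "f \<in> tensS a A B"
  have "csub ?R'" unfolding csub_def
  proof (intro conjI ballI allI)
    have "rslice a y (\<lambda>w. 0) \<in> A" "lslice x (\<lambda>w. 0) \<in> B" for x y
      using csub0[OF A(1)] csub0[OF B(1)] by (simp_all add: rslice_def lslice_def)
    then show "(\<lambda>w. 0) \<in> ?R'" using csub0[OF csub_Vec] by simp
  next
    fix g h s t assume g: "g \<in> ?R'" and h: "h \<in> ?R'"
    have "rslice a y (\<lambda>w. s * g w + t * h w) = (\<lambda>w. s * rslice a y g w + t * rslice a y h w)"
      "lslice x (\<lambda>w. s * g w + t * h w) = (\<lambda>w. s * lslice x g w + t * lslice x h w)" for x y
      by (auto simp: rslice_def lslice_def)
    then show "(\<lambda>w. s * g w + t * h w) \<in> ?R'"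
      using g h csub_lin[OF A(1)] csub_lin[OF B(1)] csub_lin[OF csub_Vec] by simp
  qed
  moreover have "{tens a f g |f g. f \<in> A \<and> g \<in> B} \<subseteq> ?R'"
  proof clarify
    fix g h assume gh: "g \<in> A" "h \<in> B"
    have "rslice a y (tens a g h) = (\<lambda>w. h y * g w)" for y
      using gh A(2) by (auto simp: rslice_def tens_app fun_eq_iff Vec_length)
    moreover have "lslice x (tens a g h) = (\<lambda>w. g x * h w)" if "x \<in> words a" for x
      using that by (auto simp: lslice_def tens_app words_def)
    ultimately show "tens a g h \<in> Vec (a + b) \<and> (\<forall>y\<in>words b. rslice a y (tens a g h) \<in> A)
        \<and> (\<forall>x\<in>words a. lslice x (tens a g h) \<in> B)"
      using tens_Vec[of g a h b] gh A B csub_scale by auto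
  qed
  ultimately show "f \<in> Vec (a + b)
     \<and> (\<forall>y\<in>words b. rslice a y f \<in> A) \<and> (\<forall>x\<in>words a. lslice x f \<in> B)"
    using cspan_subset f unfolding tensS_def by blast
next
  assume f: "f \<in> Vec (a + b)
     \<and> (\<forall>y\<in>words b. rslice a y f \<in> A) \<and> (\<forall>x\<in>words a. lslice x f \<in> B)"
  obtain P where P: "\<And>u. P u \<in> A" "\<And>g w. g \<in> A \<Longrightarrow> g w = (\<Sum>u\<in>words a. g u * P u w)"
    using oproj_ex_kernel[OF A] by metis
  obtain Q where Q: "\<And>u. Q u \<in> B" "\<And>g w. g \<in> B \<Longrightarrow> g w = (\<Sum>u\<in>words b. g u * Q u w)"
    using oproj_ex_kernel[OF B] by metis
  have 1: "f (x @ y) = (\<Sum>u\<in>words a. f (u @ y) * P u x)" if "x \<in> words a" "y \<in> words b" for x y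
  proof -
    have "f (x @ y) = rslice a y f x" unfolding rslice_def using wordsD[OF that(1)] by simp
    also have "\<dots> = (\<Sum>u\<in>words a. rslice a y f u * P u x)" by (rule P(2)) (use f that in blast)
    also have "\<dots> = (\<Sum>u\<in>words a. f (u @ y) * P u x)"
      by (intro sum.cong) (auto simp: rslice_def words_def)
    finally show ?thesis .
  qed
  have 2: "f (x @ y) = (\<Sum>v\<in>words b. f (x @ v) * Q v y)" if "x \<in> words a" for x y
  proof -
    have "lslice x f \<in> B" using f that by blast
    from Q(2)[OF this, of y] show ?thesis unfolding lslice_def .
  qed
  \<comment> \<open>Reproducing \<open>f\<close> in the left and in the right legs at once displays
    it as a combination of the elementary tensors of \<open>P u\<close> and
    \<open>Q v\<close>.\<close>
  define g where "g = (\<lambda>w. \<Sum>u\<in>words a. 1 * (\<lambda>w. \<Sum>v\<in>words b. f (u @ v) * tens a (P u) (Q v) w) w)"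
  have T: "tens a (P u) (Q v) \<in> tensS a A B" for u v
    unfolding tensS_def using P(1)[of u] Q(1)[of v] by (intro subsetD[OF cspan_incl]) blast
  have sT: "csub (tensS a A B)" unfolding tensS_def by (rule csub_cspan)
  have gT: "g \<in> tensS a A B" unfolding g_def by (intro csub_sum[OF sT] T)
  have "f = g"
  proof (rule Vec_eqI)
    show "f \<in> Vec (a + b)" using f by blast
    show "g \<in> Vec (a + b)" unfolding g_def
      by (intro csub_sum[OF csub_Vec] tens_Vec subsetD[OF A(2)] subsetD[OF B(2)] P(1) Q(1))
    fix w assume "w \<in> words (a + b)"
    then obtain x y where xy: "w = x @ y" "x \<in> words a" "y \<in> words b" by (rule split_word_at)
    have "f w = (\<Sum>u\<in>words a. f (u @ y) * P u x)" unfolding xy(1) by (rule 1[OF xy(2,3)])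
    also have "\<dots> = (\<Sum>u\<in>words a. (\<Sum>v\<in>words b. f (u @ v) * Q v y) * P u x)"
      by (intro sum.cong[OF refl] arg_cong2[where f = "(*)"] 2 refl)
    also have "\<dots> = (\<Sum>u\<in>words a. \<Sum>v\<in>words b. f (u @ v) * tens a (P u) (Q v) w)"
      unfolding sum_distrib_right xy(1) tens_app[OF wordsD[OF xy(2)]]
      by (intro sum.cong refl) simp
    also have "\<dots> = g w" by (simp add: g_def)
    finally show "f w = g w" .
  qed
  with gT show "f \<in> tensS a A B" by simp
qed

section \<open>Symmetric tensors and the invariant vector\<close>

abbreviation zc :: "nat list \<Rightarrow> nat" where
  "zc w \<equiv> count_list w 0"

lemma zc_le: "w \<in> words n \<Longrightarrow> zc w \<le> n"
  using count_le_length[of w 0] by (simp add: words_def)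

lemma mset_word:
  "set w \<subseteq> {0,1} \<Longrightarrow> mset w = replicate_mset (zc w) 0 + replicate_mset (length w - zc w) (1::nat)"
proof (induction w)
  case (Cons c w)
  then show ?case using count_le_length[of w 0] by (auto simp: Suc_diff_le)
qed simp

lemma zc_eq_permute:
  assumes "w \<in> words n" "w' \<in> words n" "zc w = zc w'"
  obtains p where "p permutes {..<n}" "permute_list p w' = w"
proof -
  have "mset w = mset w'" using assms mset_word by (simp add: words_def)
  then show ?thesis using that assms(2) by (elim mset_eq_permutation) (simp add: words_def)
qed

lemma zc_permute_list: "p permutes {..<length w} \<Longrightarrow> zc (permute_list p w) = zc w"
  by (metis count_mset mset_permute_list)

text \<open>Two words over {0,1} of equal length with equally many zeros are permutations of each
  other, so the orbits of the symmetric group are the level sets of \<open>zc\<close>.\<close>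

lemma Lsym_iff:
  "f \<in> Lsym n \<longleftrightarrow> f \<in> Vec n \<and> (\<forall>w\<in>words n. \<forall>w'\<in>words n. zc w = zc w' \<longrightarrow> f w = f w')"
proof (intro iffI conjI ballI impI)
  assume f: "f \<in> Lsym n"
  then show "f \<in> Vec n" by (simp add: Lsym_def)
  fix w w' assume w: "w \<in> words n" "w' \<in> words n" "zc w = zc w'"
  then obtain p where "p permutes {..<n}" "permute_list p w' = w" by (rule zc_eq_permute)
  with f w(2) show "f w = f w'" by (auto simp: Lsym_def permute_list_def words_def)
next
  assume f: "f \<in> Vec n \<and> (\<forall>w\<in>words n. \<forall>w'\<in>words n. zc w = zc w' \<longrightarrow> f w = f w')"
  have "f (map (\<lambda>i. w ! p i) [0..<n]) = f w" if p: "p permutes {..<n}" and w: "w \<in> words n" for p w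
  proof -
    have eq: "map (\<lambda>i. w ! p i) [0..<n] = permute_list p w"
      using wordsD[OF w] by (simp add: permute_list_def)
    have "permute_list p w \<in> words n" using p w by (simp add: words_def)
    moreover have "zc (permute_list p w) = zc w" using p w by (simp add: zc_permute_list words_def)
    ultimately show ?thesis using f w eq by metis
  qed
  moreover have "f \<in> Vec n" using f ..
  ultimately show "f \<in> Lsym n" by (simp add: Lsym_def)
qed

lemma csub_Lsym: "csub (Lsym n)"
  unfolding csub_def
proof (intro conjI ballI allI)
  show "(\<lambda>w. 0) \<in> Lsym n" using csub0[OF csub_Vec] by (simp add: Lsym_iff)
next
  fix f g a b assume fg: "f \<in> Lsym n" "g \<in> Lsym n"
  have "f w = f w' \<and> g w = g w'" if "w \<in> words n" "w' \<in> words n" "zc w = zc w'" for w w'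
    using fg that unfolding Lsym_iff by metis
  then show "(\<lambda>w. a * f w + b * g w) \<in> Lsym n"
    using fg csub_lin[OF csub_Vec] unfolding Lsym_iff by metis
qed

lemma Lsym_Vec: "Lsym n \<subseteq> Vec n"
  by (auto simp: Lsym_def)

lemma words_Suc: "words (Suc n) = Cons 0 ` words n \<union> Cons 1 ` words n"
proof
  show "words (Suc n) \<subseteq> Cons 0 ` words n \<union> Cons 1 ` words n"
  proof
    fix w assume "w \<in> words (Suc n)"
    then show "w \<in> Cons 0 ` words n \<union> Cons 1 ` words n" by (cases w) (auto simp: words_def)
  qed
qed (auto simp: words_def)

lemma card_words_zc: "card {w\<in>words n. zc w = k} = n choose k"
proof (induction n arbitrary: k)
  case 0
  have "{w\<in>words 0. zc w = k} = (if k = 0 then {[]} else {})" by auto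
  then show ?case by simp
next
  case (Suc n)
  have "{w\<in>words (Suc n). zc w = k} =
      Cons 0 ` {w\<in>words n. Suc (zc w) = k} \<union> Cons 1 ` {w\<in>words n. zc w = k}"
    by (auto simp: words_Suc)
  moreover have "card (Cons 0 ` {w\<in>words n. Suc (zc w) = k} \<union> Cons (1::nat) ` {w\<in>words n. zc w = k})
      = card {w\<in>words n. Suc (zc w) = k} + card {w\<in>words n. zc w = k}"
    by (subst card_Un_disjoint) (auto simp: card_image)
  moreover have "card {w\<in>words n. Suc (zc w) = k} = (case k of 0 \<Rightarrow> 0 | Suc k \<Rightarrow> n choose k)"
    by (cases k) (auto simp: Suc.IH)
  ultimately show ?case by (cases k) (simp_all add: Suc.IH)
qed

lemma sum_words_zc:
  fixes \<phi> :: "nat \<Rightarrow> 'a::comm_semiring_1"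
  shows "(\<Sum>w\<in>words n. \<phi> (zc w)) = (\<Sum>k\<le>n. of_nat (n choose k) * \<phi> k)"
proof -
  have "(\<Sum>k\<le>n. of_nat (n choose k) * \<phi> k) = (\<Sum>k\<le>n. \<Sum>w\<in>{w\<in>words n. zc w = k}. \<phi> (zc w))"
    by (rule sum.cong) (auto simp: card_words_zc)
  also have "\<dots> = (\<Sum>w\<in>words n. \<phi> (zc w))"
    by (rule sum.group) (auto dest: zc_le)
  finally show ?thesis by simp
qed

lemma zc_word_sum_zc_eq:
  assumes "k \<le> n"
  shows "(\<Sum>w\<in>words n. if zc w = k then 1 / of_nat (n choose k) else 0) = (1::complex)"
proof -
  have "(\<Sum>w\<in>words n. if zc w = k then 1 / of_nat (n choose k) else 0)
      = (\<Sum>j\<le>n. of_nat (n choose j) * (if j = k then 1 / of_nat (n choose k) else (0::complex)))"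
    by (rule sum_words_zc)
  also have "\<dots> = (\<Sum>j\<le>n. if j = k then 1 else 0)"
    using assms by (intro sum.cong) auto
  finally show ?thesis using assms by simp
qed

text \<open>Symmetrizing a basis word with k zeros spreads its unit mass evenly over the
  \<open>n choose k\<close> words of its orbit; the factor sqrt(\<open>n choose k\<close>) in front
  then leaves the reciprocal square root.\<close>

lemma ebasis_eq:
  assumes "k \<le> n"
  shows "ebasis n k w = (if w \<in> words n \<and> zc w = k then 1 / of_real (sqrt (n choose k)) else 0)"
proof -
  define w0 :: "nat list" where "w0 = replicate k 0 @ replicate (n - k) 1"
  define g :: vec where "g = (\<lambda>w. if w \<in> words n \<and> zc w = k then 1 / of_nat (n choose k) else 0)"
  have zr: "zc (replicate m 1) = 0" "zc (replicate m 0) = m" for m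
    by (induction m) auto
  have w0: "w0 \<in> words n" "zc w0 = k" using assms zr by (auto simp: w0_def words_def)
  have gV: "g \<in> Vec n" by (auto simp: g_def Vec_def)
  have e: "(\<lambda>v. if v = w0 then 1 else 0) \<in> Vec n" using w0 by (auto simp: Vec_def)
  have "oproj (Lsym n) (\<lambda>v. if v = w0 then 1 else 0) = g"
  proof (rule oproj_eqI[OF csub_Lsym Lsym_Vec e])
    show "g \<in> Lsym n" using gV by (simp add: Lsym_iff g_def)
    fix h assume h: "h \<in> Lsym n"
    have "ip (\<lambda>w. (if w = w0 then 1 else 0) - g w) h
        = (\<Sum>w\<in>words n. (if w = w0 then 1 else 0) * cnj (h w)) - (\<Sum>w\<in>words n. g w * cnj (h w))"
      unfolding ip_eq[OF csub_diff[OF csub_Vec e gV]] by (simp add: left_diff_distrib sum_subtractf)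
    also have "(\<Sum>w\<in>words n. (if w = w0 then 1 else 0) * cnj (h w)) = cnj (h w0)"
      using w0 by (simp add: if_distrib[of "\<lambda>x. x * _"] cong: if_cong)
    also have "(\<Sum>w\<in>words n. g w * cnj (h w))
        = (\<Sum>w\<in>words n. (if zc w = k then 1 / of_nat (n choose k) else 0) * cnj (h w0))"
    proof (rule sum.cong[OF refl])
      fix w assume w: "w \<in> words n"
      show "g w * cnj (h w) = (if zc w = k then 1 / of_nat (n choose k) else 0) * cnj (h w0)"
      proof (cases "zc w = k")
        case True
        then have "h w = h w0" using h w w0 unfolding Lsym_iff by metis
        with True w show ?thesis by (simp add: g_def)
      qed (simp add: g_def)
    qed
    also have "\<dots> = cnj (h w0)"
      unfolding sum_distrib_right[symmetric] zc_word_sum_zc_eq[OF assms] by simp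
    finally show "ip (\<lambda>w. (if w = w0 then 1 else 0) - g w) h = 0" by simp
  qed
  then have "ebasis n k w = of_real (sqrt (n choose k)) * g w"
    unfolding ebasis_def w0_def by simp
  moreover have "of_real (sqrt (n choose k)) / of_nat (n choose k) = 1 / complex_of_real (sqrt (n choose k))"
  proof -
    have "sqrt (n choose k) / real (n choose k) = 1 / sqrt (n choose k)"
      by (simp add: real_div_sqrt divide_simps)
    then have "complex_of_real (sqrt (n choose k) / real (n choose k)) = of_real (1 / sqrt (n choose k))"
      by (rule arg_cong)
    then show ?thesis by simp
  qed
  ultimately show ?thesis by (simp add: g_def)
qed

section \<open>Coefficients and scalar products of \<delta>\<close>

lemma delta_Vec: "delta n \<in> Vec (2 * n)"
proof -
  have "ebasis n k \<in> Vec n" if "k \<le> n" for k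
    using that by (auto simp: Vec_def ebasis_eq)
  then have t: "tens n (ebasis n k) (ebasis n (n - k)) \<in> Vec (n + n)" if "k \<le> n" for k
    using that by (intro tens_Vec) auto
  have "(\<lambda>w. \<Sum>k\<le>n. (-1) ^ k * tens n (ebasis n k) (ebasis n (n - k)) w) \<in> Vec (n + n)"
    by (rule csub_sum[OF csub_Vec]) (use t in auto)
  from csub_scale[OF csub_Vec this] show ?thesis unfolding delta_def mult_2 .
qed

definition dform :: "nat \<Rightarrow> nat \<Rightarrow> nat \<Rightarrow> complex" where
  "dform n a b = (if a + b = n then (-1) ^ a / (of_real (sqrt (n + 1)) * of_nat (n choose a)) else 0)"

lemma delta_app:
  assumes "u \<in> words n" "v \<in> words n"
  shows "delta n (u @ v) = dform n (zc u) (zc v)"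
proof -
  have "(\<Sum>k\<le>n. (-1) ^ k * tens n (ebasis n k) (ebasis n (n - k)) (u @ v))
      = (\<Sum>k\<le>n. if k = zc u then (-1) ^ k * ebasis n k u * ebasis n (n - k) v else 0)"
    using assms by (intro sum.cong) (auto simp: tens_app[OF wordsD[OF assms(1)]] ebasis_eq)
  also have "\<dots> = (-1) ^ zc u * ebasis n (zc u) u * ebasis n (n - zc u) v"
    using zc_le[OF assms(1)] by simp
  also have "\<dots> = (if zc u + zc v = n then (-1) ^ zc u / of_nat (n choose zc u) else 0)"
  proof -
    have "n choose (n - zc u) = n choose zc u"
      using zc_le[OF assms(1)] by (simp add: binomial_symmetric[symmetric])
    moreover have "complex_of_real (sqrt (n choose zc u)) * of_real (sqrt (n choose zc u)) = of_nat (n choose zc u)"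
      by (simp flip: of_real_mult)
    moreover have "zc v = n - zc u \<longleftrightarrow> zc u + zc v = n" using zc_le[OF assms(1)] by auto
    ultimately show ?thesis using assms zc_le[OF assms(1)] by (simp add: ebasis_eq)
  qed
  finally show ?thesis by (simp add: delta_def dform_def)
qed

lemma cnj_delta [simp]: "cnj (delta n w) = delta n w"
proof (cases "w \<in> words (n + n)")
  case True
  then obtain u v where "w = u @ v" "u \<in> words n" "v \<in> words n" by (rule split_word_at)
  then show ?thesis by (simp add: delta_app dform_def)
qed (use delta_Vec[of n] in \<open>simp add: Vec_def mult_2\<close>)

definition kap :: "nat \<Rightarrow> complex" where
  "kap n = (-1) ^ n / of_nat (n + 1)"

text \<open>The scalar product of the two middle legs of \<open>\<delta> \<otimes> \<delta>\<close>: this gives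
  \<open>(1 \<otimes> \<delta>\<^sup>*)(\<delta> \<otimes> 1) = (\<delta>\<^sup>* \<otimes> 1)(1 \<otimes> \<delta>) = (-1)\<^sup>n / (n + 1)\<close> on \<open>L_n\<close>.\<close>

lemma delta_contract:
  assumes "u \<in> words n" "w \<in> words n"
  shows "(\<Sum>v\<in>words n. delta n (u @ v) * delta n (v @ w))
       = (if zc u = zc w then kap n / of_nat (n choose zc w) else 0)"
proof -
  have z: "zc u \<le> n" "zc w \<le> n" using assms zc_le by auto
  have "(\<Sum>v\<in>words n. delta n (u @ v) * delta n (v @ w))
      = (\<Sum>v\<in>words n. dform n (zc u) (zc v) * dform n (zc v) (zc w))"
    using assms by (intro sum.cong) (auto simp: delta_app)
  also have "\<dots> = (\<Sum>k\<le>n. of_nat (n choose k) * (dform n (zc u) k * dform n k (zc w)))"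
    by (rule sum_words_zc)
  also have "\<dots> = (\<Sum>k\<le>n. if k = n - zc u then of_nat (n choose k) * (dform n (zc u) k * dform n k (zc w)) else 0)"
    using z by (intro sum.cong) (auto simp: dform_def)
  also have "\<dots> = of_nat (n choose (n - zc u)) * (dform n (zc u) (n - zc u) * dform n (n - zc u) (zc w))"
    using z by simp
  also have "\<dots> = (if zc u = zc w then kap n / of_nat (n choose zc w) else 0)"
  proof (cases "zc u = zc w")
    case True
    have "(-1::complex) ^ n = (-1) ^ zc w * (-1) ^ (n - zc w)"
      using z by (simp flip: power_add)
    moreover have "complex_of_real (sqrt (n + 1)) * of_real (sqrt (n + 1)) = of_nat (n + 1)"
      by (simp flip: of_real_mult)
    moreover have "n choose (n - zc w) = n choose zc w"
      using z by (simp add: binomial_symmetric[symmetric])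
    moreover have "c * (a / (s * c) * (b / (s * c))) = (a * b / N) / c"
      if "s * s = N" "c \<noteq> 0" "N \<noteq> 0" for a b c s N :: complex
      using that by (auto simp: field_simps)
    moreover have "of_nat (n choose zc w) \<noteq> (0::complex)" "of_nat (n + 1) \<noteq> (0::complex)"
      using z by (simp, metis of_nat_eq_0_iff Suc_eq_plus1 Suc_not_Zero)
    ultimately show ?thesis using z True
      by (simp add: dform_def kap_def del: of_real_add of_real_of_nat_eq of_nat_add)
  next
    case False
    then show ?thesis using z by (simp add: dform_def)
  qed
  finally show ?thesis .
qed

text \<open>Exchanging the two legs multiplies \<delta> by (-1)^n. Hence the squared norm is (-1)^n
  times the trace of the contraction in \<open>delta_contract\<close>, and that trace is (n+1) times
  \<open>kap\<close>.\<close>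

lemma delta_norm: "(\<Sum>w\<in>words (2 * n). delta n w * delta n w) = 1"
proof -
  have sw: "delta n (v @ u) = (-1) ^ n * delta n (u @ v)" if "u \<in> words n" "v \<in> words n" for u v
  proof (cases "zc u + zc v = n")
    case True
    then have "n choose zc v = n choose zc u" using binomial_symmetric[of "zc u" n] by auto
    moreover have "(-1::complex) ^ n * (-1) ^ zc u = (-1) ^ zc v"
      using True by (metis (no_types) add.commute left_minus_one_mult_self mult.commute power_add)
    ultimately show ?thesis using that True by (simp add: delta_app dform_def add.commute)
  qed (use that in \<open>auto simp: delta_app dform_def\<close>)
  have "(\<Sum>w\<in>words (2 * n). delta n w * delta n w)
      = (\<Sum>u\<in>words n. \<Sum>v\<in>words n. delta n (u @ v) * delta n (u @ v))"
    unfolding mult_2 by (rule sum_words_append)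
  also have "\<dots> = (\<Sum>u\<in>words n. (-1) ^ n * (\<Sum>v\<in>words n. delta n (u @ v) * delta n (v @ u)))"
    unfolding sum_distrib_left
  proof (intro sum.cong refl)
    fix u v assume "u \<in> words n" "v \<in> words n"
    from sw[OF this] have e: "delta n (v @ u) = (-1) ^ n * delta n (u @ v)" .
    have "(-1) ^ n * (delta n (u @ v) * delta n (v @ u)) = ((-1) ^ n * (-1) ^ n) * (delta n (u @ v) * delta n (u @ v))"
      unfolding e by (simp only: mult_ac)
    moreover have "(-1) ^ n * (-1) ^ n = (1::complex)" by simp
    ultimately show "delta n (u @ v) * delta n (u @ v) = (-1) ^ n * (delta n (u @ v) * delta n (v @ u))"
      by (simp only: mult_1)
  qed
  also have "\<dots> = (\<Sum>u\<in>words n. (-1) ^ n * (kap n / of_nat (n choose zc u)))"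
    by (intro sum.cong refl) (simp add: delta_contract)
  also have "\<dots> = (\<Sum>k\<le>n. of_nat (n choose k) * ((-1) ^ n * (kap n / of_nat (n choose k))))"
    by (rule sum_words_zc)
  also have "\<dots> = (\<Sum>k\<le>n. (-1) ^ n * kap n)" by (intro sum.cong) auto
  also have "\<dots> = 1"
  proof -
    have "(1 + of_nat n :: complex) \<noteq> 0" by (metis of_nat_Suc of_nat_eq_0_iff Suc_not_Zero)
    then show ?thesis by (simp add: kap_def)
  qed
  finally show ?thesis .
qed

section \<open>Symmetry block by block: the powers of L_n\<close>

definition symat :: "nat \<Rightarrow> nat \<Rightarrow> vec \<Rightarrow> bool" where
  "symat n a f \<longleftrightarrow> (\<forall>x y w w'. length x = a \<and> w \<in> words n \<and> w' \<in> words n \<and> zc w = zc w'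
      \<longrightarrow> f (x @ w @ y) = f (x @ w' @ y))"

lemma symatD:
  "symat n a f \<Longrightarrow> length x = a \<Longrightarrow> w \<in> words n \<Longrightarrow> w' \<in> words n \<Longrightarrow> zc w = zc w'
    \<Longrightarrow> f (x @ w @ y) = f (x @ w' @ y)"
  unfolding symat_def by blast

lemma symatI:
  "(\<And>x y w w'. length x = a \<Longrightarrow> w \<in> words n \<Longrightarrow> w' \<in> words n \<Longrightarrow> zc w = zc w'
    \<Longrightarrow> f (x @ w @ y) = f (x @ w' @ y)) \<Longrightarrow> symat n a f"
  unfolding symat_def by blast

lemma symat_lin: "symat n a f \<Longrightarrow> symat n a g \<Longrightarrow> symat n a (\<lambda>w. s * f w + t * g w)"
  unfolding symat_def by metis

text \<open>The weights are the matrix entries of c times the projection p_n acting on one block,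
  and p_n fixes vectors symmetric in that block. This is what turns \<open>delta_contract\<close>
  into multiplication by the scalar \<open>kap\<close>.\<close>

lemma symat_average:
  assumes "symat n a f" "length x = a" "w \<in> words n"
  shows "(\<Sum>u\<in>words n. (if zc u = zc w then c / of_nat (n choose zc w) else 0) * f (x @ u @ y))
       = c * f (x @ w @ y)"
proof -
  have "(\<Sum>u\<in>words n. (if zc u = zc w then c / of_nat (n choose zc w) else 0) * f (x @ u @ y))
      = (\<Sum>u\<in>words n. (if zc u = zc w then 1 / of_nat (n choose zc w) else 0) * (c * f (x @ w @ y)))"
  proof (intro sum.cong refl)
    fix u assume u: "u \<in> words n"
    show "(if zc u = zc w then c / of_nat (n choose zc w) else 0) * f (x @ u @ y)
        = (if zc u = zc w then 1 / of_nat (n choose zc w) else 0) * (c * f (x @ w @ y))"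
      using symatD[OF assms(1,2) u assms(3), of y] by (cases "zc u = zc w") simp_all
  qed
  then show ?thesis
    unfolding sum_distrib_right[symmetric] zc_word_sum_zc_eq[OF zc_le[OF assms(3)]] by simp
qed

text \<open>The power L_n^m described by membership conditions instead of spans;
  \<open>Lpow_slots\<close> proves the agreement.\<close>

definition slots :: "nat \<Rightarrow> nat \<Rightarrow> vec set" where
  "slots n m = {f \<in> Vec (n * m). \<forall>j<m. symat n (n * j) f}"

lemma slots_Vec: "slots n m \<subseteq> Vec (n * m)"
  by (auto simp: slots_def)

lemma csub_slots: "csub (slots n m)"
  unfolding csub_def slots_def mem_Collect_eq
proof (intro conjI ballI allI impI)
  show "(\<lambda>w. 0) \<in> Vec (n * m)" by (rule csub0[OF csub_Vec])
  show "symat n (n * j) (\<lambda>w. 0)" for j by (simp add: symat_def)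
qed (auto intro: csub_lin[OF csub_Vec] symat_lin)

lemma Lsym_slots: "Lsym n = slots n 1"
proof -
  have "symat n 0 f \<longleftrightarrow> (\<forall>w\<in>words n. \<forall>w'\<in>words n. zc w = zc w' \<longrightarrow> f w = f w')"
    if f: "f \<in> Vec n" for f
  proof
    assume s: "symat n 0 f"
    show "\<forall>w\<in>words n. \<forall>w'\<in>words n. zc w = zc w' \<longrightarrow> f w = f w'"
    proof (intro ballI impI)
      fix w w' assume "w \<in> words n" "w' \<in> words n" "zc w = zc w'"
      from symatD[OF s _ this, of "[]" "[]"] show "f w = f w'" by simp
    qed
  next
    assume *: "\<forall>w\<in>words n. \<forall>w'\<in>words n. zc w = zc w' \<longrightarrow> f w = f w'"
    have "f (w @ y) = f (w' @ y)" if "w \<in> words n" "w' \<in> words n" "zc w = zc w'" for w w' y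
    proof (cases "y = []")
      case True
      have "f w = f w'" using that * by blast
      with True show ?thesis by simp
    next
      case False
      then have "length (w @ y) \<noteq> n" "length (w' @ y) \<noteq> n" using that wordsD by auto
      then show ?thesis using Vec_length[OF f] by simp
    qed
    then show "symat n 0 f" by (intro symatI) (metis append_Nil length_0_conv)
  qed
  moreover have "f \<in> slots n 1 \<longleftrightarrow> f \<in> Vec n \<and> symat n 0 f" for f
    by (simp add: slots_def)
  ultimately have "f \<in> slots n 1 \<longleftrightarrow> f \<in> Lsym n" for f
    unfolding Lsym_iff by blast
  then show ?thesis by blast
qed

lemma slots_lslice:
  assumes "f \<in> slots n (k + m)" "length x = n * k"
  shows "lslice x f \<in> slots n m"
proof -
  have "symat n (n * j) (lslice x f)" if "j < m" for j
  proof -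
    have "symat n (n * (k + j)) f" using assms(1) that by (simp add: slots_def)
    then have e: "f ((x @ x') @ w @ y) = f ((x @ x') @ w' @ y)"
      if "length x' = n * j" "w \<in> words n" "w' \<in> words n" "zc w = zc w'" for x' w w' y
      using that assms(2) by (intro symatD) (auto simp: algebra_simps)
    show ?thesis
    proof (rule symatI)
      fix x' y w w' :: "nat list" assume a: "length x' = n * j" "w \<in> words n" "w' \<in> words n" "zc w = zc w'"
      from e[OF a, of y] show "lslice x f (x' @ w @ y) = lslice x f (x' @ w' @ y)"
        by (simp add: lslice_def)
    qed
  qed
  moreover have "lslice x f \<in> Vec (n * m)"
    using assms by (intro lslice_Vec[where a = "n * k"]) (auto simp: slots_def algebra_simps)
  ultimately show ?thesis by (simp add: slots_def)
qed

lemma slots_rslice: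
  assumes "f \<in> slots n (k + m)"
  shows "rslice (n * k) y f \<in> slots n k"
proof -
  have "symat n (n * j) (rslice (n * k) y f)" if "j < k" for j
  proof -
    have "symat n (n * j) f" using assms(1) that by (simp add: slots_def)
    then have "f (x' @ w @ z @ y) = f (x' @ w' @ z @ y)"
      if "length x' = n * j" "w \<in> words n" "w' \<in> words n" "zc w = zc w'" for x' w w' z
      using that by (intro symatD)
    then have e: "f (x' @ w @ z @ y) = f (x' @ w' @ z @ y)"
      if "length x' = n * j" "w \<in> words n" "w' \<in> words n" "zc w = zc w'" for x' w w' z
      using that .
    show ?thesis
    proof (rule symatI)
      fix x' z w w' :: "nat list" assume a: "length x' = n * j" "w \<in> words n" "w' \<in> words n" "zc w = zc w'"
      then have "length w = length w'" by (simp add: wordsD)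
      then show "rslice (n * k) y f (x' @ w @ z) = rslice (n * k) y f (x' @ w' @ z)"
        using e[OF a, of z] by (simp add: rslice_def)
    qed
  qed
  moreover have "rslice (n * k) y f \<in> Vec (n * k)"
    using assms by (intro rslice_Vec[where b = "n * m"]) (auto simp: slots_def algebra_simps)
  ultimately show ?thesis by (simp add: slots_def)
qed

text \<open>The cut lies at a multiple of \<open>n\<close>, so every block falls entirely into one
  of the two factors and its symmetry is inherited from a slice. The other cases concern lists that
  are not words of the right length, over which \<open>symat\<close> also quantifies; there both
  values are 0.\<close>

lemma slotsI_slices:
  assumes V: "f \<in> Vec (n * k + n * m)"
    and L: "\<And>y. y \<in> words (n * m) \<Longrightarrow> rslice (n * k) y f \<in> slots n k"
    and R: "\<And>x. x \<in> words (n * k) \<Longrightarrow> lslice x f \<in> slots n m"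
  shows "f \<in> slots n (k + m)"
proof -
  have "symat n (n * j) f" if j: "j < k + m" for j
  proof (rule symatI)
    fix x y w w' :: "nat list" assume x: "length x = n * j" and w: "w \<in> words n" "w' \<in> words n" "zc w = zc w'"
    have lw: "length w = n" "length w' = n" using w wordsD by auto
    show "f (x @ w @ y) = f (x @ w' @ y)"
    proof (cases "j < k")
      case True
      then have "n * Suc j \<le> n * k" by (intro mult_le_mono2) simp
      then have jk: "n * j + n \<le> n * k" by simp
      show ?thesis
      proof (cases "n * k - n * j - n \<le> length y")
        case False
        with jk have "length (x @ w @ y) \<noteq> n * k + n * m" "length (x @ w' @ y) \<noteq> n * k + n * m"
          using x lw by auto
        then show ?thesis using Vec_length[OF V] by simp
      next
        case len: True
        then obtain p q where pq: "y = p @ q" "length p = n * k - n * j - n"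
          by (rule split_list_at)
        have lp: "length (x @ w @ p) = n * k" "length (x @ w' @ p) = n * k"
          using x lw pq(2) jk by auto
        show ?thesis
        proof (cases "q \<in> words (n * m)")
          case True
          have "symat n (n * j) (rslice (n * k) q f)"
            using L[OF True] \<open>j < k\<close> by (simp add: slots_def)
          from symatD[OF this x w, of p] show ?thesis using lp pq(1) by (simp add: rslice_def)
        next
          case False
          have "f (x @ w @ p @ q) = 0" "f (x @ w' @ p @ q) = 0"
            using False lp words_append[of "x @ w @ p" "n * k" q "n * m"]
              words_append[of "x @ w' @ p" "n * k" q "n * m"] by (auto intro!: VecD[OF V])
          then show ?thesis using pq by simp
        qed
      qed
    next
      case False
      then have "n * k \<le> length x" using x by simp
      then obtain p q where pq: "x = p @ q" "length p = n * k" "length q = length x - n * k"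
        by (rule split_list_at)
      have lq: "length q = n * (j - k)" using pq x by (simp add: right_diff_distrib')
      show ?thesis
      proof (cases "p \<in> words (n * k)")
        case True
        have "symat n (n * (j - k)) (lslice p f)"
          using R[OF True] \<open>\<not> j < k\<close> j by (simp add: slots_def)
        from symatD[OF this lq w, of y] show ?thesis using pq(1) by (simp add: lslice_def)
      next
        case False
        have "f (p @ q @ w @ y) = 0" "f (p @ q @ w' @ y) = 0"
          using False pq words_append[of p "n * k" _ "n * m"] by (auto intro!: VecD[OF V])
        then show ?thesis using pq by simp
      qed
    qed
  qed
  with V show ?thesis by (simp add: slots_def algebra_simps)
qed

lemma tensS_slots: "tensS (n * k) (slots n k) (slots n m) = slots n (k + m)"
proof -
  have "f \<in> tensS (n * k) (slots n k) (slots n m) \<longleftrightarrow> f \<in> slots n (k + m)" for f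
  proof
    assume "f \<in> tensS (n * k) (slots n k) (slots n m)"
    then show "f \<in> slots n (k + m)"
      unfolding tensS_iff[OF csub_slots slots_Vec csub_slots slots_Vec]
      by (intro slotsI_slices) auto
  next
    assume f: "f \<in> slots n (k + m)"
    then have "f \<in> Vec (n * k + n * m)" using slots_Vec[of n "k + m"] unfolding distrib_left by blast
    with f show "f \<in> tensS (n * k) (slots n k) (slots n m)"
      unfolding tensS_iff[OF csub_slots slots_Vec csub_slots slots_Vec]
      using slots_rslice[OF f] slots_lslice[OF f] wordsD by blast
  qed
  then show ?thesis by blast
qed

lemma slots_0: "slots n 0 = Vec 0"
  by (simp add: slots_def)

lemma Lpow_slots: "Lpow n m = slots n m"
  by (induction m) (use tensS_slots[of n _ 1] in \<open>auto simp: slots_0 Lsym_slots\<close>)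

section \<open>Insertion and contraction of the invariant vector\<close>

definition ins :: "nat \<Rightarrow> nat \<Rightarrow> vec \<Rightarrow> vec" where
  "ins n i f = (\<lambda>w. f (take (n * i) w @ drop (n * i + 2 * n) w) * delta n (take (2 * n) (drop (n * i) w)))"

text \<open>No conjugate is taken of \<delta>: its coefficients are real (\<open>cnj_delta\<close>),
  so this is the adjoint of \<open>ins\<close> all the same.\<close>

definition con :: "nat \<Rightarrow> nat \<Rightarrow> vec \<Rightarrow> vec" where
  "con n i f = (\<lambda>w. \<Sum>u\<in>words (2 * n). delta n u * f (take (n * i) w @ u @ drop (n * i) w))"

lemma ins_app: "length x = n * i \<Longrightarrow> length u = 2 * n \<Longrightarrow> ins n i f (x @ u @ y) = f (x @ y) * delta n u"
  by (simp add: ins_def)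

lemma con_app: "length x = n * i \<Longrightarrow> con n i f (x @ y) = (\<Sum>u\<in>words (2 * n). delta n u * f (x @ u @ y))"
  by (simp add: con_def)

lemma con_lin: "con n i (\<lambda>w. a * f w + b * g w) = (\<lambda>w. a * con n i f w + b * con n i g w)"
  by (simp add: con_def ring_distribs sum.distrib sum_distrib_left mult_ac)

lemma con_diff: "con n i (\<lambda>w. f w - b * g w) = (\<lambda>w. con n i f w - b * con n i g w)"
  using con_lin[of n i 1 f "-b" g] by simp

lemma con_scale: "con n i (\<lambda>w. a * f w) = (\<lambda>w. a * con n i f w)"
  by (simp add: con_def sum_distrib_left mult_ac)

lemma con_0 [simp]: "con n i (\<lambda>w. 0) = (\<lambda>w. 0)"
  by (simp add: con_def)

lemma ins_0 [simp]: "ins n i (\<lambda>w. 0) = (\<lambda>w. 0)"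
  by (simp add: ins_def)

lemma con_sum: "con n i (\<lambda>w. \<Sum>j\<in>J. a j * f j w) w = (\<Sum>j\<in>J. a j * con n i (f j) w)"
  unfolding con_def sum_distrib_left by (subst sum.swap) (simp add: mult_ac)

lemma ins_lin: "ins n i (\<lambda>w. a * f w + b * g w) = (\<lambda>w. a * ins n i f w + b * ins n i g w)"
  by (simp add: ins_def ring_distribs mult_ac)

lemma ins_Vec:
  assumes "f \<in> Vec (n * m)" "i \<le> m"
  shows "ins n i f \<in> Vec (n * (m + 2))"
proof -
  have "ins n i f w = 0" if w: "w \<notin> words (n * (m + 2))" for w
  proof (rule ccontr)
    assume nz: "ins n i f w \<noteq> 0"
    let ?x = "take (n * i) w" and ?u = "take (2 * n) (drop (n * i) w)" and ?y = "drop (n * i + 2 * n) w"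
    have nm: "n * i \<le> n * m" using assms by simp
    have u: "?u \<in> words (2 * n)"
      using nz delta_Vec[of n] by (auto simp: ins_def Vec_def)
    have xy: "?x @ ?y \<in> words (n * m)"
      using nz assms by (auto simp: ins_def Vec_def)
    have w: "w = ?x @ ?u @ ?y" by (metis add.commute append_take_drop_id drop_drop)
    have "set w \<subseteq> {0,1}" using u xy unfolding words_def by (subst w) auto
    moreover have "length w = length (?x @ ?y) + length ?u"
      by (subst (1) w) (simp only: length_append)
    then have "length w = n * (m + 2)" using wordsD[OF u] wordsD[OF xy] by simp
    ultimately have "w \<in> words (n * (m + 2))" by (simp add: words_def)
    with that show False by simp
  qed
  then show ?thesis by (simp add: Vec_def)
qed

lemma con_Vec:
  assumes "f \<in> Vec (n * (m + 2))" "i \<le> m"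
  shows "con n i f \<in> Vec (n * m)"
proof -
  have "f (take (n * i) w @ u @ drop (n * i) w) = 0" if w: "w \<notin> words (n * m)" and u: "u \<in> words (2 * n)" for w u
  proof (rule VecD[OF assms(1)])
    have "n * i \<le> n * m" using assms by simp
    show "take (n * i) w @ u @ drop (n * i) w \<notin> words (n * (m + 2))"
    proof
      assume *: "take (n * i) w @ u @ drop (n * i) w \<in> words (n * (m + 2))"
      then have "length (take (n * i) w) + (length u + length (drop (n * i) w)) = n * (m + 2)"
        unfolding words_def by (simp only: mem_Collect_eq length_append)
      moreover have "length (take (n * i) w) + length (drop (n * i) w) = length w" by simp
      ultimately have "length w + length u = n * (m + 2)" by linarith
      then have "length w = n * m" using u by (simp add: words_def)
      moreover have "set (take (n * i) w @ drop (n * i) w) \<subseteq> {0,1}"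
        using * unfolding words_def mem_Collect_eq set_append Un_subset_iff by blast
      ultimately show False using w unfolding words_def append_take_drop_id by simp
    qed
  qed
  then show ?thesis by (simp add: Vec_def con_def)
qed

lemma lslice_ins: "length x = n * k \<Longrightarrow> lslice x (ins n (k + i) f) = ins n i (lslice x f)"
  by (simp add: lslice_def ins_def distrib_left add.assoc)

lemma lslice_con: "length x = n * k \<Longrightarrow> lslice x (con n (k + i) f) = con n i (lslice x f)"
  by (simp add: lslice_def con_def distrib_left add.assoc)

lemma rslice_con:
  assumes "i \<le> k" "length u = n * k"
  shows "rslice (n * k) y (con n i f) u = con n i (rslice (n * (k + 2)) y f) u"
proof -
  have "n * i \<le> length u" using assms by simp
  then obtain p q where pq: "u = p @ q" "length p = n * i" by (rule split_list_at)
  have "rslice (n * k) y (con n i f) u = con n i f (p @ q @ y)"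
    using assms pq by (simp add: rslice_def)
  also have "\<dots> = (\<Sum>v\<in>words (2 * n). delta n v * f (p @ v @ q @ y))" by (rule con_app[OF pq(2)])
  also have "\<dots> = (\<Sum>v\<in>words (2 * n). delta n v * rslice (n * (k + 2)) y f (p @ v @ q))"
  proof (rule sum.cong[OF refl])
    fix v assume "v \<in> words (2 * n)"
    then have "length (p @ v @ q) = n * (k + 2)" using assms pq by (simp add: words_def distrib_left)
    then show "delta n v * f (p @ v @ q @ y) = delta n v * rslice (n * (k + 2)) y f (p @ v @ q)"
      by (simp add: rslice_def)
  qed
  also have "\<dots> = con n i (rslice (n * (k + 2)) y f) u" unfolding pq(1) by (rule con_app[OF pq(2), symmetric])
  finally show ?thesis .
qed

lemma split_word_slot:
  assumes "w \<in> words (n * m)" "i \<le> m"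
  shows "\<exists>x y. w = x @ y \<and> x \<in> words (n * i) \<and> y \<in> words (n * (m - i))"
proof -
  have "n * m = n * i + n * (m - i)" using assms(2) by (simp flip: distrib_left)
  with assms(1) have "w \<in> words (n * i + n * (m - i))" by simp
  from split_word_at[OF this] show ?thesis by metis
qed

text \<open>The length \<open>l\<close> is a separate variable so that it can be instantiated by
  \<open>n\<close> itself when the middle part is a single leg.\<close>

lemma split_word_slot3:
  assumes "w \<in> words (n * m)" "i \<le> j" "j \<le> m" "l = n * (j - i)"
  shows "\<exists>x p y. w = x @ p @ y \<and> x \<in> words (n * i) \<and> p \<in> words l \<and> y \<in> words (n * (m - j))"
proof -
  have "n * m = n * i + (l + n * (m - j))" using assms by (simp flip: distrib_left)
  with assms(1) have "w \<in> words (n * i + (l + n * (m - j)))" by simp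
  then obtain x z where xz: "w = x @ z" "x \<in> words (n * i)" "z \<in> words (l + n * (m - j))"
    by (rule split_word_at)
  obtain p y where py: "z = p @ y" "p \<in> words l" "y \<in> words (n * (m - j))"
    using xz(3) by (rule split_word_at)
  show ?thesis using xz py by blast
qed

lemma con_ins_same:
  assumes "f \<in> Vec (n * m)" "i \<le> m"
  shows "con n i (ins n i f) = f"
proof (rule Vec_eqI)
  show "con n i (ins n i f) \<in> Vec (n * m)" using assms by (intro con_Vec ins_Vec)
  fix w assume "w \<in> words (n * m)"
  from split_word_slot[OF this assms(2)]
  obtain x y where w: "w = x @ y" "x \<in> words (n * i)" "y \<in> words (n * (m - i))"
    by blast
  have "con n i (ins n i f) w = (\<Sum>u\<in>words (2 * n). delta n u * delta n u) * f w"
    unfolding w(1) con_app[OF wordsD[OF w(2)]] sum_distrib_right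
  proof (intro sum.cong refl)
    fix u assume "u \<in> words (2 * n)"
    from ins_app[OF wordsD[OF w(2)] wordsD[OF this], of f y]
    show "delta n u * ins n i f (x @ u @ y) = delta n u * delta n u * f (x @ y)" by simp
  qed
  then show "con n i (ins n i f) w = f w" by (simp add: delta_norm)
qed (rule assms)

text \<open>The contracted pair and the inserted pair overlap in one leg. Summing over that leg
  gives \<open>delta_contract\<close>, a multiple of p_n acting on leg i, and p_n disappears because
  \<open>f\<close> is symmetric there; this is why \<open>f\<close> must lie in
  \<open>slots\<close>.\<close>

lemma con_ins_Suc:
  assumes "f \<in> slots n m" "i < m"
  shows "con n i (ins n (Suc i) f) = (\<lambda>w. kap n * f w)"
proof (rule Vec_eqI)
  have fV: "f \<in> Vec (n * m)" using assms slots_Vec by blast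
  show "con n i (ins n (Suc i) f) \<in> Vec (n * m)" using assms fV by (intro con_Vec ins_Vec) auto
  show "(\<lambda>w. kap n * f w) \<in> Vec (n * m)" by (rule csub_scale[OF csub_Vec fV])
  fix w assume w0: "w \<in> words (n * m)"
  have s: "i \<le> Suc i" "Suc i \<le> m" "n = n * (Suc i - i)" using assms by auto
  from split_word_slot3[OF w0 s] obtain x v y where w: "w = x @ v @ y" "x \<in> words (n * i)" "v \<in> words n" "y \<in> words (n * (m - Suc i))"
    by blast
  have sy: "symat n (n * i) f" using assms by (simp add: slots_def)
  have "con n i (ins n (Suc i) f) w = (\<Sum>u\<in>words (n + n). delta n u * ins n (Suc i) f (x @ u @ v @ y))"
    unfolding w(1) con_app[OF wordsD[OF w(2)]] mult_2 by simp
  also have "\<dots> = (\<Sum>u\<in>words n. \<Sum>u'\<in>words n. delta n (u @ u') * ins n (Suc i) f ((x @ u) @ (u' @ v) @ y))"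
    unfolding sum_words_append by simp
  also have "\<dots> = (\<Sum>u\<in>words n. \<Sum>u'\<in>words n. delta n (u @ u') * (f ((x @ u) @ y) * delta n (u' @ v)))"
  proof (intro sum.cong refl)
    fix u u' assume "u \<in> words n" "u' \<in> words n"
    then show "delta n (u @ u') * ins n (Suc i) f ((x @ u) @ (u' @ v) @ y) =
        delta n (u @ u') * (f ((x @ u) @ y) * delta n (u' @ v))"
      using w by (subst ins_app) (auto simp: words_def)
  qed
  also have "\<dots> = (\<Sum>u\<in>words n. (\<Sum>u'\<in>words n. delta n (u @ u') * delta n (u' @ v)) * f (x @ u @ y))"
    unfolding sum_distrib_right by (intro sum.cong refl) (simp only: mult_ac append_assoc)
  also have "\<dots> = (\<Sum>u\<in>words n. (if zc u = zc v then kap n / of_nat (n choose zc v) else 0) * f (x @ u @ y))"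
    using w by (intro sum.cong refl) (simp add: delta_contract)
  also have "\<dots> = kap n * f w"
    unfolding w(1) by (rule symat_average[OF sy wordsD[OF w(2)] w(3)])
  finally show "con n i (ins n (Suc i) f) w = kap n * f w" .
qed

lemma con_Suc_ins:
  assumes "f \<in> slots n m" "i < m"
  shows "con n (Suc i) (ins n i f) = (\<lambda>w. kap n * f w)"
proof (rule Vec_eqI)
  have fV: "f \<in> Vec (n * m)" using assms slots_Vec by blast
  show "con n (Suc i) (ins n i f) \<in> Vec (n * m)" using assms fV by (intro con_Vec ins_Vec) auto
  show "(\<lambda>w. kap n * f w) \<in> Vec (n * m)" by (rule csub_scale[OF csub_Vec fV])
  fix w assume w0: "w \<in> words (n * m)"
  have s: "i \<le> Suc i" "Suc i \<le> m" "n = n * (Suc i - i)" using assms by auto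
  from split_word_slot3[OF w0 s] obtain x v y where w: "w = x @ v @ y" "x \<in> words (n * i)" "v \<in> words n" "y \<in> words (n * (m - Suc i))"
    by blast
  have sy: "symat n (n * i) f" using assms by (simp add: slots_def)
  have lxv: "length (x @ v) = n * Suc i" using w by (simp add: words_def)
  have "con n (Suc i) (ins n i f) w = (\<Sum>u\<in>words (n + n). delta n u * ins n i f ((x @ v) @ u @ y))"
    using con_app[OF lxv, of "ins n i f" y] unfolding w(1) mult_2 by simp
  also have "\<dots> = (\<Sum>u'\<in>words n. \<Sum>u\<in>words n. delta n (u' @ u) * ins n i f (x @ (v @ u') @ (u @ y)))"
    unfolding sum_words_append by simp
  also have "\<dots> = (\<Sum>u'\<in>words n. \<Sum>u\<in>words n. delta n (u' @ u) * (f (x @ u @ y) * delta n (v @ u')))"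
  proof (intro sum.cong refl)
    fix u u' assume "u \<in> words n" "u' \<in> words n"
    then show "delta n (u' @ u) * ins n i f (x @ (v @ u') @ (u @ y)) =
        delta n (u' @ u) * (f (x @ u @ y) * delta n (v @ u'))"
      using w by (subst ins_app) (auto simp: words_def)
  qed
  also have "\<dots> = (\<Sum>u\<in>words n. \<Sum>u'\<in>words n. delta n (u' @ u) * (f (x @ u @ y) * delta n (v @ u')))"
    by (rule sum.swap)
  also have "\<dots> = (\<Sum>u\<in>words n. (\<Sum>u'\<in>words n. delta n (v @ u') * delta n (u' @ u)) * f (x @ u @ y))"
    unfolding sum_distrib_right by (intro sum.cong refl) (simp only: mult_ac append_assoc)
  also have "\<dots> = (\<Sum>u\<in>words n. (if zc u = zc v then kap n / of_nat (n choose zc v) else 0) * f (x @ u @ y))"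
    using w by (intro sum.cong refl) (auto simp: delta_contract)
  also have "\<dots> = kap n * f w"
    unfolding w(1) by (rule symat_average[OF sy wordsD[OF w(2)] w(3)])
  finally show "con n (Suc i) (ins n i f) w = kap n * f w" .
qed

text \<open>The contraction removes two legs in front of the insertion point, which therefore moves
  from j+2 to j.\<close>

lemma con_ins_above:
  assumes "f \<in> Vec (n * (m + 2))" "i \<le> j" "j \<le> m"
  shows "con n i (ins n (j + 2) f) = ins n j (con n i f)"
proof (rule Vec_eqI)
  show "con n i (ins n (j + 2) f) \<in> Vec (n * (m + 2))" using assms by (intro con_Vec ins_Vec) auto
  show "ins n j (con n i f) \<in> Vec (n * (m + 2))" using assms by (intro con_Vec ins_Vec) auto
  fix w assume w0: "w \<in> words (n * (m + 2))"
  have s: "i \<le> j" "j \<le> (m + 2)" "n * (j - i) = n * (j - i)" using assms by auto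
  from split_word_slot3[OF w0 s] obtain x p z where w: "w = x @ p @ z" "x \<in> words (n * i)" "p \<in> words (n * (j - i))" "z \<in> words (n * (m + 2 - j))"
    by blast
  obtain q y where z: "z = q @ y" "q \<in> words (n * 2)"
  proof -
    have "2 \<le> m + 2 - j" using assms by simp
    from split_word_slot[OF w(4) this] that show ?thesis by blast
  qed
  have lq: "length q = 2 * n" using z by (simp add: words_def)
  have lxp: "length (x @ p) = n * j" using w assms by (simp add: words_def flip: distrib_left)
  have "con n i (ins n (j + 2) f) w = (\<Sum>u\<in>words (2 * n). delta n u * ins n (j + 2) f (x @ u @ p @ q @ y))"
    unfolding w(1) z(1) by (rule con_app[OF wordsD[OF w(2)]])
  also have "\<dots> = (\<Sum>u\<in>words (2 * n). (delta n u * f (x @ u @ p @ y)) * delta n q)"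
  proof (rule sum.cong[OF refl])
    fix u assume "u \<in> words (2 * n)"
    then have "length (x @ u @ p) = n * (j + 2)" using lxp by (simp add: words_def)
    from ins_app[OF this lq, of f y]
    show "delta n u * ins n (j + 2) f (x @ u @ p @ q @ y) = (delta n u * f (x @ u @ p @ y)) * delta n q" by simp
  qed
  also have "\<dots> = con n i f (x @ p @ y) * delta n q"
    unfolding sum_distrib_right[symmetric] con_app[OF wordsD[OF w(2)]] ..
  also have "\<dots> = ins n j (con n i f) w"
    using ins_app[OF lxp lq, of "con n i f" y] unfolding w(1) z(1) by simp
  finally show "con n i (ins n (j + 2) f) w = ins n j (con n i f) w" .
qed

lemma con_ins_below:
  assumes "f \<in> Vec (n * (m + 2))" "i \<le> j" "j \<le> m"
  shows "con n (j + 2) (ins n i f) = ins n i (con n j f)"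
proof (rule Vec_eqI)
  show "con n (j + 2) (ins n i f) \<in> Vec (n * (m + 2))" using assms by (intro con_Vec ins_Vec) auto
  show "ins n i (con n j f) \<in> Vec (n * (m + 2))" using assms by (intro con_Vec ins_Vec) auto
  fix w assume w0: "w \<in> words (n * (m + 2))"
  have s: "i \<le> j + 2" "j + 2 \<le> (m + 2)" "n * (j + 2 - i) = n * (j + 2 - i)" using assms by auto
  from split_word_slot3[OF w0 s] obtain x z y where w: "w = x @ z @ y" "x \<in> words (n * i)" "z \<in> words (n * (j + 2 - i))"
    by blast
  obtain q p where z: "z = q @ p" "q \<in> words (n * 2)" "p \<in> words (n * (j - i))"
  proof -
    have "2 \<le> j + 2 - i" "j + 2 - i - 2 = j - i" using assms by auto
    with split_word_slot[OF w(3), of 2] that show ?thesis by metis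
  qed
  have lq: "length q = 2 * n" using z by (simp add: words_def)
  have lxp: "length (x @ p) = n * j" using w z assms by (simp add: words_def flip: distrib_left)
  have lxqp: "length (x @ q @ p) = n * (j + 2)" using lxp lq by simp
  have "con n (j + 2) (ins n i f) w = (\<Sum>u\<in>words (2 * n). delta n u * ins n i f (x @ q @ p @ u @ y))"
    using con_app[OF lxqp, of "ins n i f" y] unfolding w(1) z(1) by simp
  also have "\<dots> = (\<Sum>u\<in>words (2 * n). (delta n u * f ((x @ p) @ u @ y)) * delta n q)"
    unfolding ins_app[OF wordsD[OF w(2)] lq] by (simp add: mult.assoc)
  also have "\<dots> = con n j f (x @ p @ y) * delta n q"
    using con_app[OF lxp, of f y] unfolding sum_distrib_right[symmetric] by simp
  also have "\<dots> = ins n i (con n j f) w"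
    unfolding w(1) z(1) using ins_app[OF wordsD[OF w(2)] lq, of "con n j f" "p @ y"] by simp
  finally show "con n (j + 2) (ins n i f) w = ins n i (con n j f) w" .
qed

lemma con_con:
  assumes "f \<in> Vec (n * (m + 2 + 2))" "i \<le> j" "j \<le> m"
  shows "con n i (con n (j + 2) f) = con n j (con n i f)"
proof (rule Vec_eqI)
  note f = assms(1)
  show "con n i (con n (j + 2) f) \<in> Vec (n * m)" using assms f by (intro con_Vec) auto
  show "con n j (con n i f) \<in> Vec (n * m)" using assms f by (intro con_Vec) auto
  fix w assume w0: "w \<in> words (n * m)"
  have s: "i \<le> j" "j \<le> m" "n * (j - i) = n * (j - i)" using assms by auto
  from split_word_slot3[OF w0 s] obtain x p y where w: "w = x @ p @ y" "x \<in> words (n * i)" "p \<in> words (n * (j - i))" "y \<in> words (n * (m - j))"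
    by blast
  have lxp: "length (x @ p) = n * j" using w assms by (simp add: words_def flip: distrib_left)
  have "con n i (con n (j + 2) f) w = (\<Sum>u\<in>words (2 * n). delta n u * con n (j + 2) f (x @ u @ p @ y))"
    unfolding w(1) by (rule con_app[OF wordsD[OF w(2)]])
  also have "\<dots> = (\<Sum>u\<in>words (2 * n). delta n u * (\<Sum>v\<in>words (2 * n). delta n v * f (x @ u @ p @ v @ y)))"
  proof (rule sum.cong[OF refl])
    fix u assume "u \<in> words (2 * n)"
    then have "length (x @ u @ p) = n * (j + 2)" using lxp by (simp add: words_def)
    from con_app[OF this, of f y] show "delta n u * con n (j + 2) f (x @ u @ p @ y)
        = delta n u * (\<Sum>v\<in>words (2 * n). delta n v * f (x @ u @ p @ v @ y))" by simp
  qed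
  also have "\<dots> = (\<Sum>v\<in>words (2 * n). delta n v * (\<Sum>u\<in>words (2 * n). delta n u * f (x @ u @ p @ v @ y)))"
    unfolding sum_distrib_left by (subst sum.swap) (simp add: mult_ac)
  also have "\<dots> = (\<Sum>v\<in>words (2 * n). delta n v * con n i f ((x @ p) @ v @ y))"
    using con_app[OF wordsD[OF w(2)], of f] by simp
  also have "\<dots> = con n j (con n i f) w"
    using con_app[OF lxp, of "con n i f" y] unfolding w(1) by simp
  finally show "con n i (con n (j + 2) f) w = con n j (con n i f) w" .
qed

lemma ip_ins:
  assumes "f \<in> Vec (n * m)" "i \<le> m"
  shows "ip (ins n i f) g = ip f (con n i g)"
proof -
  have e: "n * (m + 2) = n * i + (2 * n + n * (m - i))" "n * m = n * i + n * (m - i)"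
    using assms by (simp_all add: distrib_left flip: distrib_left)
  have "ip (ins n i f) g
     = (\<Sum>x\<in>words (n * i). \<Sum>u\<in>words (2 * n). \<Sum>y\<in>words (n * (m - i)). ins n i f (x @ u @ y) * cnj (g (x @ u @ y)))"
    unfolding ip_eq[OF ins_Vec[OF assms]] e(1) sum_words_append ..
  also have "\<dots> = (\<Sum>x\<in>words (n * i). \<Sum>u\<in>words (2 * n). \<Sum>y\<in>words (n * (m - i)). f (x @ y) * (delta n u * cnj (g (x @ u @ y))))"
  proof (intro sum.cong refl)
    fix x u y assume "x \<in> words (n * i)" "u \<in> words (2 * n)"
    from ins_app[OF wordsD[OF this(1)] wordsD[OF this(2)], of f y]
    show "ins n i f (x @ u @ y) * cnj (g (x @ u @ y)) = f (x @ y) * (delta n u * cnj (g (x @ u @ y)))"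
      by simp
  qed
  also have "\<dots> = (\<Sum>x\<in>words (n * i). \<Sum>y\<in>words (n * (m - i)). \<Sum>u\<in>words (2 * n). f (x @ y) * (delta n u * cnj (g (x @ u @ y))))"
    by (intro sum.cong refl sum.swap)
  also have "\<dots> = (\<Sum>x\<in>words (n * i). \<Sum>y\<in>words (n * (m - i)). f (x @ y) * cnj (con n i g (x @ y)))"
  proof (intro sum.cong refl)
    fix x y assume "x \<in> words (n * i)"
    from con_app[OF wordsD[OF this], of g y]
    show "(\<Sum>u\<in>words (2 * n). f (x @ y) * (delta n u * cnj (g (x @ u @ y)))) = f (x @ y) * cnj (con n i g (x @ y))"
      by (simp add: sum_distrib_left)
  qed
  also have "\<dots> = ip f (con n i g)" unfolding ip_eq[OF assms(1)] e(2) sum_words_append ..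
  finally show ?thesis .
qed

lemma delta_slots: "delta n \<in> slots n 2"
proof -
  have "symat n (n * j) (delta n)" if "j < 2" for j
  proof -
    have "delta n (x @ w @ y) = delta n (x @ w' @ y)"
      if x: "length x = n * j" and w: "w \<in> words n" "w' \<in> words n" "zc w = zc w'" for x w w' y
    proof (cases "x @ w @ y \<in> words (2 * n)")
      case True
      have "set w' \<subseteq> {0,1}" "set w \<subseteq> {0,1}" "length w = n" "length w' = n" using w by (auto simp: words_def)
      with True have t: "x @ w' @ y \<in> words (2 * n)" "x \<in> words (n * j)" "set y \<subseteq> {0,1}" "length x + n + length y = 2 * n"
        using x by (auto simp: words_def)
      show ?thesis
      proof (cases "j = 0")
        case True
        then have "x = []" "y \<in> words n" using x t by (auto simp: words_def)
        then show ?thesis using w by (simp add: delta_app)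
      next
        case False
        then have "j = 1" using \<open>j < 2\<close> by simp
        then have "x \<in> words n" "y = []" using x t by (auto simp: words_def)
        then show ?thesis using w by (simp add: delta_app)
      qed
    next
      case False
      then have "x @ w' @ y \<notin> words (2 * n)" using w by (auto simp: words_def)
      with False show ?thesis using VecD[OF delta_Vec] by metis
    qed
    then show ?thesis by (auto simp: symat_def)
  qed
  then show ?thesis using delta_Vec[of n] by (simp add: slots_def mult.commute)
qed

text \<open>Cutting before and after the inserted pair leaves three pieces whose slices are
  multiples of slices of \<open>f\<close> or of \<delta> itself.\<close>

lemma slots_ins:
  assumes f: "f \<in> slots n m" and i: "i \<le> m"
  shows "ins n i f \<in> slots n (m + 2)"
proof -
  have fV: "f \<in> Vec (n * m)" using f slots_Vec by blast
  have V: "ins n i f \<in> Vec (n * i + n * (m + 2 - i))"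
    using ins_Vec[OF fV i] i by (simp flip: distrib_left)
  have "ins n i f \<in> slots n (i + (m + 2 - i))"
  proof (rule slotsI_slices[OF V])
    fix z assume z0: "z \<in> words (n * (m + 2 - i))"
    have "2 \<le> m + 2 - i" using i by simp
    from split_word_slot[OF z0 this]
    obtain q y where z: "z = q @ y" "q \<in> words (n * 2)" "y \<in> words (n * (m + 2 - i - 2))"
      by blast
    then have lq: "length q = 2 * n" by (simp add: words_def)
    have "rslice (n * i) z (ins n i f) = (\<lambda>u. delta n q * rslice (n * i) y f u)"
      unfolding z(1) using ins_app[OF _ lq] by (auto simp: rslice_def fun_eq_iff)
    moreover have "rslice (n * i) y f \<in> slots n i"
      using f i by (intro slots_rslice[where m = "m - i"]) auto
    ultimately show "rslice (n * i) z (ins n i f) \<in> slots n i"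
      using csub_scale[OF csub_slots] by simp
  next
    fix x assume x: "x \<in> words (n * i)"
    have "lslice x (ins n i f) \<in> slots n (2 + (m - i))"
    proof (rule slotsI_slices)
      have "lslice x (ins n i f) \<in> Vec (n * (m + 2 - i))" by (rule lslice_Vec[OF V wordsD[OF x]])
      moreover have "m + 2 - i = 2 + (m - i)" using i by simp
      ultimately show "lslice x (ins n i f) \<in> Vec (n * 2 + n * (m - i))" by (simp only: distrib_left)
      fix y assume "y \<in> words (n * (m - i))"
      have "rslice (n * 2) y (lslice x (ins n i f)) = (\<lambda>u. f (x @ y) * delta n u)"
        using ins_app[OF wordsD[OF x]] Vec_length[OF delta_Vec[of n]]
        by (auto simp: rslice_def lslice_def fun_eq_iff mult.commute)
      then show "rslice (n * 2) y (lslice x (ins n i f)) \<in> slots n 2"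
        using csub_scale[OF csub_slots delta_slots] by simp
    next
      fix q assume q: "q \<in> words (n * 2)"
      then have lq: "length q = 2 * n" by (simp add: words_def)
      have "lslice q (lslice x (ins n i f)) = (\<lambda>u. delta n q * lslice x f u)"
        using ins_app[OF wordsD[OF x] lq] by (auto simp: lslice_def fun_eq_iff)
      moreover have "lslice x f \<in> slots n (m - i)"
        using f i x wordsD by (intro slots_lslice[where k = i]) auto
      ultimately show "lslice q (lslice x (ins n i f)) \<in> slots n (m - i)"
        using csub_scale[OF csub_slots] by simp
    qed
    moreover have "m + 2 - i = 2 + (m - i)" using i by simp
    ultimately show "lslice x (ins n i f) \<in> slots n (m + 2 - i)" by (simp only:)
  qed
  then show ?thesis using i by simp
qed

lemma slots_con:
  assumes f: "f \<in> slots n (m + 2)" and i: "i \<le> m"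
  shows "con n i f \<in> slots n m"
proof -
  have fV: "f \<in> Vec (n * (m + 2))" using f slots_Vec by blast
  have V: "con n i f \<in> Vec (n * i + n * (m - i))"
    using con_Vec[OF fV i] i by (simp flip: distrib_left)
  have "con n i f \<in> slots n (i + (m - i))"
  proof (rule slotsI_slices[OF V])
    fix y
    have "rslice (n * i) (q @ y) f \<in> slots n i" for q
      using f i by (intro slots_rslice[where m = "m + 2 - i"]) auto
    then have "(\<lambda>w. \<Sum>q\<in>words (2 * n). delta n q * rslice (n * i) (q @ y) f w) \<in> slots n i"
      by (intro csub_sum[OF csub_slots])
    moreover have "rslice (n * i) y (con n i f) = (\<lambda>w. \<Sum>q\<in>words (2 * n). delta n q * rslice (n * i) (q @ y) f w)"
      by (auto simp: rslice_def con_app fun_eq_iff)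
    ultimately show "rslice (n * i) y (con n i f) \<in> slots n i" by simp
  next
    fix x assume x: "x \<in> words (n * i)"
    have "lslice (x @ q) f \<in> slots n (m - i)" if "q \<in> words (2 * n)" for q
      using f i wordsD[OF x] wordsD[OF that] by (intro slots_lslice[where k = "i + 2"]) (auto simp: distrib_left)
    then have "(\<lambda>w. \<Sum>q\<in>words (2 * n). delta n q * lslice (x @ q) f w) \<in> slots n (m - i)"
      by (intro csub_sum[OF csub_slots])
    moreover have "lslice x (con n i f) = (\<lambda>w. \<Sum>q\<in>words (2 * n). delta n q * lslice (x @ q) f w)"
      using con_app[OF wordsD[OF x]] by (auto simp: lslice_def fun_eq_iff)
    ultimately show "lslice x (con n i f) \<in> slots n (m - i)" by simp
  qed
  then show ?thesis using i by simp
qed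

text \<open>This will be \<open>E_k \<otimes> E_m\<close>: only the contraction across the boundary between the two
  factors may be nonzero.\<close>

definition TT :: "nat \<Rightarrow> nat \<Rightarrow> nat \<Rightarrow> vec set" where
  "TT n k m = {f \<in> slots n (k + m). \<forall>i. i + 1 < k + m \<and> i + 1 \<noteq> k \<longrightarrow> con n i f = (\<lambda>w. 0)}"

lemma csub_TT: "csub (TT n k m)"
  using csub_slots[of n "k + m"] unfolding csub_def TT_def
  by (simp add: con_lin)

lemma TT_slots: "TT n k m \<subseteq> slots n (k + m)"
  by (auto simp: TT_def)

lemma TT_Vec: "TT n k m \<subseteq> Vec (n * (k + m))"
  using TT_slots slots_Vec by blast

lemma TTD: "f \<in> TT n k m \<Longrightarrow> i + 1 < k + m \<Longrightarrow> i + 1 \<noteq> k \<Longrightarrow> con n i f = (\<lambda>w. 0)"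
  by (simp add: TT_def)

text \<open>With one factor trivial there is no boundary contraction to exempt, so both sides
  describe E_m.\<close>

lemma TT_0_right: "TT n m 0 = TT n 0 m"
  by (auto simp: TT_def)

section \<open>E_m and E_k \<otimes> E_m as joint kernels of contractions\<close>

lemma ip_lin_right:
  assumes "f \<in> Vec N"
  shows "ip f (\<lambda>w. a * g w + b * h w) = cnj a * ip f g + cnj b * ip f h"
  unfolding ip_eq[OF assms] sum_distrib_left sum.distrib[symmetric]
  by (intro sum.cong refl) (simp add: algebra_simps)

lemma ip_0_right [simp]: "ip f (\<lambda>w. 0) = 0"
  by (simp add: ip_def)

lemma ip_scale_right: "f \<in> Vec N \<Longrightarrow> ip f (\<lambda>w. a * g w) = cnj a * ip f g"
  using ip_lin_right[of f N a g 0 g] by simp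

lemma tens_lin_right: "tens a f (\<lambda>w. s * g w + t * h w) = (\<lambda>w. s * tens a f g w + t * tens a f h w)"
  by (auto simp: tens_def algebra_simps)

lemma ins_tens: "tens (n * i) f (tens (2 * n) (delta n) g) = ins n i (tens (n * i) f g)"
proof
  fix w
  show "tens (n * i) f (tens (2 * n) (delta n) g) w = ins n i (tens (n * i) f g) w"
  proof (cases "n * i \<le> length w")
    case True
    have "drop (2 * n) (drop (n * i) w) = drop (n * i + 2 * n) w" by (simp only: drop_drop add.commute)
    then show ?thesis unfolding tens_def ins_def using True by (simp del: drop_drop)
  next
    case False
    then have e: "drop (n * i + 2 * n) w = []" "drop (n * i) w = []" "take (n * i) w = w" by simp_all
    show ?thesis unfolding tens_def ins_def e append_Nil2 by simp
  qed
qed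

text \<open>The generators of K_m are insertions of \<delta>, and \<open>ip_ins\<close> moves an
  insertion over to \<open>f\<close> as a contraction. Conversely, the insertion of
  \<open>con n i f\<close> at position i belongs to K_m, and pairing it with \<open>f\<close> gives
  the squared norm of \<open>con n i f\<close>.\<close>

lemma Kspace_orth:
  assumes f: "f \<in> slots n m"
  shows "(\<forall>h\<in>Kspace n m. ip f h = 0) \<longleftrightarrow> (\<forall>i. i + 1 < m \<longrightarrow> con n i f = (\<lambda>w. 0))"
proof
  have fV: "f \<in> Vec (n * m)" using f slots_Vec by blast
  let ?T = "\<lambda>i. tensS (2 * n) (Cdelta n) (slots n i)"
  have K: "Kspace n m = cspan (\<Union>i\<in>{1..m-1}. tensS (n * (i - 1)) (slots n (i - 1)) (?T (m - i - 1)))"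
    by (simp add: Kspace_def Lpow_slots)
  \<comment> \<open>The condition of being orthogonal to \<open>f\<close>, pulled back through a
    linear map F. It is used with F tensoring by a fixed left factor and with F the identity, so
    that each of the nested spans can be reduced to generators.\<close>
  have sub: "csub {h. ip f (F h) = 0}"
    if "\<And>a g b h. F (\<lambda>w. a * g w + b * h w) = (\<lambda>w. a * F g w + b * F h w)" for F
  proof -
    have "F (\<lambda>w. 0) = (\<lambda>w. 0)" using that[of 0 _ 0] by simp
    then show ?thesis unfolding csub_def by (auto simp: that ip_lin_right[OF fV])
  qed
  {
    assume *: "\<forall>i. i + 1 < m \<longrightarrow> con n i f = (\<lambda>w. 0)"
    have z: "ip f (tens (n * i) g (tens (2 * n) q g')) = 0"
      if i: "i + 1 < m" and g: "g \<in> slots n i" and g': "g' \<in> slots n (m - i - 2)" and q: "q \<in> Cdelta n" for i g g' q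
    proof -
      obtain c where c: "q = (\<lambda>w. c * delta n w)" using q by (auto simp: Cdelta_def)
      have m: "(i + (m - i - 2)) + 2 = m" using i by auto
      have tV: "tens (n * i) g g' \<in> Vec (n * (i + (m - i - 2)))"
        unfolding distrib_left using g g' slots_Vec by (intro tens_Vec) auto
      have iV: "ins n i (tens (n * i) g g') \<in> Vec (n * m)"
        using ins_Vec[OF tV, of i] unfolding m by (simp only: le_add1)
      have "tens (n * i) g (tens (2 * n) q g') = (\<lambda>w. c * tens (n * i) g (tens (2 * n) (delta n) g') w)"
        by (simp add: c tens_def mult_ac)
      then have "ip f (tens (n * i) g (tens (2 * n) q g')) = cnj c * ip f (ins n i (tens (n * i) g g'))"
        using ip_scale_right[OF fV] by (simp add: ins_tens)
      also have "ip f (ins n i (tens (n * i) g g')) = cnj (ip (ins n i (tens (n * i) g g')) f)"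
        by (rule ip_cnj[OF iV fV])
      also have "ip (ins n i (tens (n * i) g g')) f = 0"
        using ip_ins[OF tV, of i f] * i by simp
      finally show ?thesis by simp
    qed
    have "tensS (n * i) (slots n i) (?T (m - i - 2)) \<subseteq> {h. ip f h = 0}" if i: "i + 1 < m" for i
    proof -
      have "?T (m - i - 2) \<subseteq> {h. ip f (tens (n * i) g h) = 0}" if "g \<in> slots n i" for g
        unfolding tensS_def using z[OF i that]
        by (intro cspan_subset sub tens_lin_right) blast
      then show ?thesis
        unfolding tensS_def[of "n * i"] by (intro cspan_subset sub) auto
    qed
    then have "tensS (n * (i - 1)) (slots n (i - 1)) (?T (m - i - 1)) \<subseteq> {h. ip f h = 0}" if "i \<in> {1..m-1}" for i
      using that by (cases i) (auto simp: numeral_2_eq_2)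
    then have "(\<Union>i\<in>{1..m-1}. tensS (n * (i - 1)) (slots n (i - 1)) (?T (m - i - 1))) \<subseteq> {h. ip f h = 0}"
      by (rule UN_least)
    then have "Kspace n m \<subseteq> {h. ip f h = 0}"
      unfolding K by (intro cspan_subset sub[of "\<lambda>h. h"]) auto
    then show "\<forall>h\<in>Kspace n m. ip f h = 0" by blast
  }
  assume *: "\<forall>h\<in>Kspace n m. ip f h = 0"
  show "\<forall>i. i + 1 < m \<longrightarrow> con n i f = (\<lambda>w. 0)"
  proof (intro allI impI)
    fix i assume i: "i + 1 < m"
    define r where "r = m - i - 2"
    have m: "m = i + r + 2" using i by (simp add: r_def)
    define c where "c = con n i f"
    have cs: "c \<in> slots n (i + r)" unfolding c_def using f m by (intro slots_con) auto
    then have cV: "c \<in> Vec (n * (i + r))" using slots_Vec by blast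
    have hs: "ins n i c \<in> slots n m" unfolding m by (rule slots_ins[OF cs]) simp
    then have hV: "ins n i c \<in> Vec (n * m)" using slots_Vec by blast
    have CV: "Cdelta n \<subseteq> Vec (2 * n)"
      using csub_scale[OF csub_Vec delta_Vec] by (auto simp: Cdelta_def)
    have Cs: "csub (Cdelta n)" unfolding csub_def
    proof (intro conjI ballI allI)
      show "(\<lambda>w. 0) \<in> Cdelta n" unfolding Cdelta_def by (auto intro!: exI[of _ 0])
    next
      fix f g a b assume "f \<in> Cdelta n" "g \<in> Cdelta n"
      then obtain c c' where "f = (\<lambda>w. c * delta n w)" "g = (\<lambda>w. c' * delta n w)" by (auto simp: Cdelta_def)
      then have "(\<lambda>w. a * f w + b * g w) = (\<lambda>w. (a * c + b * c') * delta n w)" by (simp add: algebra_simps)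
      then show "(\<lambda>w. a * f w + b * g w) \<in> Cdelta n" unfolding Cdelta_def by blast
    qed
    have Ts: "csub (?T r)" unfolding tensS_def by (rule csub_cspan)
    have TV: "?T r \<subseteq> Vec (2 * n + n * r)"
      using tensS_iff[OF Cs CV csub_slots slots_Vec] by blast
    have "ins n i c \<in> tensS (n * i) (slots n i) (?T r)"
      unfolding tensS_iff[OF csub_slots slots_Vec Ts TV]
    proof (intro conjI ballI)
      have "n * i + (2 * n + n * r) = n * m" by (simp add: m algebra_simps)
      then show "ins n i c \<in> Vec (n * i + (2 * n + n * r))" using hV by (simp only:)
      fix y show "rslice (n * i) y (ins n i c) \<in> slots n i"
        using hs unfolding m by (intro slots_rslice[where m = "r + 2"]) (simp only: add.assoc)
    next
      fix x assume x: "x \<in> words (n * i)"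
      have "lslice x (ins n i c) = tens (2 * n) (delta n) (lslice x c)"
        using wordsD[OF x] by (auto simp: lslice_def ins_def tens_def fun_eq_iff)
      moreover have "lslice x c \<in> slots n r" by (rule slots_lslice[OF cs wordsD[OF x]])
      moreover have "delta n \<in> Cdelta n" unfolding Cdelta_def by (auto intro!: exI[of _ 1])
      ultimately show "lslice x (ins n i c) \<in> ?T r"
        unfolding tensS_def by (intro subsetD[OF cspan_incl]) auto
    qed
    moreover have "Suc i \<in> {1..m-1}" "Suc i - 1 = i" "m - Suc i - 1 = r" using i by (auto simp: r_def)
    ultimately have "ins n i c \<in> Kspace n m"
      unfolding K by (intro subsetD[OF cspan_incl] UN_I[of "Suc i"]) simp_all
    then have "ip f (ins n i c) = 0" using * by blast
    then have "ip (ins n i c) f = 0" using ip_cnj[OF fV hV] by simp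
    then have "ip c c = 0" using ip_ins[OF cV, of i f] by (simp add: c_def)
    then show "con n i f = (\<lambda>w. 0)" using ip_self_eq_0[OF cV] by (simp add: c_def)
  qed
qed

lemma E_eq_TT: "E n m = TT n 0 m"
proof -
  consider "m = 0" | "m = 1" | "m \<ge> 2" by linarith
  then show ?thesis
  proof cases
    case 3
    then show ?thesis using Kspace_orth[of _ n m] by (auto simp: E_def TT_def Lpow_slots)
  qed (auto simp: E_def TT_def slots_0 Lsym_slots)
qed

text \<open>A contraction that does not cross the boundary acts on one factor only, hence commutes
  with slicing in the other factor; \<open>tensS_iff\<close> then translates between the two
  descriptions.\<close>

lemma tensS_E: "tensS (n * k) (E n k) (E n m) = TT n k m"
proof -
  have char: "f \<in> tensS (n * k) (E n k) (E n m) \<longleftrightarrow> f \<in> Vec (n * k + n * m)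
     \<and> (\<forall>y\<in>words (n * m). rslice (n * k) y f \<in> TT n 0 k) \<and> (\<forall>x\<in>words (n * k). lslice x f \<in> TT n 0 m)" for f
    unfolding E_eq_TT using TT_Vec[of n 0] by (intro tensS_iff csub_TT) simp_all
  have "f \<in> tensS (n * k) (E n k) (E n m) \<longleftrightarrow> f \<in> TT n k m" for f
  proof
    assume f: "f \<in> tensS (n * k) (E n k) (E n m)"
    have fs: "f \<in> slots n (k + m)"
      using f TT_slots[of n 0] unfolding char by (intro slotsI_slices) auto
    then have fV: "f \<in> Vec (n * (k + m))" using slots_Vec by blast
    have "con n i f = (\<lambda>w. 0)" if i: "i + 1 < k + m" "i + 1 \<noteq> k" for i
    proof (rule Vec_eqI)
      have km: "(k + m - 2) + 2 = k + m" using i by simp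
      have "f \<in> Vec (n * ((k + m - 2) + 2))" unfolding km by (rule fV)
      then show "con n i f \<in> Vec (n * (k + m - 2))"
        by (rule con_Vec) (use i in simp)
      fix w assume w: "w \<in> words (n * (k + m - 2))"
      show "con n i f w = 0"
      proof (cases "i + 1 < k")
        case True
        then have "k - 2 \<le> k + m - 2" by simp
        from split_word_slot[OF w this] obtain x y where
          xy: "w = x @ y" "x \<in> words (n * (k - 2))" "y \<in> words (n * (k + m - 2 - (k - 2)))"
          by blast
        have "k + m - 2 - (k - 2) = m" using True by simp
        then have y: "y \<in> words (n * m)" using xy(3) by (simp only:)
        have "con n i f w = rslice (n * (k - 2)) y (con n i f) x"
          using wordsD[OF xy(2)] xy(1) by (simp add: rslice_def)
        also have "\<dots> = con n i (rslice (n * (k - 2 + 2)) y f) x"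
          using True wordsD[OF xy(2)] by (intro rslice_con) auto
        also have "k - 2 + 2 = k" using True by simp
        also have "con n i (rslice (n * k) y f) = (\<lambda>w. 0)"
          using f y True unfolding char by (intro TTD[where k = 0 and m = k]) auto
        finally show ?thesis by simp
      next
        case False
        define j where "j = i - k"
        have ij: "i = k + j" using False i by (simp add: j_def)
        have "k \<le> k + m - 2" using i ij by simp
        from split_word_slot[OF w this] obtain x y where
          xy: "w = x @ y" "x \<in> words (n * k)" by blast
        have "con n i f w = lslice x (con n (k + j) f) y"
          using xy(1) by (simp add: lslice_def ij)
        also have "\<dots> = con n j (lslice x f) y"
          using wordsD[OF xy(2)] by (simp add: lslice_con)
        also have "con n j (lslice x f) = (\<lambda>w. 0)"
          using f xy(2) i ij unfolding char by (intro TTD[where k = 0 and m = m]) auto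
        finally show ?thesis by simp
      qed
    qed (simp add: Vec_def)
    with fs show "f \<in> TT n k m" by (simp add: TT_def)
  next
    assume f: "f \<in> TT n k m"
    then have fs: "f \<in> slots n (k + m)" using TT_slots by blast
    show "f \<in> tensS (n * k) (E n k) (E n m)" unfolding char
    proof (intro conjI ballI)
      show "f \<in> Vec (n * k + n * m)" using fs slots_Vec[of n "k + m"] unfolding distrib_left by blast
    next
      fix y
      have "con n i (rslice (n * k) y f) = (\<lambda>w. 0)" if "i + 1 < k" for i
      proof (rule Vec_eqI)
        have k: "k - 2 + 2 = k" using that by simp
        have "rslice (n * k) y f \<in> Vec (n * k)" using slots_rslice[OF fs] slots_Vec by blast
        then have "rslice (n * k) y f \<in> Vec (n * (k - 2 + 2))" unfolding k .
        then show "con n i (rslice (n * k) y f) \<in> Vec (n * (k - 2))"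
          by (rule con_Vec) (use that in simp)
        fix w assume w: "w \<in> words (n * (k - 2))"
        have "con n i (rslice (n * (k - 2 + 2)) y f) w = rslice (n * (k - 2)) y (con n i f) w"
          using that wordsD[OF w] by (intro rslice_con[symmetric]) auto
        then show "con n i (rslice (n * k) y f) w = 0"
          using TTD[OF f, of i] that unfolding k by (simp add: rslice_def)
      qed (simp add: Vec_def)
      then show "rslice (n * k) y f \<in> TT n 0 k" using slots_rslice[OF fs] by (simp add: TT_def)
    next
      fix x assume x: "x \<in> words (n * k)"
      have "con n i (lslice x f) = (\<lambda>w. 0)" if "i + 1 < m" for i
        using lslice_con[OF wordsD[OF x], of i f] TTD[OF f, of "k + i"] that
        by (simp add: lslice_def)
      then show "lslice x f \<in> TT n 0 m" using slots_lslice[OF fs wordsD[OF x]] by (simp add: TT_def)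
    qed
  qed
  then show ?thesis by blast
qed

section \<open>The commutation relation\<close>

text \<open>The sign in the recursion for G. With it \<open>kap\<close> equals -eps/d_1, so the
  powers of \<open>eps\<close> absorb all signs and only the recursion for the d's remains.\<close>

definition eps :: "nat \<Rightarrow> complex" where
  "eps n = (-1) ^ (n + 1)"

definition dc :: "nat \<Rightarrow> nat \<Rightarrow> complex" where
  "dc n i = of_int (dnat n i)"

definition dd :: "nat \<Rightarrow> complex" where
  "dd n = of_nat (n + 1)"

lemma eps_sq [simp]: "eps n * eps n = 1" "eps n * (eps n * z) = z"
  by (simp_all add: eps_def flip: mult.assoc)

lemma dd_nz [simp]: "dd n \<noteq> 0"
  unfolding dd_def of_nat_eq_0_iff by simp

lemma kap_eq: "kap n = - eps n / dd n"
  by (simp add: kap_def eps_def dd_def)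

lemma dc_simps [simp]: "dc n 0 = 0" "dc n (Suc 0) = 1"
  by (simp_all add: dc_def)

lemma dc_rec: "dc n (Suc (Suc i)) = dd n * dc n (Suc i) - dc n i"
  by (simp add: dc_def dd_def)

text \<open>Here n \<ge> 1 enters, through the factor n+1 \<ge> 2; for n = 0 the sequence begins 0,
  1, 1, 0. The growth supplies both the nonzero denominators and the positive radicands.\<close>

lemma dnat_incr:
  assumes "n \<ge> 1"
  shows "0 \<le> dnat n i \<and> dnat n i < dnat n (Suc i)"
proof (induction i)
  case (Suc i)
  have "2 * dnat n (Suc i) \<le> int (n + 1) * dnat n (Suc i)"
    using assms Suc by (intro mult_right_mono) auto
  moreover have "dnat n (Suc (Suc i)) = int (n + 1) * dnat n (Suc i) - dnat n i" by simp
  ultimately show ?case using Suc by linarith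
qed simp

lemma dnat_mono: "n \<ge> 1 \<Longrightarrow> i < j \<Longrightarrow> dnat n i < dnat n j"
  by (rule lift_Suc_mono_less[of "dnat n"]) (blast dest: dnat_incr, assumption)

lemma dnat_pos: "n \<ge> 1 \<Longrightarrow> i > 0 \<Longrightarrow> dnat n i > 0"
  using dnat_mono[of n 0 i] by simp

lemma dc_nz: "n \<ge> 1 \<Longrightarrow> i > 0 \<Longrightarrow> dc n i \<noteq> 0"
  using dnat_pos[of n i] by (simp add: dc_def)

section \<open>Contractions of linear combinations of insertions\<close>

definition lin :: "nat \<Rightarrow> nat \<Rightarrow> (nat \<Rightarrow> complex) \<Rightarrow> vec \<Rightarrow> vec" where
  "lin n M a f = (\<lambda>w. \<Sum>i\<le>M. a i * ins n i f w)"

lemma lin_slots: "f \<in> slots n M \<Longrightarrow> lin n M a f \<in> slots n (M + 2)"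
  unfolding lin_def by (intro csub_sum[OF csub_slots] slots_ins) auto

lemma lin_zero_coeff: "(\<And>i. i \<le> M \<Longrightarrow> a i = 0) \<Longrightarrow> lin n M a f = (\<lambda>w. 0)"
  by (simp add: lin_def)

lemma lin_lin: "lin n M a (\<lambda>w. s * f w + t * g w) = (\<lambda>w. s * lin n M a f w + t * lin n M a g w)"
  by (simp add: lin_def ins_lin ring_distribs sum.distrib sum_distrib_left mult.left_commute)

text \<open>Row j of the tridiagonal matrix of relations between \<open>con n j\<close> and the
  insertions: 1 on the diagonal, \<open>kap\<close> for the two neighbours, truncated at 0 and
  M.\<close>

definition cf :: "nat \<Rightarrow> nat \<Rightarrow> (nat \<Rightarrow> complex) \<Rightarrow> nat \<Rightarrow> complex" where
  "cf n M a j = a j + kap n * ((if 1 \<le> j then a (j - 1) else 0) + (if j < M then a (Suc j) else 0))"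

text \<open>The terms are sorted by the distance of i from j. Distance at most one is collected in
  \<open>cf\<close>; farther insertions commute with the contraction, one of the two indices
  dropping by 2.\<close>

lemma con_lin_expand:
  assumes f: "f \<in> slots n M" and j: "j \<le> M"
  shows "con n j (lin n M a f) w = cf n M a j * f w
     + (\<Sum>i\<le>M. if j + 2 \<le> i then a i * ins n (i - 2) (con n j f) w else 0)
     + (\<Sum>i\<le>M. if i + 2 \<le> j then a i * ins n i (con n (j - 2) f) w else 0)"
proof -
  have fV: "f \<in> Vec (n * M)" using f slots_Vec by blast
  have "con n j (lin n M a f) w = (\<Sum>i\<le>M. a i * con n j (ins n i f) w)"
    unfolding lin_def by (rule con_sum)
  also have "\<dots> = (\<Sum>i\<le>M. (if i = j then a j * f w else 0)
      + (if Suc i = j then kap n * a i * f w else 0) + (if i = Suc j then kap n * a i * f w else 0)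
      + (if j + 2 \<le> i then a i * ins n (i - 2) (con n j f) w else 0)
      + (if i + 2 \<le> j then a i * ins n i (con n (j - 2) f) w else 0))"
  proof (rule sum.cong[OF refl])
    fix i assume "i \<in> {..M}"
    then have i: "i \<le> M" by simp
    consider "i = j" | "Suc i = j" | "i = Suc j" | "j + 2 \<le> i" | "i + 2 \<le> j" by linarith
    then show "a i * con n j (ins n i f) w = (if i = j then a j * f w else 0)
      + (if Suc i = j then kap n * a i * f w else 0) + (if i = Suc j then kap n * a i * f w else 0)
      + (if j + 2 \<le> i then a i * ins n (i - 2) (con n j f) w else 0)
      + (if i + 2 \<le> j then a i * ins n i (con n (j - 2) f) w else 0)"
    proof cases
      case 1
      then show ?thesis using con_ins_same[OF fV j] by simp
    next
      case 2
      then show ?thesis using con_Suc_ins[OF f, of i] j by auto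
    next
      case 3
      then show ?thesis using con_ins_Suc[OF f, of j] i by simp
    next
      case 4
      have M: "M - 2 + 2 = M" using 4 i by simp
      have "f \<in> Vec (n * (M - 2 + 2))" unfolding M by (rule fV)
      from con_ins_above[OF this, of j "i - 2"]
      have "con n j (ins n i f) = ins n (i - 2) (con n j f)"
        using 4 i by (simp del: add_2_eq_Suc' add: le_add_diff_inverse2)
      then show ?thesis using 4 by simp
    next
      case 5
      have M: "M - 2 + 2 = M" using 5 j by simp
      have "f \<in> Vec (n * (M - 2 + 2))" unfolding M by (rule fV)
      from con_ins_below[OF this, of i "j - 2"]
      have "con n j (ins n i f) = ins n i (con n (j - 2) f)"
        using 5 j by (simp del: add_2_eq_Suc' add: le_add_diff_inverse2)
      then show ?thesis using 5 by simp
    qed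
  qed
  also have "\<dots> = (a j * f w + (if 1 \<le> j then kap n * a (j - 1) * f w else 0)
      + (if j < M then kap n * a (Suc j) * f w else 0))
     + (\<Sum>i\<le>M. if j + 2 \<le> i then a i * ins n (i - 2) (con n j f) w else 0)
     + (\<Sum>i\<le>M. if i + 2 \<le> j then a i * ins n i (con n (j - 2) f) w else 0)"
  proof -
    have "(\<Sum>i\<le>M. if Suc i = j then kap n * a i * f w else 0)
        = (if 1 \<le> j then kap n * a (j - 1) * f w else 0)"
      using j by (cases j) auto
    moreover have "(\<Sum>i\<le>M. if i = Suc j then kap n * a i * f w else 0)
        = (if j < M then kap n * a (Suc j) * f w else 0)"
      by (simp add: Suc_le_eq)
    moreover have "(\<Sum>i\<le>M. if i = j then a j * f w else 0) = a j * f w"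
      using j by simp
    ultimately show ?thesis unfolding sum.distrib by simp
  qed
  also have "a j * f w + (if 1 \<le> j then kap n * a (j - 1) * f w else 0)
      + (if j < M then kap n * a (Suc j) * f w else 0) = cf n M a j * f w"
    by (simp add: cf_def algebra_simps)
  finally show ?thesis .
qed

lemma con_lin_simple:
  assumes "f \<in> slots n M" "j \<le> M"
    and "\<And>i. j + 2 \<le> i \<Longrightarrow> i \<le> M \<Longrightarrow> a i = 0 \<or> con n j f = (\<lambda>w. 0)"
    and "\<And>i. i + 2 \<le> j \<Longrightarrow> a i = 0 \<or> con n (j - 2) f = (\<lambda>w. 0)"
  shows "con n j (lin n M a f) = (\<lambda>w. cf n M a j * f w)"
proof
  fix w
  have "(\<Sum>i\<le>M. if j + 2 \<le> i then a i * ins n (i - 2) (con n j f) w else 0) = 0"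
    using assms(3) by (intro sum.neutral) fastforce
  moreover have "(\<Sum>i\<le>M. if i + 2 \<le> j then a i * ins n i (con n (j - 2) f) w else 0) = 0"
    using assms(4) by (intro sum.neutral) fastforce
  ultimately show "con n j (lin n M a f) w = cf n M a j * f w"
    unfolding con_lin_expand[OF assms(1,2)] by simp
qed

text \<open>Coefficients of \<open>G_(k+1)\<close> and of its mirror image acting behind the first \<open>k + 1\<close> legs;
  note that \<open>dc n i\<close> is \<open>d_(i-1)\<close>, and that truncated subtraction makes \<open>hc\<close> vanish for \<open>i > k + m\<close>.\<close>

definition gc :: "nat \<Rightarrow> nat \<Rightarrow> nat \<Rightarrow> complex" where
  "gc n k i = (if i \<le> k then eps n ^ i * dc n (Suc i) else 0)"

definition hc :: "nat \<Rightarrow> nat \<Rightarrow> nat \<Rightarrow> nat \<Rightarrow> complex" where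
  "hc n k m i = (if k < i then eps n ^ (i - Suc k) * dc n (m - (i - Suc k)) else 0)"

text \<open>Up to the sign eps^j this is the recursion for d. At j = 0 the missing left neighbour
  would carry \<open>dc n 0\<close>, which is 0; at j = k the missing right neighbour is what
  remains in \<open>cf_gc_last\<close>.\<close>

lemma cf_gc_below: "j < k \<Longrightarrow> k \<le> M \<Longrightarrow> cf n M (gc n k) j = 0"
  by (cases j) (auto simp: cf_def gc_def kap_eq dc_rec field_simps)

lemma cf_gc_last: "k \<le> M \<Longrightarrow> cf n M (gc n k) k = eps n ^ k * dc n (Suc (Suc k)) / dd n"
  by (cases k) (auto simp: cf_def gc_def kap_eq dc_rec field_simps)

lemma cf_gc_Suc: "cf n M (gc n k) (Suc k) = kap n * eps n ^ k * dc n (Suc k)"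
  by (auto simp: cf_def gc_def)

lemma cf_gc_above: "k + 2 \<le> j \<Longrightarrow> cf n M (gc n k) j = 0"
  by (auto simp: cf_def gc_def)

lemma cf_hc_below: "j < k \<Longrightarrow> cf n M (hc n k m) j = 0"
  by (auto simp: cf_def hc_def)

lemma cf_hc_eq: "k < M \<Longrightarrow> cf n M (hc n k m) k = kap n * dc n m"
  by (auto simp: cf_def hc_def)

lemma cf_hc_Suc: "1 \<le> m \<Longrightarrow> cf n (k + m) (hc n k m) (Suc k) = dc n (Suc m) / dd n"
  by (cases m; cases "m - 1") (auto simp: cf_def hc_def kap_eq dc_rec field_simps)

text \<open>The same recursion read backwards: the d's descend along the legs, and at j = k+m the
  absent right neighbour would carry \<open>dc n 0\<close>, which is 0.\<close>

lemma cf_hc_above: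
  assumes "k + 2 \<le> j" "j \<le> k + m"
  shows "cf n (k + m) (hc n k m) j = 0"
proof -
  \<comment> \<open>Writing j = k+s+2 and m = s+r+2 removes the truncated subtractions from
    \<open>hc\<close>.\<close>
  obtain s where s: "j = Suc (Suc (k + s))" using assms by (metis add.commute add_Suc_right le_Suc_ex numeral_2_eq_2 add_0_right)
  obtain r where r: "m = Suc (Suc (s + r))" using assms s by (metis add_Suc_right add_le_cancel_left le_Suc_ex add_Suc)
  show ?thesis unfolding s r
    by (cases r) (auto simp: cf_def hc_def kap_eq dc_rec field_simps Suc_diff_le)
qed

text \<open>Here \<open>gg\<close> is \<open>G_(k+1) \<otimes> 1\<close>, and \<open>sg\<close> is the closed form of \<open>\<sigma>_(k,m)\<close> on \<open>E_k \<otimes> E_m\<close>.\<close>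

definition gg :: "nat \<Rightarrow> nat \<Rightarrow> nat \<Rightarrow> vec \<Rightarrow> vec" where
  "gg n k m f = lin n (k + m) (gc n k) f"

definition sg :: "nat \<Rightarrow> nat \<Rightarrow> nat \<Rightarrow> vec \<Rightarrow> vec" where
  "sg n k m f = (\<lambda>w. gg n k m f w
     - dd n / dc n (Suc m) * lin n (k + m) (hc n k m) (con n (Suc k) (gg n k m f)) w)"

lemma TT_slotsD: "f \<in> TT n k m \<Longrightarrow> f \<in> slots n (k + m)"
  using TT_slots by blast

lemma gg_slots: "f \<in> slots n (k + m) \<Longrightarrow> gg n k m f \<in> slots n (k + m + 2)"
  unfolding gg_def by (rule lin_slots)

lemma con_gg_below: "f \<in> TT n k m \<Longrightarrow> j < k \<Longrightarrow> con n j (gg n k m f) = (\<lambda>w. 0)"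
  unfolding gg_def
  by (subst con_lin_simple) (use TT_slots in \<open>auto simp: gc_def TTD cf_gc_below intro!: TTD\<close>)

lemma con_gg_eq:
  "f \<in> TT n k m \<Longrightarrow> con n k (gg n k m f) = (\<lambda>w. eps n ^ k * dc n (Suc (Suc k)) / dd n * f w)"
  unfolding gg_def
  by (subst con_lin_simple) (use TT_slots in \<open>auto simp: gc_def TTD cf_gc_last intro!: TTD\<close>)

lemma con_gg_above:
  "f \<in> TT n k m \<Longrightarrow> k + 2 \<le> j \<Longrightarrow> j \<le> k + m \<Longrightarrow> con n j (gg n k m f) = (\<lambda>w. 0)"
  unfolding gg_def
  by (subst con_lin_simple) (use TT_slots in \<open>auto simp: gc_def TTD cf_gc_above intro!: TTD\<close>)

lemma con_gg_Suc_E: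
  assumes "f \<in> TT n 0 (k + m)" "1 \<le> m"
  shows "con n (Suc k) (gg n k m f) = (\<lambda>w. kap n * eps n ^ k * dc n (Suc k) * f w)"
  unfolding gg_def
  using assms TT_slots[of n 0 "k + m"]
  by (subst con_lin_simple) (auto simp: gc_def cf_gc_Suc intro!: TTD)

text \<open>The insertion on the neighbouring leg gives the scalar term. The earlier insertions
  commute past the contraction, which then hits \<open>f\<close> across its own boundary, and their
  coefficients are those of G for one leg less. This is the source of the induction on powers of
  \<sigma>.\<close>

lemma con_gg_Suc:
  assumes "f \<in> TT n (Suc k) (Suc m)"
  shows "con n (Suc (Suc k)) (gg n (Suc k) (Suc m) f)
     = (\<lambda>w. kap n * eps n ^ Suc k * dc n (Suc (Suc k)) * f w + gg n k m (con n k f) w)"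
proof
  fix w
  have fs: "f \<in> slots n (Suc k + Suc m)" using assms TT_slots by blast
  have "con n (Suc (Suc k)) (gg n (Suc k) (Suc m) f) w = cf n (Suc k + Suc m) (gc n (Suc k)) (Suc (Suc k)) * f w
    + (\<Sum>i\<le>Suc k + Suc m. if Suc (Suc k) + 2 \<le> i then gc n (Suc k) i * ins n (i - 2) (con n (Suc (Suc k)) f) w else 0)
    + (\<Sum>i\<le>Suc k + Suc m. if i + 2 \<le> Suc (Suc k) then gc n (Suc k) i * ins n i (con n (Suc (Suc k) - 2) f) w else 0)"
    unfolding gg_def by (rule con_lin_expand[OF fs]) simp
  also have "(\<Sum>i\<le>Suc k + Suc m. if Suc (Suc k) + 2 \<le> i then gc n (Suc k) i * ins n (i - 2) (con n (Suc (Suc k)) f) w else 0) = 0"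
    by (rule sum.neutral) (simp add: gc_def)
  also have "(\<Sum>i\<le>Suc k + Suc m. if i + 2 \<le> Suc (Suc k) then gc n (Suc k) i * ins n i (con n (Suc (Suc k) - 2) f) w else 0)
     = (\<Sum>i\<le>k + m. gc n k i * ins n i (con n k f) w)"
    by (rule sum.mono_neutral_cong_right) (auto simp: gc_def)
  finally show "con n (Suc (Suc k)) (gg n (Suc k) (Suc m) f) w
      = kap n * eps n ^ Suc k * dc n (Suc (Suc k)) * f w + gg n k m (con n k f) w"
    by (simp add: cf_gc_Suc gg_def lin_def)
qed

lemma TT_con:
  assumes "f \<in> TT n (Suc k) (Suc m)"
  shows "con n k f \<in> TT n k m"
proof -
  have f: "f \<in> slots n (k + m + 2)" using assms TT_slots[of n "Suc k" "Suc m"] by auto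
  then have fV: "f \<in> Vec (n * (k + m + 2))" using slots_Vec by blast
  have "con n i (con n k f) = (\<lambda>w. 0)" if i: "i + 1 < k + m" "i + 1 \<noteq> k" for i
  proof (cases "i + 1 < k")
    case True
    have e: "k + m - 2 + 2 + 2 = k + m + 2" "k - 2 + 2 = k" using True by auto
    have "f \<in> Vec (n * (k + m - 2 + 2 + 2))" unfolding e by (rule fV)
    from con_con[OF this, of i "k - 2"] True e have "con n i (con n k f) = con n (k - 2) (con n i f)"
      by (simp only:)
    then show ?thesis using TTD[OF assms, of i] True by simp
  next
    case False
    then have ki: "k \<le> i" using i by simp
    have e: "k + m - 2 + 2 + 2 = k + m + 2" using i by auto
    have "f \<in> Vec (n * (k + m - 2 + 2 + 2))" unfolding e by (rule fV)
    from con_con[OF this, of k i] ki i have "con n k (con n (i + 2) f) = con n i (con n k f)"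
      by auto
    moreover have "con n (i + 2) f = (\<lambda>w. 0)" using i ki by (intro TTD[OF assms]) auto
    ultimately show ?thesis by simp
  qed
  moreover have "con n k f \<in> slots n (k + m)" using f by (rule slots_con) simp
  ultimately show ?thesis by (simp add: TT_def)
qed

context
  fixes n k m f
  assumes f: "f \<in> TT n k (Suc m)"
begin

private abbreviation "\<theta> \<equiv> con n (Suc k) (gg n k (Suc m) f)"

lemma gg_con_slots: "\<theta> \<in> slots n (k + Suc m)"
  by (rule slots_con[OF gg_slots[OF TT_slotsD[OF f]]]) simp

text \<open>Equivalently, \<theta> lies in E_(k+1) \<otimes> E_m: one leg has moved across the
  boundary. The mirrored G acts on this second factor E_m.\<close>

lemma con_gg_con:
  assumes "j + 1 \<le> k + m" "j \<noteq> k"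
  shows "con n j \<theta> = (\<lambda>w. 0)"
proof -
  have gV: "gg n k (Suc m) f \<in> Vec (n * (k + Suc m + 2))"
    using gg_slots[of f n k "Suc m"] f TT_slots slots_Vec by blast
  have e: "k + m - 1 + 2 + 2 = k + Suc m + 2" using assms by auto
  have gV': "gg n k (Suc m) f \<in> Vec (n * (k + m - 1 + 2 + 2))" unfolding e by (rule gV)
  show ?thesis
  proof (cases "j < k")
    case True
    then have k: "k - 1 + 2 = Suc k" by simp
    have "con n j (con n (k - 1 + 2) (gg n k (Suc m) f)) = con n (k - 1) (con n j (gg n k (Suc m) f))"
      using True by (intro con_con[OF gV']) auto
    then show ?thesis unfolding k con_gg_below[OF f True] by simp
  next
    case False
    have "con n (Suc k) (con n (j + 2) (gg n k (Suc m) f)) = con n j \<theta>"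
      using False assms by (intro con_con[OF gV']) auto
    moreover have "con n (j + 2) (gg n k (Suc m) f) = (\<lambda>w. 0)"
      using False assms by (intro con_gg_above[OF f]) auto
    ultimately show ?thesis by simp
  qed
qed

lemma con_hh_zero:
  assumes "j < k \<or> k + 2 \<le> j" "j \<le> k + Suc m"
  shows "con n j (lin n (k + Suc m) (hc n k (Suc m)) \<theta>) = (\<lambda>w. 0)"
proof -
  have "con n j (lin n (k + Suc m) (hc n k (Suc m)) \<theta>) = (\<lambda>w. cf n (k + Suc m) (hc n k (Suc m)) j * \<theta> w)"
  proof (rule con_lin_simple[OF gg_con_slots assms(2)])
    fix i assume "j + 2 \<le> i" "i \<le> k + Suc m"
    then show "hc n k (Suc m) i = 0 \<or> con n j \<theta> = (\<lambda>w. 0)"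
      using assms by (intro disjI2 con_gg_con) auto
  next
    fix i assume i: "i + 2 \<le> j"
    show "hc n k (Suc m) i = 0 \<or> con n (j - 2) \<theta> = (\<lambda>w. 0)"
    proof (cases "k < i")
      case True
      then show ?thesis using assms i by (intro disjI2 con_gg_con) auto
    qed (simp add: hc_def)
  qed
  moreover have "cf n (k + Suc m) (hc n k (Suc m)) j = 0"
    using assms cf_hc_below cf_hc_above by blast
  ultimately show ?thesis by simp
qed

lemma con_hh_Suc:
  "con n (Suc k) (lin n (k + Suc m) (hc n k (Suc m)) \<theta>) = (\<lambda>w. dc n (Suc (Suc m)) / dd n * \<theta> w)"
proof -
  have "con n (Suc k) (lin n (k + Suc m) (hc n k (Suc m)) \<theta>)
      = (\<lambda>w. cf n (k + Suc m) (hc n k (Suc m)) (Suc k) * \<theta> w)"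
  proof (rule con_lin_simple[OF gg_con_slots])
    fix i assume "Suc k + 2 \<le> i" "i \<le> k + Suc m"
    then show "hc n k (Suc m) i = 0 \<or> con n (Suc k) \<theta> = (\<lambda>w. 0)"
      by (intro disjI2 con_gg_con) auto
  qed (auto simp: hc_def)
  then show ?thesis using cf_hc_Suc[where n = n and k = k and m = "Suc m"] by simp
qed

end

lemma sg_no_right: "sg n k 0 f = gg n k 0 f"
  unfolding sg_def by (subst lin_zero_coeff) (auto simp: hc_def)

text \<open>At position k+1 the mirrored part contracts to d_m/d_1 times \<theta>
  (\<open>con_hh_Suc\<close>), and the factor in \<open>sg\<close> is the reciprocal, so the two
  parts cancel. At every other position except the boundary both contractions vanish
  separately.\<close>

lemma sg_TT:
  assumes "n \<ge> 1" and f: "f \<in> TT n k m"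
  shows "sg n k m f \<in> TT n (Suc k) (Suc m)"
proof (cases m)
  case 0
  have "con n i (gg n k 0 f) = (\<lambda>w. 0)" if "i + 1 < Suc k + 1" "i + 1 \<noteq> Suc k" for i
    using f 0 that by (intro con_gg_below) auto
  moreover have "gg n k 0 f \<in> slots n (k + 0 + 2)"
    using TT_slotsD[OF f] 0 by (intro gg_slots) simp
  ultimately show ?thesis using 0 by (simp add: sg_no_right TT_def)
next
  case (Suc m')
  let ?\<theta> = "con n (Suc k) (gg n k m f)" and ?c = "dd n / dc n (Suc m)"
  have f': "f \<in> TT n k (Suc m')" using f Suc by simp
  have nz: "dc n (Suc m) \<noteq> 0" using assms by (intro dc_nz) auto
  have gs: "gg n k m f \<in> slots n (k + m + 2)" using f TT_slots by (intro gg_slots) auto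
  have hs: "lin n (k + m) (hc n k m) ?\<theta> \<in> slots n (k + m + 2)"
    using gg_con_slots[OF f'] Suc by (intro lin_slots) simp
  have "sg n k m f \<in> slots n (k + m + 2)"
    using csub_lin[OF csub_slots gs hs, of 1 "- ?c"] by (simp add: sg_def)
  moreover have "con n i (sg n k m f) = (\<lambda>w. 0)" if i: "i + 1 < k + m + 2" "i \<noteq> k" for i
  proof -
    have "con n i (sg n k m f) = (\<lambda>w. con n i (gg n k m f) w - ?c * con n i (lin n (k + m) (hc n k m) ?\<theta>) w)"
      unfolding sg_def by (rule con_diff)
    also have "\<dots> = (\<lambda>w. 0)"
    proof (cases "i = Suc k")
      case True
      then show ?thesis using con_hh_Suc[OF f'] nz Suc by simp
    next
      case False
      have "con n i (lin n (k + m) (hc n k m) ?\<theta>) = (\<lambda>w. 0)"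
        unfolding Suc using False i Suc by (intro con_hh_zero[OF f']) auto
      moreover have "con n i (gg n k m f) = (\<lambda>w. 0)"
        using False i con_gg_below[OF f, of i] con_gg_above[OF f, of i] by (cases "i < k") auto
      ultimately show ?thesis by simp
    qed
    finally show ?thesis .
  qed
  ultimately show ?thesis by (simp add: TT_def)
qed

section \<open>The adjoint of \<sigma> and its boundary contraction\<close>

lemma ip_sum_left:
  assumes "\<And>i. i \<in> I \<Longrightarrow> F i \<in> Vec N"
  shows "ip (\<lambda>w. \<Sum>i\<in>I. a i * F i w) h = (\<Sum>i\<in>I. a i * ip (F i) h)"
proof -
  have V: "(\<lambda>w. \<Sum>i\<in>I. a i * F i w) \<in> Vec N" by (intro csub_sum[OF csub_Vec] assms)
  have "ip (\<lambda>w. \<Sum>i\<in>I. a i * F i w) h = (\<Sum>w\<in>words N. \<Sum>i\<in>I. a i * (F i w * cnj (h w)))"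
    unfolding ip_eq[OF V] by (simp add: sum_distrib_right mult.assoc)
  also have "\<dots> = (\<Sum>i\<in>I. \<Sum>w\<in>words N. a i * (F i w * cnj (h w)))" by (rule sum.swap)
  also have "\<dots> = (\<Sum>i\<in>I. a i * ip (F i) h)"
    by (intro sum.cong refl) (simp add: ip_eq[OF assms] sum_distrib_left)
  finally show ?thesis .
qed

lemma ip_lin_left:
  assumes "f \<in> Vec N" "g \<in> Vec N"
  shows "ip (\<lambda>w. a * f w + b * g w) h = a * ip f h + b * ip g h"
  unfolding ip_eq[OF assms(1)] ip_eq[OF assms(2)] ip_eq[OF csub_lin[OF csub_Vec assms]]
  by (simp add: ring_distribs sum.distrib sum_distrib_left mult.assoc)

text \<open>Every insertion away from position k is adjoint to a contraction that kills
  \<open>h\<close>. Only the last coefficient of G survives; the mirrored part starts behind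
  position k and contributes nothing.\<close>

lemma ip_sg:
  assumes f: "f \<in> TT n k m" and h: "h \<in> TT n (Suc k) (Suc m)"
  shows "ip (sg n k m f) h = eps n ^ k * dc n (Suc k) * ip f (con n k h)"
proof -
  have fV: "f \<in> Vec (n * (k + m))" using f TT_Vec by blast
  have iV: "ins n i g \<in> Vec (n * (k + m + 2))" if "g \<in> Vec (n * (k + m))" "i \<le> k + m" for i g
    using that by (rule ins_Vec)
  have ch: "con n i h = (\<lambda>w. 0)" if "i \<le> k + m" "i \<noteq> k" for i
    using that by (intro TTD[OF h]) auto
  have lin_ip: "ip (lin n (k + m) a g) h = a k * ip g (con n k h)" if g: "g \<in> Vec (n * (k + m))" for a g
  proof -
    have "ip (lin n (k + m) a g) h = (\<Sum>i\<le>k + m. a i * ip (ins n i g) h)"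
      unfolding lin_def by (rule ip_sum_left[where N = "n * (k + m + 2)"]) (use iV[OF g] in auto)
    also have "\<dots> = (\<Sum>i\<le>k + m. if i = k then a k * ip g (con n k h) else 0)"
      using ip_ins[OF g] ch by (intro sum.cong) auto
    finally show ?thesis by simp
  qed
  have linV: "lin n (k + m) a g \<in> Vec (n * (k + m + 2))" if "g \<in> Vec (n * (k + m))" for a g
    unfolding lin_def using iV[OF that] by (intro csub_sum[OF csub_Vec]) auto
  have gV: "gg n k m f \<in> Vec (n * (k + m + 2))" unfolding gg_def by (rule linV[OF fV])
  have g: "ip (gg n k m f) h = eps n ^ k * dc n (Suc k) * ip f (con n k h)"
    unfolding gg_def lin_ip[OF fV] by (simp add: gc_def)
  show ?thesis
  proof (cases m)
    case 0
    then show ?thesis using g by (simp add: sg_no_right)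
  next
    case (Suc m')
    have tV: "con n (Suc k) (gg n k m f) \<in> Vec (n * (k + m))"
      using gV Suc by (intro con_Vec) auto
    have "ip (sg n k m f) h = ip (gg n k m f) h
       - dd n / dc n (Suc m) * ip (lin n (k + m) (hc n k m) (con n (Suc k) (gg n k m f))) h"
      using ip_lin_left[OF gV linV[OF tV], of 1 "- (dd n / dc n (Suc m))"] by (simp add: sg_def)
    then show ?thesis unfolding lin_ip[OF tV] g by (simp add: hc_def)
  qed
qed

lemma con_sg_E:
  assumes n: "n \<ge> 1" and f: "f \<in> TT n 0 (k + m)"
  shows "con n k (sg n k m f)
     = (\<lambda>w. eps n ^ k / dd n * (dc n (Suc (Suc k)) - dc n (Suc k) * dc n m / dc n (Suc m)) * f w)"
proof -
  have fT: "f \<in> TT n k m" using f by (auto simp: TT_def)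
  show ?thesis
  proof (cases m)
    case 0
    then show ?thesis using con_gg_eq[OF fT] by (simp add: sg_no_right)
  next
    case (Suc m')
    have nz: "dc n (Suc m) \<noteq> 0" using n by (intro dc_nz) auto
    have f': "f \<in> TT n k (Suc m')" using fT Suc by simp
    have th: "con n (Suc k) (gg n k m f) = (\<lambda>w. kap n * eps n ^ k * dc n (Suc k) * f w)"
      using f Suc by (intro con_gg_Suc_E) auto
    have "con n k (lin n (k + m) (hc n k m) (con n (Suc k) (gg n k m f)))
        = (\<lambda>w. cf n (k + m) (hc n k m) k * con n (Suc k) (gg n k m f) w)"
    proof (rule con_lin_simple)
      show "con n (Suc k) (gg n k m f) \<in> slots n (k + m)" using gg_con_slots[OF f'] Suc by simp
    next
      fix i assume "k + 2 \<le> i" "i \<le> k + m"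
      then have "con n k f = (\<lambda>w. 0)" by (intro TTD[OF f]) auto
      then show "hc n k m i = 0 \<or> con n k (con n (Suc k) (gg n k m f)) = (\<lambda>w. 0)"
        unfolding th con_scale by simp
    qed (auto simp: hc_def)
    moreover have "cf n (k + m) (hc n k m) k = kap n * dc n m" using Suc by (intro cf_hc_eq) simp
    ultimately show ?thesis
      unfolding sg_def con_diff con_gg_eq[OF fT] th using nz
      by (simp add: kap_eq fun_eq_iff field_simps)
  qed
qed

text \<open>Contracting the mirrored part yields \<open>kap\<close> times \<theta> plus the mirrored
  part of the smaller problem. By \<open>con_gg_Suc\<close>, \<theta> contains
  \<open>gg n k m (con n k f)\<close>; this cancels against the \<open>gg\<close> in the smaller
  mirrored part, and exactly \<open>sg n k m (con n k f)\<close> is left.\<close>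

lemma con_sg:
  assumes n: "n \<ge> 1" and f: "f \<in> TT n (Suc k) (Suc m)"
  shows "con n (Suc k) (sg n (Suc k) (Suc m) f)
     = (\<lambda>w. eps n ^ Suc k / dd n
          * (dc n (Suc (Suc (Suc k))) - dc n (Suc (Suc k)) * dc n (Suc m) / dc n (Suc (Suc m))) * f w
        + eps n * dc n (Suc m) / dc n (Suc (Suc m)) * sg n k m (con n k f) w)"
proof
  fix w
  let ?f' = "con n k f"
  let ?\<theta> = "con n (Suc (Suc k)) (gg n (Suc k) (Suc m) f)"
  let ?t = "con n (Suc k) (gg n k m ?f')"
  let ?M = "Suc k + Suc m"
  have nz: "dc n (Suc m) \<noteq> 0" "dc n (Suc (Suc m)) \<noteq> 0" by (rule dc_nz[OF n], simp)+
  have th: "?\<theta> w = kap n * eps n ^ Suc k * dc n (Suc (Suc k)) * f w + gg n k m ?f' w" for w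
    unfolding con_gg_Suc[OF f] ..
  have conth: "con n (Suc k) ?\<theta> = ?t" if "1 \<le> m"
  proof -
    have "con n (Suc k) f = (\<lambda>w. 0)" using that by (intro TTD[OF f]) auto
    then show ?thesis unfolding con_gg_Suc[OF f]
      using con_lin[of n "Suc k" "kap n * eps n ^ Suc k * dc n (Suc (Suc k))" f 1 "gg n k m ?f'"] by simp
  qed
  have "con n (Suc k) (lin n ?M (hc n (Suc k) (Suc m)) ?\<theta>) w = cf n ?M (hc n (Suc k) (Suc m)) (Suc k) * ?\<theta> w
     + (\<Sum>i\<le>?M. if Suc k + 2 \<le> i then hc n (Suc k) (Suc m) i * ins n (i - 2) (con n (Suc k) ?\<theta>) w else 0)
     + (\<Sum>i\<le>?M. if i + 2 \<le> Suc k then hc n (Suc k) (Suc m) i * ins n i (con n (Suc k - 2) ?\<theta>) w else 0)"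
    by (rule con_lin_expand[OF gg_con_slots[OF f]]) simp
  also have "cf n ?M (hc n (Suc k) (Suc m)) (Suc k) = kap n * dc n (Suc m)"
    by (rule cf_hc_eq) simp
  also have "(\<Sum>i\<le>?M. if i + 2 \<le> Suc k then hc n (Suc k) (Suc m) i * ins n i (con n (Suc k - 2) ?\<theta>) w else 0) = 0"
    by (rule sum.neutral) (simp add: hc_def)
  also have "(\<Sum>i\<le>?M. if Suc k + 2 \<le> i then hc n (Suc k) (Suc m) i * ins n (i - 2) (con n (Suc k) ?\<theta>) w else 0)
      = eps n * lin n (k + m) (hc n k m) ?t w"
  \<comment> \<open>For m = 0 both sides are empty. The hypothesis m \<ge> 1 of \<open>conth\<close>
    places the contraction at k+1 of \<open>f\<close> inside the second factor.\<close>
  proof (cases m)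
    case 0
    have "lin n (k + m) (hc n k m) ?t = (\<lambda>w. 0)"
      by (rule lin_zero_coeff) (simp add: hc_def 0)
    then show ?thesis using 0 by (auto intro!: sum.neutral)
  next
    case (Suc m')
    then have ct: "con n (Suc k) ?\<theta> = ?t" by (intro conth) simp
    have "(\<Sum>i\<le>?M. if Suc k + 2 \<le> i then hc n (Suc k) (Suc m) i * ins n (i - 2) ?t w else 0)
        = (\<Sum>i\<in>{Suc k + 2..?M}. hc n (Suc k) (Suc m) i * ins n (i - 2) ?t w)"
      by (rule sum.mono_neutral_cong_right) auto
    \<comment> \<open>For i > k, \<open>hc n (Suc k) (Suc m) (i + 2)\<close> is \<open>eps n\<close>
      times \<open>hc n k m i\<close>: the number of legs to the right is unchanged, and the
      exponent of the sign grows by one.\<close>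
    also have "\<dots> = (\<Sum>i\<in>{Suc k..k + m}. eps n * (hc n k m i * ins n i ?t w))"
      by (rule sum.reindex_bij_witness[where i = "\<lambda>i. i + 2" and j = "\<lambda>i. i - 2"])
         (auto simp: hc_def Suc_diff_le Suc_diff_Suc simp flip: power_Suc)
    also have "\<dots> = (\<Sum>i\<le>k + m. eps n * (hc n k m i * ins n i ?t w))"
      by (rule sum.mono_neutral_left) (auto simp: hc_def)
    finally show ?thesis unfolding ct by (simp add: lin_def sum_distrib_left)
  qed
  finally have h: "con n (Suc k) (lin n ?M (hc n (Suc k) (Suc m)) ?\<theta>) w
      = kap n * dc n (Suc m) * ?\<theta> w + eps n * lin n (k + m) (hc n k m) ?t w" by simp
  have l: "lin n (k + m) (hc n k m) ?t w = dc n (Suc m) / dd n * (gg n k m ?f' w - sg n k m ?f' w)"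
    using nz by (simp add: sg_def)
  have "con n (Suc k) (sg n (Suc k) (Suc m) f) w
      = eps n ^ Suc k * dc n (Suc (Suc (Suc k))) / dd n * f w
        - dd n / dc n (Suc (Suc m)) * (kap n * dc n (Suc m) * ?\<theta> w + eps n * lin n (k + m) (hc n k m) ?t w)"
    unfolding sg_def[of n "Suc k"] con_diff con_gg_eq[OF f] h ..
  also have "\<dots> = eps n ^ Suc k / dd n
          * (dc n (Suc (Suc (Suc k))) - dc n (Suc (Suc k)) * dc n (Suc m) / dc n (Suc (Suc m))) * f w
        + eps n * dc n (Suc m) / dc n (Suc (Suc m)) * sg n k m ?f' w"
    unfolding l th kap_eq using nz by (simp add: field_simps)
  finally show "con n (Suc k) (sg n (Suc k) (Suc m) f) w = eps n ^ Suc k / dd n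
          * (dc n (Suc (Suc (Suc k))) - dc n (Suc (Suc k)) * dc n (Suc m) / dc n (Suc (Suc m))) * f w
        + eps n * dc n (Suc m) / dc n (Suc (Suc m)) * sg n k m ?f' w" .
qed

section \<open>Orthogonal decomposition\<close>

lemma rslice_ins:
  assumes "i \<le> k" "length u = n * (k + 2)"
  shows "ins n i (rslice (n * k) y f) u = ins n i f (u @ y)"
proof -
  have nk: "n * i \<le> n * k" using assms(1) by (rule mult_le_mono2)
  have lu: "length u = n * k + 2 * n" using assms(2) by simp
  have len: "n * i \<le> length u" "n * i + 2 * n \<le> length u" "2 * n \<le> length u - n * i"
    using nk lu by linarith+
  have "length (take (n * i) u @ drop (n * i + 2 * n) u) = n * k"
    unfolding length_append length_take length_drop using nk lu by linarith
  then show ?thesis using len unfolding ins_def rslice_def by simp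
qed

text \<open>\<open>opL\<close> is 0 by definition on lists shorter than its output; the closed form
  has to vanish there too.\<close>

lemma ins_short:
  assumes "f \<in> Vec (n * m + b)" "length w < n * (m + 2)"
  shows "ins n i f w = 0"
proof (cases "length (take (n * i) w @ drop (n * i + 2 * n) w) = n * m + b
    \<and> length (take (2 * n) (drop (n * i) w)) = 2 * n")
  case True
  then have False using assms(2) by (auto simp: min_def split: if_splits)
  then show ?thesis ..
next
  case False
  then show ?thesis
    using Vec_length[OF assms(1)] Vec_length[OF delta_Vec[of n]] unfolding ins_def by fastforce
qed

text \<open>The closed form of G is a hypothesis because the lemma serves inside the induction that
  proves it, and again afterwards in \<open>sigma_eq\<close>.\<close>

lemma opL_G:
  assumes "f \<in> Vec (n * m + b)"
    and G: "\<And>g. g \<in> Vec (n * m) \<Longrightarrow> G n (Suc m) g = (\<lambda>w. \<Sum>i\<le>m. eps n ^ i * dc n (Suc i) * ins n i g w)"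
  shows "opL (n * m) (n * (m + 2)) (G n (Suc m)) f = (\<lambda>w. \<Sum>i\<le>m. eps n ^ i * dc n (Suc i) * ins n i f w)"
proof
  fix w
  show "opL (n * m) (n * (m + 2)) (G n (Suc m)) f w = (\<Sum>i\<le>m. eps n ^ i * dc n (Suc i) * ins n i f w)"
  proof (cases "n * (m + 2) \<le> length w")
    case True
    then obtain u y where w: "w = u @ y" "length u = n * (m + 2)" by (rule split_list_at)
    have t: "take (n * (m + 2)) w = u" "drop (n * (m + 2)) w = y" using w by simp_all
    have "opL (n * m) (n * (m + 2)) (G n (Suc m)) f w = G n (Suc m) (rslice (n * m) y f) u"
      using True unfolding opL_def rslice_def t by (simp only: if_True)
    also have "\<dots> = (\<Sum>i\<le>m. eps n ^ i * dc n (Suc i) * ins n i (rslice (n * m) y f) u)"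
      unfolding G[OF rslice_Vec[OF assms(1)]] ..
    also have "\<dots> = (\<Sum>i\<le>m. eps n ^ i * dc n (Suc i) * ins n i f w)"
      unfolding w(1) using w(2) by (intro sum.cong refl) (simp add: rslice_ins)
    finally show ?thesis .
  next
    case False
    then have "opL (n * m) (n * (m + 2)) (G n (Suc m)) f w = 0" by (simp only: opL_def if_False)
    moreover have "ins n i f w = 0" for i
      using False by (intro ins_short[OF assms(1)]) simp
    ultimately show ?thesis by simp
  qed
qed

lemma tens_delta: 
  assumes "f \<in> Vec (n * m)"
  shows "tens (n * m) f (delta n) = ins n m f"
proof
  fix w
  show "tens (n * m) f (delta n) w = ins n m f w"
  proof (cases "length w = n * m + 2 * n")
    case True
    then show ?thesis by (simp add: tens_def ins_def)
  next
    case False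
    have "ins n m f w = 0"
    proof (rule ccontr)
      assume "ins n m f w \<noteq> 0"
      then have "length (take (n * m) w @ drop (n * m + 2 * n) w) = n * m"
        "length (take (2 * n) (drop (n * m) w)) = 2 * n"
        using Vec_length[OF assms] Vec_length[OF delta_Vec[of n]] unfolding ins_def by fastforce+
      with False show False by (auto simp: min_def split: if_splits)
    qed
    moreover have "tens (n * m) f (delta n) w = 0"
    proof (rule ccontr)
      assume "tens (n * m) f (delta n) w \<noteq> 0"
      then have "length (take (n * m) w) = n * m" "length (drop (n * m) w) = 2 * n"
        using Vec_length[OF assms] Vec_length[OF delta_Vec[of n]] unfolding tens_def by fastforce+
      with False show False by (auto simp: min_def split: if_splits)
    qed
    ultimately show ?thesis by simp
  qed
qed

text \<open>The recursion appends one insertion at the end at each stage, and (-1)^((n+1)i) is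
  eps^i; unrolling it gives the coefficients \<open>gc\<close>.\<close>

lemma G_eq:
  "f \<in> Vec (n * m) \<Longrightarrow> G n (Suc m) f = (\<lambda>w. \<Sum>i\<le>m. eps n ^ i * dc n (Suc i) * ins n i f w)"
proof (induction m arbitrary: f)
  case 0
  have "f [] * delta n w = ins n 0 f w" for w
    using fun_cong[OF tens_delta[of f n 0], of w] 0 by (simp add: tens_def)
  then show ?case by simp
next
  case (Suc m)
  have V: "f \<in> Vec (n * m + n)" using Suc.prems by (simp add: add.commute)
  have c: "(-1) ^ ((n + 1) * (m + 1)) * of_int (d n (int (m + 1))) = eps n ^ Suc m * dc n (Suc (Suc m))"
    unfolding power_mult eps_def dc_def d_def by (simp add: nat_add_distrib)
  have t: "tens (n * (m + 1)) f (delta n) = ins n (Suc m) f"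
    using tens_delta[OF Suc.prems] by simp
  have o: "opL (n * m) (n * (m + 2)) (G n (Suc m)) f = (\<lambda>w. \<Sum>i\<le>m. eps n ^ i * dc n (Suc i) * ins n i f w)"
    by (rule opL_G[OF V Suc.IH])
  show ?case
    unfolding G.simps o c t by (simp only: sum.atMost_Suc)
qed

text \<open>Fixing the first k+1 legs, \<open>gg\<close> and \<open>sg\<close> differ by insertions
  into the remaining legs, which are orthogonal to E_(m+1), while the slice of \<open>sg\<close>
  lies in E_(m+1). These two facts characterize the projection.\<close>

lemma oproj_slice:
  assumes n: "n \<ge> 1" and f: "f \<in> TT n k m" and x: "length x = n * Suc k"
  shows "oproj (E n (Suc m)) (lslice x (gg n k m f)) = lslice x (sg n k m f)"
proof (rule oproj_eqI)
  show "csub (E n (Suc m))" unfolding E_eq_TT by (rule csub_TT)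
  show "E n (Suc m) \<subseteq> Vec (n * Suc m)" unfolding E_eq_TT using TT_Vec[of n 0 "Suc m"] by simp
  have gs: "gg n k m f \<in> slots n (Suc k + Suc m)"
    using gg_slots[OF TT_slotsD[OF f]] by simp
  then show gV: "lslice x (gg n k m f) \<in> Vec (n * Suc m)"
    using slots_lslice[OF gs x] slots_Vec by blast
  have S: "sg n k m f \<in> TT n (Suc k) (Suc m)" by (rule sg_TT[OF n f])
  have "con n i (lslice x (sg n k m f)) = (\<lambda>w. 0)" if "i + 1 < Suc m" for i
    using lslice_con[OF x, of i "sg n k m f"] TTD[OF S, of "Suc k + i"] that
    by (simp add: lslice_def)
  then show "lslice x (sg n k m f) \<in> E n (Suc m)"
    using slots_lslice[OF TT_slotsD[OF S] x] by (simp add: E_eq_TT TT_def)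
  fix h assume h: "h \<in> E n (Suc m)"
  show "ip (\<lambda>w. lslice x (gg n k m f) w - lslice x (sg n k m f) w) h = 0"
  proof (cases m)
    case 0
    then show ?thesis by (simp add: sg_no_right ip_def)
  next
    case (Suc m')
    let ?\<theta> = "con n (Suc k) (gg n k m f)"
    have f': "f \<in> TT n k (Suc m')" using f Suc by simp
    have "?\<theta> \<in> slots n (k + Suc m')" using gg_con_slots[OF f'] unfolding Suc .
    then have "?\<theta> \<in> slots n (Suc k + m')" by simp
    then have "lslice x ?\<theta> \<in> slots n m'" by (rule slots_lslice[OF _ x])
    then have tV: "lslice x ?\<theta> \<in> Vec (n * m')" using slots_Vec by blast
    have li: "lslice x (ins n i ?\<theta>) = ins n (i - Suc k) (lslice x ?\<theta>)" if "k < i" for i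
      using lslice_ins[OF x, of "i - Suc k" ?\<theta>] that by simp
    have "(\<lambda>w. lslice x (gg n k m f) w - lslice x (sg n k m f) w)
        = (\<lambda>w. \<Sum>i\<in>{k<..k + m}. (dd n / dc n (Suc m) * hc n k m i) * ins n (i - Suc k) (lslice x ?\<theta>) w)"
    proof
      fix w
      have "lslice x (gg n k m f) w - lslice x (sg n k m f) w
          = (\<Sum>i\<le>k + m. (dd n / dc n (Suc m) * hc n k m i) * ins n i ?\<theta> (x @ w))"
        by (simp add: sg_def lin_def lslice_def sum_distrib_left mult_ac)
      also have "\<dots> = (\<Sum>i\<in>{k<..k + m}. (dd n / dc n (Suc m) * hc n k m i) * ins n i ?\<theta> (x @ w))"
        by (rule sum.mono_neutral_right) (auto simp: hc_def)
      also have "\<dots> = (\<Sum>i\<in>{k<..k + m}. (dd n / dc n (Suc m) * hc n k m i) * ins n (i - Suc k) (lslice x ?\<theta>) w)"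
        using li by (intro sum.cong refl) (auto simp: lslice_def fun_eq_iff)
      finally show "lslice x (gg n k m f) w - lslice x (sg n k m f) w
          = (\<Sum>i\<in>{k<..k + m}. (dd n / dc n (Suc m) * hc n k m i) * ins n (i - Suc k) (lslice x ?\<theta>) w)" .
    qed
    moreover have "ip (\<lambda>w. \<Sum>i\<in>{k<..k + m}. (dd n / dc n (Suc m) * hc n k m i) * ins n (i - Suc k) (lslice x ?\<theta>) w) h
        = (\<Sum>i\<in>{k<..k + m}. (dd n / dc n (Suc m) * hc n k m i) * ip (ins n (i - Suc k) (lslice x ?\<theta>)) h)"
      by (rule ip_sum_left[where N = "n * (m' + 2)"], rule ins_Vec[OF tV]) (use Suc in auto)
    moreover have "ip (ins n (i - Suc k) (lslice x ?\<theta>)) h = 0" if i: "i \<in> {k<..k + m}" for i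
    proof -
      have "con n (i - Suc k) h = (\<lambda>w. 0)"
        using h i unfolding E_eq_TT by (intro TTD[where k = 0 and m = "Suc m"]) auto
      then show ?thesis using i Suc by (subst ip_ins[OF tV]) auto
    qed
    ultimately show ?thesis by simp
  qed
qed

lemma sigma_eq:
  assumes n: "n \<ge> 1" and f: "f \<in> TT n k m"
  shows "sigma n k m f = sg n k m f"
proof
  fix w
  have fV: "f \<in> Vec (n * k + n * m)" using f TT_Vec[of n k m] unfolding distrib_left by blast
  have g: "opL (n * k) (n * (k + 2)) (G n (k + 1)) f = gg n k m f"
  proof
    fix w
    have "opL (n * k) (n * (k + 2)) (G n (k + 1)) f w = (\<Sum>i\<le>k. eps n ^ i * dc n (Suc i) * ins n i f w)"
      using opL_G[OF fV G_eq] by simp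
    also have "\<dots> = gg n k m f w"
      unfolding gg_def lin_def by (rule sum.mono_neutral_cong_left) (auto simp: gc_def)
    finally show "opL (n * k) (n * (k + 2)) (G n (k + 1)) f w = gg n k m f w" .
  qed
  have gV: "gg n k m f \<in> Vec (n * Suc k + n * Suc m)"
  proof -
    have "gg n k m f \<in> slots n (Suc k + Suc m)" using gg_slots[OF TT_slotsD[OF f]] by simp
    then show ?thesis using slots_Vec[of n "Suc k + Suc m"] unfolding distrib_left by blast
  qed
  have sV: "sg n k m f \<in> Vec (n * Suc k + n * Suc m)"
    using sg_TT[OF n f] TT_Vec[of n "Suc k" "Suc m"] unfolding distrib_left by blast
  show "sigma n k m f w = sg n k m f w"
  proof (cases "n * Suc k \<le> length w")
    case True
    then obtain x y where w: "w = x @ y" "length x = n * Suc k" by (rule split_list_at)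
    have "(\<lambda>v. if length v = n * Suc m then gg n k m f (x @ v) else 0) = lslice x (gg n k m f)"
      using Vec_length[OF gV] w by (auto simp: lslice_def fun_eq_iff)
    moreover have t: "take (n * (k + 1)) w = x" "drop (n * (k + 1)) w = y" "n * (k + 1) \<le> length w"
      using w by simp_all
    moreover have e: "n * (1 + m) = n * Suc m" "m + 1 = Suc m" by simp_all
    ultimately have "sigma n k m f w = oproj (E n (Suc m)) (lslice x (gg n k m f)) y"
      by (simp only: sigma_def g opR_def if_True)
    also have "\<dots> = lslice x (sg n k m f) y" unfolding oproj_slice[OF n f w(2)] ..
    finally show ?thesis by (simp add: lslice_def w)
  next
    case False
    then have "sigma n k m f w = 0" unfolding sigma_def opR_def by simp
    moreover have "length w \<noteq> n * Suc k + n * Suc m" using False by linarith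
    ultimately show ?thesis using Vec_length[OF sV] by simp
  qed
qed

section \<open>Powers of \<sigma>: orthogonality and norms\<close>

lemma gg_lin: "gg n k m (\<lambda>w. s * f w + t * g w) = (\<lambda>w. s * gg n k m f w + t * gg n k m g w)"
  unfolding gg_def by (rule lin_lin)

lemma sg_lin: "sg n k m (\<lambda>w. s * f w + t * g w) = (\<lambda>w. s * sg n k m f w + t * sg n k m g w)"
  unfolding sg_def gg_lin con_lin lin_lin by (simp add: algebra_simps)

lemma sg_scale: "sg n k m (\<lambda>w. s * f w) = (\<lambda>w. s * sg n k m f w)"
  using sg_lin[of n k m s f 0 f] by simp

lemma sg_sum:
  "finite J \<Longrightarrow> sg n k m (\<lambda>w. \<Sum>j\<in>J. f j w) = (\<lambda>w. \<Sum>j\<in>J. sg n k m (f j) w)"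
proof (induction J rule: finite_induct)
  case empty
  show ?case using sg_scale[of n k m 0] by simp
next
  case (insert j J)
  have "sg n k m (\<lambda>w. f j w + (\<Sum>j\<in>J. f j w)) = (\<lambda>w. sg n k m (f j) w + sg n k m (\<lambda>w. \<Sum>j\<in>J. f j w) w)"
    using sg_lin[of n k m 1 "f j" 1] by simp
  then show ?case using insert by simp
qed

text \<open>Counts upwards from the source (p, q), whereas \<open>sigpow\<close> counts down from
  the target; inductions then run without truncated subtraction.\<close>

fun sp :: "nat \<Rightarrow> nat \<Rightarrow> nat \<Rightarrow> nat \<Rightarrow> vec \<Rightarrow> vec" where
  "sp n p q 0 f = f"
| "sp n p q (Suc i) f = sg n (p + i) (q + i) (sp n p q i f)"

lemma sp_lin: "sp n p q i (\<lambda>w. s * f w + t * g w) = (\<lambda>w. s * sp n p q i f w + t * sp n p q i g w)"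
  by (induction i) (simp_all add: sg_lin)

lemma sp_TT: "n \<ge> 1 \<Longrightarrow> f \<in> TT n p q \<Longrightarrow> sp n p q i f \<in> TT n (p + i) (q + i)"
  by (induction i) (simp_all add: sg_TT)

lemma sp_shift: "sp n (Suc p) (Suc q) j (sg n p q f) = sp n p q (Suc j) f"
  by (induction j) simp_all

lemma sigpow_eq: "n \<ge> 1 \<Longrightarrow> f \<in> TT n p q \<Longrightarrow> sigpow n (p + j) (q + j) j f = sp n p q j f"
proof (induction j arbitrary: p q f)
  case (Suc j)
  have "sigpow n (p + Suc j) (q + Suc j) (Suc j) f = sigpow n (Suc p + j) (Suc q + j) j (sg n p q f)"
    using Suc.prems by (simp add: sigma_eq)
  also have "\<dots> = sp n (Suc p) (Suc q) j (sg n p q f)"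
    using Suc.prems by (intro Suc.IH sg_TT)
  finally show ?case unfolding sp_shift .
qed simp

text \<open>Up to sign, the scalar by which the boundary contraction takes \<sigma>^i to
  \<sigma>^(i-1) on E_(p+q). Multiplied by d_(p+i-1) it becomes mu_(p+i) (1 - d_p d_(q-1) / (d_(p+i)
  d_(q+i-1))), the inverse square of the i-th factor of the normalization.\<close>

definition bb :: "nat \<Rightarrow> nat \<Rightarrow> nat \<Rightarrow> nat \<Rightarrow> complex" where
  "bb n p q i = (dc n (Suc (p + i)) * dc n (q + i) - dc n (Suc p) * dc n q) / (dd n * dc n (q + i))"

lemma E_TT: "f \<in> TT n 0 (p + q) \<Longrightarrow> f \<in> TT n p q"
  by (auto simp: TT_def)

text \<open>The scalars telescope: over the common denominator, the product subtracted in the first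
  term of \<open>con_sg\<close> is the leading product of the previous \<open>bb\<close>, and only
  the initial product d_p d_(q-1) stays subtracted.\<close>

lemma con_sp:
  assumes n: "n \<ge> 1" and f: "f \<in> TT n 0 (p + q)"
  shows "con n (p + i) (sp n p q (Suc i) f) = (\<lambda>w. eps n ^ (p + i) * bb n p q (Suc i) * sp n p q i f w)"
proof (induction i)
  case 0
  have nz: "dc n (Suc q) \<noteq> 0" by (rule dc_nz[OF n]) simp
  show ?case using con_sg_E[OF n f] nz by (simp add: bb_def fun_eq_iff field_simps)
next
  case (Suc i)
  have nz: "dc n (Suc (q + i)) \<noteq> 0" "dc n (Suc (Suc (q + i))) \<noteq> 0" by (rule dc_nz[OF n], simp)+
  have T: "sp n p q (Suc i) f \<in> TT n (Suc (p + i)) (Suc (q + i))"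
    using sp_TT[OF n E_TT[OF f], of "Suc i"] by simp
  have s: "sg n (p + i) (q + i) (con n (p + i) (sp n p q (Suc i) f))
      = (\<lambda>w. eps n ^ (p + i) * bb n p q (Suc i) * sp n p q (Suc i) f w)"
    unfolding Suc.IH by (simp add: sg_scale)
  have e: "sp n p q (Suc (Suc i)) f = sg n (Suc (p + i)) (Suc (q + i)) (sp n p q (Suc i) f)" by simp
  show ?case
    unfolding e add_Suc_right con_sg[OF n T] s using nz
    by (simp add: bb_def fun_eq_iff field_simps del: sp.simps)
qed

lemma cnj_eps [simp]: "cnj (eps n) = eps n"
  by (simp add: eps_def)

lemma cnj_dc [simp]: "cnj (dc n i) = dc n i"
  by (simp add: dc_def)

lemma cnj_bb [simp]: "cnj (bb n p q i) = bb n p q i"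
  by (simp add: bb_def dd_def)

lemma eps_power_sq: "eps n ^ i * eps n ^ i = 1"
  by (simp flip: power_mult_distrib)

text \<open>The outer \<sigma> on the left moves across as a boundary contraction, which by
  \<open>con_sp\<close> lowers the power on the right. Both steps carry the same sign eps^(p+i), so
  the signs cancel.\<close>

lemma ip_sp_Suc:
  assumes n: "n \<ge> 1" and f: "f \<in> TT n 0 (p + q)" and g: "g \<in> TT n 0 (p' + q')"
    and e: "p + i = p' + i'" "q + i = q' + i'"
  shows "ip (sp n p q (Suc i) f) (sp n p' q' (Suc i') g)
     = dc n (Suc (p + i)) * bb n p' q' (Suc i') * ip (sp n p q i f) (sp n p' q' i' g)"
proof -
  have F: "sp n p q i f \<in> TT n (p + i) (q + i)" by (rule sp_TT[OF n E_TT[OF f]])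
  have H: "sp n p' q' (Suc i') g \<in> TT n (Suc (p + i)) (Suc (q + i))"
    using sp_TT[OF n E_TT[OF g], of "Suc i'"] e by simp
  have V: "sp n p q i f \<in> Vec (n * (p + i + (q + i)))" using F TT_Vec by blast
  have "ip (sp n p q (Suc i) f) (sp n p' q' (Suc i') g)
      = eps n ^ (p + i) * dc n (Suc (p + i)) * ip (sp n p q i f) (con n (p + i) (sp n p' q' (Suc i') g))"
    using ip_sg[OF F H] by (simp del: sp.simps(2) add: sp.simps(2)[of n p q])
  also have "con n (p + i) (sp n p' q' (Suc i') g)
      = (\<lambda>w. eps n ^ (p + i) * bb n p' q' (Suc i') * sp n p' q' i' g w)"
    unfolding e by (rule con_sp[OF n g])
  also have "ip (sp n p q i f) \<dots> = eps n ^ (p + i) * bb n p' q' (Suc i') * ip (sp n p q i f) (sp n p' q' i' g)"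
    by (subst ip_scale_right[OF V]) simp
  finally show ?thesis using eps_power_sq[of n "p + i"] by (simp add: mult_ac del: sp.simps)
qed

lemma ip_sp_0:
  assumes n: "n \<ge> 1" and f: "f \<in> TT n 0 (p + q)" and g: "g \<in> TT n 0 (p' + q')"
    and e: "p + Suc i = p'" "q + Suc i = q'"
  shows "ip (sp n p q (Suc i) f) g = 0"
proof -
  have F: "sp n p q i f \<in> TT n (p + i) (q + i)" by (rule sp_TT[OF n E_TT[OF f]])
  have H: "g \<in> TT n (Suc (p + i)) (Suc (q + i))" using E_TT[OF g] e by simp
  have "con n (p + i) g = (\<lambda>w. 0)" using e by (intro TTD[OF g]) auto
  then show ?thesis using ip_sg[OF F H] by simp
qed

text \<open>Both exponents decrease together until one of them is 0; the vector left on that side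
  lies in E and is killed by the contraction coming from the other.\<close>

lemma ip_sp_orth:
  assumes n: "n \<ge> 1"
  shows "f \<in> TT n 0 (p + q) \<Longrightarrow> g \<in> TT n 0 (p' + q') \<Longrightarrow> p + i = p' + i' \<Longrightarrow> q + i = q' + i' \<Longrightarrow> i \<noteq> i'
    \<Longrightarrow> ip (sp n p q i f) (sp n p' q' i' g) = 0"
proof (induction i arbitrary: i')
  case 0
  then obtain j where j: "i' = Suc j" by (cases i') auto
  have "ip (sp n p' q' (Suc j) g) f = 0"
    using 0 j by (intro ip_sp_0[OF n, where p' = p and q' = q]) auto
  moreover have "f \<in> Vec (n * (p + q))" using 0 TT_Vec[of n 0 "p + q"] by auto
  moreover have "sp n p' q' (Suc j) g \<in> TT n p q"
  proof -
    have "p' + Suc j = p" "q' + Suc j = q" using 0 j by auto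
    moreover have "sp n p' q' (Suc j) g \<in> TT n (p' + Suc j) (q' + Suc j)"
      using 0 by (intro sp_TT[OF n E_TT])
    ultimately show ?thesis by (simp only:)
  qed
  then have "sp n p' q' (Suc j) g \<in> Vec (n * (p + q))" using TT_Vec by blast
  ultimately show ?case using ip_cnj[of "sp n p' q' (Suc j) g" "n * (p + q)" f] j by simp
next
  case (Suc i)
  show ?case
  proof (cases i')
    case 0
    then show ?thesis using Suc.prems ip_sp_0[OF n, of f p q g p' q' i] by simp
  next
    case (Suc j)
    then show ?thesis using Suc.prems Suc.IH[of j] ip_sp_Suc[OF n, of f p q g p' q' i j]
      by (simp del: sp.simps)
  qed
qed

lemma ip_sp_eq:
  assumes n: "n \<ge> 1" and f: "f \<in> TT n 0 (p + q)" and g: "g \<in> TT n 0 (p + q)"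
  shows "ip (sp n p q i f) (sp n p q i g) = (\<Prod>r\<in>{1..i}. dc n (p + r) * bb n p q r) * ip f g"
proof (induction i)
  case (Suc i)
  then show ?case using ip_sp_Suc[OF n f g refl refl, of i] by (simp add: mult_ac del: sp.simps)
qed simp

text \<open>Factor by factor, \<open>dc n (p + r) * bb n p q r\<close> equals \<mu> (1 - x), and
  positivity of both parts makes the square roots genuine. The nonvanishing is kept separately for
  dividing by the coefficient in the surjectivity argument.\<close>

lemma Wcoef_sq:
  assumes n: "n \<ge> 1"
  shows "complex_of_real (Wcoef n (p + j) (q + j) j) * of_real (Wcoef n (p + j) (q + j) j)
     * (\<Prod>r\<in>{1..j}. dc n (p + r) * bb n p q r) = 1"
    and "Wcoef n (p + j) (q + j) j \<noteq> 0"
proof -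
  define D where "D i = real_of_int (dnat n i)" for i
  define x where "x r = D (Suc p) * D q / (D (Suc (p + r)) * D (q + r))" for r
  define \<mu> where "\<mu> r = D (Suc (p + r)) * D (p + r) / real (n + 1)" for r
  have Dpos: "i > 0 \<Longrightarrow> D i > 0" for i using dnat_pos[OF n] by (simp add: D_def)
  have W: "Wcoef n (p + j) (q + j) j = (\<Prod>r\<in>{1..j}. 1 / sqrt (\<mu> r) * (1 / sqrt (1 - x r)))"
    unfolding Wcoef_def
  proof (rule prod.cong[OF refl])
    fix r assume "r \<in> {1..j}"
    then have r: "r \<ge> 1" by simp
    have e: "int (p + j) - int j = int p" "int (q + j) - int j = int q" by simp_all
    have n1: "nat (int p + int r + 1) = Suc (p + r)" "nat (int p + int r - 1 + 1) = p + r"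
      "nat (int p + 1) = Suc p" "nat (int q - 1 + 1) = q" "nat (int q + int r - 1 + 1) = q + r"
      using r by auto
    have d1: "dnat n (nat (1 + 1)) = int (n + 1)" by (simp add: numeral_2_eq_2)
    show "1 / sqrt (mu n (int (p + j) - int j + int r)) *
        (1 / sqrt (1 - real_of_int (d n (int (p + j) - int j) * d n (int (q + j) - int j - 1)) /
           real_of_int (d n (int (p + j) - int j + int r) * d n (int (q + j) - int j + int r - 1))))
        = 1 / sqrt (\<mu> r) * (1 / sqrt (1 - x r))"
      unfolding mu_def d_def e n1 d1 \<mu>_def x_def D_def by simp
  qed
  have pos: "\<mu> r > 0" "1 - x r > 0" "\<mu> r * (1 - x r) = D (p + r) * (D (Suc (p + r)) * D (q + r) - D (Suc p) * D q) / (real (n + 1) * D (q + r))"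
    if "r \<in> {1..j}" for r
  proof -
    have r: "r \<ge> 1" using that by simp
    have p: "D (Suc (p + r)) > 0" "D (p + r) > 0" "D (q + r) > 0" using r by (auto intro!: Dpos)
    then show "\<mu> r > 0" by (simp add: \<mu>_def)
    \<comment> \<open>Only \<open>D q\<close> may be 0, namely for q = 0; strict growth in both
      factors still gives a strict inequality of the products.\<close>
    have "D (Suc p) < D (Suc (p + r))" "D q < D (q + r)" "0 \<le> D q" "0 < D (Suc p)"
      using r dnat_mono[OF n] dnat_incr[OF n, of q] dnat_pos[OF n, of "Suc p"] by (auto simp: D_def)
    then have "D (Suc p) * D q < D (Suc (p + r)) * D (q + r)" by (intro mult_strict_mono) auto
    then show "1 - x r > 0" using p by (simp add: x_def)
    show "\<mu> r * (1 - x r) = D (p + r) * (D (Suc (p + r)) * D (q + r) - D (Suc p) * D q) / (real (n + 1) * D (q + r))"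
    proof -
      have "A * B / N * (1 - y / (A * C)) = B * (A * C - y) / (N * C)"
        if "A > 0" "C > 0" "N > 0" for A B C N y :: real
      proof -
        have "1 - y / (A * C) = (A * C - y) / (A * C)" using that by (simp add: field_simps)
        then show ?thesis using that by (simp add: frac_eq_eq ac_simps)
      qed
      then show ?thesis using p unfolding \<mu>_def x_def by simp
    qed
  qed
  have b: "dc n (p + r) * bb n p q r = of_real (\<mu> r * (1 - x r))" if "r \<in> {1..j}" for r
    unfolding pos(3)[OF that] bb_def dc_def dd_def D_def by simp
  show "Wcoef n (p + j) (q + j) j \<noteq> 0" unfolding W using pos by force
  have "Wcoef n (p + j) (q + j) j * Wcoef n (p + j) (q + j) j * (\<Prod>r\<in>{1..j}. \<mu> r * (1 - x r)) = 1"
    unfolding W prod.distrib[symmetric]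
  proof (rule prod.neutral, rule ballI)
    fix r assume "r \<in> {1..j}"
    note p = pos[OF this]
    have "sqrt (\<mu> r) * sqrt (\<mu> r) = \<mu> r" "sqrt (1 - x r) * sqrt (1 - x r) = 1 - x r" "sqrt (\<mu> r) > 0" "sqrt (1 - x r) > 0"
      using p by auto
    moreover have "1 / s * (1 / t) * (1 / s * (1 / t)) * (M * X) = 1"
      if "s * s = M" "t * t = X" "s > 0" "t > 0" for s t M X :: real
      using that by (auto simp: field_simps)
    ultimately show "1 / sqrt (\<mu> r) * (1 / sqrt (1 - x r)) * (1 / sqrt (\<mu> r) * (1 / sqrt (1 - x r))) * (\<mu> r * (1 - x r)) = 1"
      by blast
  qed
  then have "complex_of_real (Wcoef n (p + j) (q + j) j * Wcoef n (p + j) (q + j) j * (\<Prod>r\<in>{1..j}. \<mu> r * (1 - x r))) = 1"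
    by (simp only: of_real_1)
  moreover have "(\<Prod>r\<in>{1..j}. dc n (p + r) * bb n p q r) = of_real (\<Prod>r\<in>{1..j}. \<mu> r * (1 - x r))"
    unfolding of_real_prod by (rule prod.cong) (use b in auto)
  ultimately show "complex_of_real (Wcoef n (p + j) (q + j) j) * of_real (Wcoef n (p + j) (q + j) j)
     * (\<Prod>r\<in>{1..j}. dc n (p + r) * bb n p q r) = 1"
    by (simp only: of_real_mult)
qed

lemma TT_decompose:
  assumes n: "n \<ge> 1"
  shows "f \<in> TT n k m \<Longrightarrow> \<exists>x. (\<forall>j\<le>min k m. x j \<in> TT n 0 (k + m - 2 * j))
     \<and> f = (\<lambda>w. \<Sum>j\<le>min k m. sp n (k - j) (m - j) j (x j) w)"
proof (induction k arbitrary: m f)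
  case 0
  then show ?case by (intro exI[of _ "\<lambda>_. f"]) simp
next
  case (Suc k)
  show ?case
  proof (cases m)
    case 0
    then show ?thesis using Suc.prems TT_0_right[of n "Suc k"] by (intro exI[of _ "\<lambda>_. f"]) simp
  next
    case (Suc m')
    define R where "R = sg n k m' ` TT n k m'"
    have RT: "R \<subseteq> TT n (Suc k) (Suc m')" unfolding R_def using sg_TT[OF n] by blast
    have "csub R" unfolding csub_def
    proof (intro conjI ballI allI)
      show "(\<lambda>w. 0) \<in> R" unfolding R_def
        using sg_scale[of n k m' 0] csub0[OF csub_TT] by (intro image_eqI[of _ _ "\<lambda>w. 0"]) auto
    next
      fix g h a b assume "g \<in> R" "h \<in> R"
      then obtain g' h' where "g = sg n k m' g'" "h = sg n k m' h'" "g' \<in> TT n k m'" "h' \<in> TT n k m'"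
        by (auto simp: R_def)
      then show "(\<lambda>w. a * g w + b * h w) \<in> R"
        unfolding R_def using csub_lin[OF csub_TT, of g' n k m' h' a b]
        by (intro image_eqI[where x = "\<lambda>w. a * g' w + b * h' w"]) (simp_all add: sg_lin)
    qed
    moreover have fT: "f \<in> TT n (Suc k) (Suc m')" using Suc.prems Suc by simp
    ultimately obtain g where g: "g \<in> R" "\<And>h. h \<in> R \<Longrightarrow> ip (\<lambda>w. f w - g w) h = 0"
      using orth_decomp[of R "n * (Suc k + Suc m')" f] RT TT_Vec[of n "Suc k" "Suc m'"] by blast
    define z where "z = (\<lambda>w. f w - g w)"
    have zT: "z \<in> TT n (Suc k) (Suc m')" unfolding z_def using csub_diff[OF csub_TT fT] g(1) RT by blast
    then have zV: "z \<in> Vec (n * (Suc k + Suc m'))" using TT_Vec by blast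
    \<comment> \<open>Testing the remainder \<open>z\<close> against \<sigma> applied to its own
      boundary contraction produces a nonzero multiple of the squared norm of that
      contraction.\<close>
    define c where "c = con n k z"
    have cT: "c \<in> TT n k m'" unfolding c_def by (rule TT_con[OF zT])
    have sV: "sg n k m' c \<in> Vec (n * (Suc k + Suc m'))"
      using sg_TT[OF n cT] TT_Vec[of n "Suc k" "Suc m'"] by blast
    have "ip z (sg n k m' c) = 0" using g(2)[of "sg n k m' c"] cT by (simp add: z_def R_def)
    then have "ip (sg n k m' c) z = 0" using ip_cnj[OF zV sV] by simp
    moreover have "dc n (Suc k) \<noteq> 0" by (rule dc_nz[OF n]) simp
    moreover have "eps n \<noteq> 0" by (simp add: eps_def)
    ultimately have "ip c c = 0" using ip_sg[OF cT zT] by (simp add: c_def)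
    moreover have "c \<in> Vec (n * (k + m'))" using cT TT_Vec by blast
    ultimately have "c = (\<lambda>w. 0)" by (intro ip_self_eq_0)
    then have zE: "z \<in> TT n 0 (Suc k + Suc m')" using zT unfolding c_def TT_def by auto
    obtain y where y: "y \<in> TT n k m'" "g = sg n k m' y" using g(1) by (auto simp: R_def)
    obtain x where x: "\<And>j. j \<le> min k m' \<Longrightarrow> x j \<in> TT n 0 (k + m' - 2 * j)"
      "y = (\<lambda>w. \<Sum>j\<le>min k m'. sp n (k - j) (m' - j) j (x j) w)"
      using Suc.IH[OF y(1)] by blast
    \<comment> \<open>The remainder becomes component 0. Applying \<sigma> to the decomposition of
      \<open>y\<close> raises every exponent by one, which shifts the other components.\<close>
    define x' where "x' j = (case j of 0 \<Rightarrow> z | Suc i \<Rightarrow> x i)" for j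
    have "g = (\<lambda>w. \<Sum>j\<le>min k m'. sg n k m' (sp n (k - j) (m' - j) j (x j)) w)"
      unfolding y(2) x(2) by (rule sg_sum) simp
    also have "\<dots> = (\<lambda>w. \<Sum>j\<le>min k m'. sp n (Suc k - Suc j) (Suc m' - Suc j) (Suc j) (x' (Suc j)) w)"
      by (intro ext sum.cong refl) (simp add: x'_def)
    finally have "f = (\<lambda>w. \<Sum>j\<le>Suc (min k m'). sp n (Suc k - j) (Suc m' - j) j (x' j) w)"
      unfolding sum.atMost_Suc_shift by (simp add: x'_def z_def fun_eq_iff del: sp.simps(2))
    moreover have "x' j \<in> TT n 0 (Suc k + Suc m' - 2 * j)" if "j \<le> Suc (min k m')" for j
      using x(1)[of "j - 1"] zE that by (cases j) (auto simp: x'_def)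
    ultimately show ?thesis unfolding Suc min_Suc_Suc by blast
  qed
qed

section \<open>Equivariance\<close>

text \<open>Matrix entry of a tensor power of U between two basis words.\<close>

definition kr :: "(nat \<Rightarrow> nat \<Rightarrow> complex) \<Rightarrow> nat list \<Rightarrow> nat list \<Rightarrow> complex" where
  "kr U w v = (\<Prod>i<length w. U (w ! i) (v ! i))"

lemma kr_Nil [simp]: "kr U [] v = 1"
  by (simp add: kr_def)

lemma kr_Cons [simp]: "kr U (a # w) (b # v) = U a b * kr U w v"
  by (simp add: kr_def prod.lessThan_Suc_shift del: prod.lessThan_Suc)

lemma kr_append: "length x = length x' \<Longrightarrow> kr U (x @ y) (x' @ y') = kr U x x' * kr U y y'"
  by (induction x x' rule: list_induct2) (simp_all add: mult.assoc)

lemma kr_transpose: "length w = length v \<Longrightarrow> kr (\<lambda>i j. U j i) v w = kr U w v"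
  by (simp add: kr_def)

lemma kr_permute:
  assumes "p permutes {..<length w}" "length v = length w"
  shows "kr U (permute_list p w) (permute_list p v) = kr U w v"
proof -
  have "kr U (permute_list p w) (permute_list p v) = (\<Prod>i<length w. U (w ! p i) (v ! p i))"
    using assms by (simp add: kr_def permute_list_nth)
  also have "\<dots> = (\<Prod>i<length w. U (w ! i) (v ! i))"
    by (rule prod.reindex_bij_betw[OF permutes_imp_bij[OF assms(1)], of "\<lambda>i. U (w ! i) (v ! i)"])
  finally show ?thesis by (simp add: kr_def)
qed

lemma act_eq: "w \<in> words N \<Longrightarrow> act U N f w = (\<Sum>v\<in>words N. kr U w v * f v)"
  by (simp add: act_def kr_def words_def)

lemma act_Vec: "act U N f \<in> Vec N"
  by (simp add: act_def Vec_def)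

lemma act_sum: "act U N (\<lambda>w. \<Sum>j\<in>J. c j * F j w) = (\<lambda>w. \<Sum>j\<in>J. c j * act U N (F j) w)"
proof
  fix w
  show "act U N (\<lambda>w. \<Sum>j\<in>J. c j * F j w) w = (\<Sum>j\<in>J. c j * act U N (F j) w)"
  proof (cases "w \<in> words N")
    case True
    have "act U N (\<lambda>w. \<Sum>j\<in>J. c j * F j w) w = (\<Sum>v\<in>words N. \<Sum>j\<in>J. c j * (kr U w v * F j v))"
      unfolding act_eq[OF True] sum_distrib_left by (simp only: mult.left_commute)
    also have "\<dots> = (\<Sum>j\<in>J. \<Sum>v\<in>words N. c j * (kr U w v * F j v))" by (rule sum.swap)
    finally show ?thesis unfolding act_eq[OF True] sum_distrib_left .
  qed (simp add: act_def)
qed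

lemma act_lin: "act U N (\<lambda>w. a * f w + b * g w) = (\<lambda>w. a * act U N f w + b * act U N g w)"
proof
  fix w show "act U N (\<lambda>w. a * f w + b * g w) w = a * act U N f w + b * act U N g w"
    by (simp add: act_def ring_distribs sum.distrib sum_distrib_left mult.left_commute)
qed

lemma act_diff: "act U N (\<lambda>w. f w - b * g w) = (\<lambda>w. act U N f w - b * act U N g w)"
  using act_lin[of U N 1 f "- b" g] by simp

lemma act_0: "act U N (\<lambda>w. 0) = (\<lambda>w. 0)"
  by (auto simp: act_def)

lemma act_app2:
  assumes "x \<in> words a" "y \<in> words b"
  shows "act U (a + b) f (x @ y) = (\<Sum>x'\<in>words a. \<Sum>y'\<in>words b. kr U x x' * kr U y y' * f (x' @ y'))"
proof -
  have "x @ y \<in> words (a + b)" using assms by (simp add: words_append wordsD)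
  then show ?thesis unfolding act_eq sum_words_append
    using assms(1) by (simp add: act_eq sum_words_append kr_append wordsD cong: sum.cong)
qed

lemma act_app3:
  assumes "x \<in> words a" "u \<in> words b" "y \<in> words c"
  shows "act U (a + (b + c)) f (x @ u @ y) =
    (\<Sum>x'\<in>words a. \<Sum>u'\<in>words b. \<Sum>y'\<in>words c. kr U x x' * kr U u u' * kr U y y' * f (x' @ u' @ y'))"
proof -
  have uy: "u @ y \<in> words (b + c)" using assms by (simp add: words_append wordsD)
  show ?thesis unfolding act_app2[OF assms(1) uy] sum_words_append
  proof (intro sum.cong refl)
    fix x' u' y' assume "u' \<in> words b"
    then have "kr U (u @ y) (u' @ y') = kr U u u' * kr U y y'" using assms by (simp add: kr_append wordsD)
    then show "kr U x x' * kr U (u @ y) (u' @ y') * f (x' @ u' @ y')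
      = kr U x x' * kr U u u' * kr U y y' * f (x' @ u' @ y')" by (simp add: mult.assoc)
  qed
qed

text \<open>The tensor power of U commutes with permutations of the legs, so a permutation of
  \<open>w\<close> can be transferred to the summation variable, where \<phi> does not see
  it.\<close>

lemma kr_sum_sym:
  assumes w: "w \<in> words n" "w' \<in> words n" "zc w = zc w'"
    and \<phi>: "\<And>v v'. v \<in> words n \<Longrightarrow> v' \<in> words n \<Longrightarrow> zc v = zc v' \<Longrightarrow> \<phi> v = \<phi> v'"
  shows "(\<Sum>v\<in>words n. kr U w v * \<phi> v) = (\<Sum>v\<in>words n. kr U w' v * \<phi> v)"
proof -
  obtain p where p: "p permutes {..<n}" "permute_list p w' = w" using zc_eq_permute[OF w] .
  have pw: "permute_list p v \<in> words n" if "v \<in> words n" for v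
    using that p by (simp add: words_def)
  have "(\<Sum>v\<in>words n. kr U w' v * \<phi> v) = (\<Sum>v\<in>words n. kr U w (permute_list p v) * \<phi> (permute_list p v))"
  proof (intro sum.cong refl)
    fix v assume v: "v \<in> words n"
    have "kr U w (permute_list p v) = kr U w' v"
      unfolding p(2)[symmetric] using p(1) v w by (intro kr_permute) (auto simp: words_def)
    moreover have "\<phi> (permute_list p v) = \<phi> v"
      using p(1) v by (intro \<phi> pw zc_permute_list) (auto simp: words_def)
    ultimately show "kr U w' v * \<phi> v = kr U w (permute_list p v) * \<phi> (permute_list p v)" by simp
  qed
  also have "\<dots> = (\<Sum>v\<in>words n. kr U w v * \<phi> v)"
  proof (rule sum.reindex_bij_witness[where i = "permute_list (inv p)" and j = "permute_list p"])
    fix v assume v: "v \<in> words n"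
    show "permute_list p v \<in> words n" using pw[OF v] .
    have q: "inv p permutes {..<n}" using p(1) by (rule permutes_inv)
    show "permute_list (inv p) v \<in> words n" using v q by (simp add: words_def)
    have "permute_list (inv p) (permute_list p v) = permute_list (p \<circ> inv p) v"
      using q v by (intro permute_list_compose[symmetric]) (simp add: words_def)
    then show "permute_list (inv p) (permute_list p v) = v" using permutes_inv_o(1)[OF p(1)] by simp
    have "permute_list p (permute_list (inv p) v) = permute_list (inv p \<circ> p) v"
      using p(1) v by (intro permute_list_compose[symmetric]) (simp add: words_def)
    then show "permute_list p (permute_list (inv p) v) = v" using permutes_inv_o(2)[OF p(1)] by simp
  qed simp
  finally show ?thesis by simp
qed

lemma slot_lengths:
  fixes n i m :: nat
  assumes "i \<le> m"
  shows "n * (m + 2) = n * i + (2 * n + n * (m - i))" "n * m = n * i + n * (m - i)"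
proof -
  show e: "n * m = n * i + n * (m - i)" using assms by (simp flip: distrib_left)
  show "n * (m + 2) = n * i + (2 * n + n * (m - i))" unfolding distrib_left[of n m 2] e by simp
qed

lemma act_slots:
  assumes f: "f \<in> slots n m"
  shows "act U (n * m) f \<in> slots n m"
proof -
  have "symat n (n * j) (act U (n * m) f)" if j: "j < m" for j
  proof (rule symatI)
    fix x y w w' :: "nat list"
    assume x: "length x = n * j" and w: "w \<in> words n" "w' \<in> words n" "zc w = zc w'"
    have sf: "symat n (n * j) f" using f j by (simp add: slots_def)
    have "n * m = n * (j + (1 + (m - Suc j)))" using j by simp
    then have l: "n * m = n * j + (n + n * (m - Suc j))" by (simp only: distrib_left mult_1_right)
    show "act U (n * m) f (x @ w @ y) = act U (n * m) f (x @ w' @ y)"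
    proof (cases "x \<in> words (n * j) \<and> y \<in> words (n * (m - Suc j))")
      case True
      have e: "act U (n * m) f (x @ v @ y) = (\<Sum>x'\<in>words (n * j). \<Sum>y'\<in>words (n * (m - Suc j)).
          kr U x x' * kr U y y' * (\<Sum>v'\<in>words n. kr U v v' * f (x' @ v' @ y')))" if "v \<in> words n" for v
      proof -
        have "act U (n * m) f (x @ v @ y) = (\<Sum>x'\<in>words (n * j). \<Sum>v'\<in>words n. \<Sum>y'\<in>words (n * (m - Suc j)).
           kr U x x' * kr U v v' * kr U y y' * f (x' @ v' @ y'))"
          unfolding l using True that by (intro act_app3) auto
        also have "\<dots> = (\<Sum>x'\<in>words (n * j). \<Sum>y'\<in>words (n * (m - Suc j)). \<Sum>v'\<in>words n.
           kr U x x' * kr U v v' * kr U y y' * f (x' @ v' @ y'))"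
          by (intro sum.cong refl sum.swap)
        finally show ?thesis unfolding sum_distrib_left by (simp only: mult_ac)
      qed
      show ?thesis unfolding e[OF w(1)] e[OF w(2)]
      proof (rule sum.cong[OF refl], rule sum.cong[OF refl])
        fix x' y' assume x': "x' \<in> words (n * j)"
        have "(\<Sum>v'\<in>words n. kr U w v' * f (x' @ v' @ y')) = (\<Sum>v'\<in>words n. kr U w' v' * f (x' @ v' @ y'))"
          using w by (rule kr_sum_sym) (rule symatD[OF sf wordsD[OF x']])
        then show "kr U x x' * kr U y y' * (\<Sum>v'\<in>words n. kr U w v' * f (x' @ v' @ y'))
          = kr U x x' * kr U y y' * (\<Sum>v'\<in>words n. kr U w' v' * f (x' @ v' @ y'))" by (rule arg_cong)
      qed
    next
      case False
      then have "x @ v @ y \<notin> words (n * m)" if "v \<in> words n" for v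
        unfolding l using words_append[OF x, of "v @ y" "n + n * (m - Suc j)"]
          words_append[OF wordsD[OF that], of y "n * (m - Suc j)"] by blast
      then show ?thesis using w by (simp add: act_def)
    qed
  qed
  then show ?thesis using act_Vec by (simp add: slots_def)
qed

section \<open>Invariance of \<delta> by generating functions\<close>

definition Pr :: "(nat \<Rightarrow> complex) \<Rightarrow> nat list \<Rightarrow> complex" where
  "Pr x w = prod_list (map x w)"

lemma Pr_word: "w \<in> words n \<Longrightarrow> Pr x w = x 0 ^ zc w * x 1 ^ (n - zc w)"
proof (induction n arbitrary: w)
  case (Suc n)
  then obtain c v where w: "w = c # v" "c = 0 \<or> c = 1" "v \<in> words n" by (auto simp: words_Suc)
  then show ?case using Suc.IH[OF w(3)] zc_le[OF w(3)] by (auto simp: Pr_def Suc_diff_le)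
qed (simp add: Pr_def)

text \<open>\<open>Pr x\<close> lists the coordinates of the n-th tensor power of x. Since it is
  summed against the row index of U, the result is the power of the transpose of U applied to
  x.\<close>

lemma Pr_kr_sum:
  "v \<in> words n \<Longrightarrow> (\<Sum>w\<in>words n. Pr x w * kr U w v) = Pr (\<lambda>b. x 0 * U 0 b + x 1 * U 1 b) v"
proof (induction n arbitrary: v)
  case (Suc n)
  then obtain b v' where v: "v = b # v'" "v' \<in> words n" by (auto simp: words_Suc)
  have "(\<Sum>w\<in>words (Suc n). Pr x w * kr U w v)
      = (\<Sum>w\<in>Cons 0 ` words n. Pr x w * kr U w v) + (\<Sum>w\<in>Cons 1 ` words n. Pr x w * kr U w v)"
    unfolding words_Suc by (rule sum.union_disjoint) auto
  also have "\<dots> = (x 0 * U 0 b + x 1 * U 1 b) * (\<Sum>w\<in>words n. Pr x w * kr U w v')"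
    unfolding v by (simp add: sum.reindex Pr_def ring_distribs sum_distrib_left mult_ac)
  finally show ?case unfolding Suc.IH[OF v(2)] v(1) by (simp add: Pr_def)
qed (simp add: Pr_def)

text \<open>Counting words produces one binomial coefficient for each leg; the denominator in
  \<open>dform\<close> cancels one of them, and the other is what the binomial theorem
  requires.\<close>

lemma delta_generating:
  "(\<Sum>u\<in>words n. \<Sum>v\<in>words n. Pr x u * Pr y v * delta n (u @ v))
     = (x 1 * y 0 - x 0 * y 1) ^ n / of_real (sqrt (n + 1))"
proof -
  let ?s = "complex_of_real (sqrt (n + 1))"
  have "(\<Sum>u\<in>words n. \<Sum>v\<in>words n. Pr x u * Pr y v * delta n (u @ v))
      = (\<Sum>u\<in>words n. \<Sum>v\<in>words n. x 0 ^ zc u * x 1 ^ (n - zc u) * (y 0 ^ zc v * y 1 ^ (n - zc v) * dform n (zc u) (zc v)))"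
    by (intro sum.cong refl) (simp add: Pr_word delta_app)
  also have "\<dots> = (\<Sum>u\<in>words n. x 0 ^ zc u * x 1 ^ (n - zc u)
      * (\<Sum>b\<le>n. of_nat (n choose b) * (y 0 ^ b * y 1 ^ (n - b) * dform n (zc u) b)))"
    unfolding sum_distrib_left[symmetric]
    by (intro sum.cong refl arg_cong2[where f = "(*)"] sum_words_zc)
  also have "\<dots> = (\<Sum>a\<le>n. of_nat (n choose a) * (x 0 ^ a * x 1 ^ (n - a)
      * (\<Sum>b\<le>n. of_nat (n choose b) * (y 0 ^ b * y 1 ^ (n - b) * dform n a b))))"
    by (rule sum_words_zc)
  also have "\<dots> = (\<Sum>a\<le>n. of_nat (n choose a) * (- x 0 * y 1) ^ a * (x 1 * y 0) ^ (n - a) / ?s)"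
  proof (intro sum.cong refl)
    fix a assume "a \<in> {..n}"
    then have a: "a \<le> n" by simp
    have "(\<Sum>b\<le>n. of_nat (n choose b) * (y 0 ^ b * y 1 ^ (n - b) * dform n a b))
        = (\<Sum>b\<le>n. if b = n - a then of_nat (n choose b) * (y 0 ^ b * y 1 ^ (n - b) * dform n a b) else 0)"
      using a by (intro sum.cong refl) (auto simp: dform_def)
    also have "\<dots> = of_nat (n choose (n - a)) * (y 0 ^ (n - a) * y 1 ^ a * dform n a (n - a))"
      using a by simp
    also have "\<dots> = y 0 ^ (n - a) * y 1 ^ a * (-1) ^ a / ?s"
    proof -
      have "n choose (n - a) = n choose a" using a by (simp add: binomial_symmetric[symmetric])
      then show ?thesis using a by (simp add: dform_def)
    qed
    finally have e: "(\<Sum>b\<le>n. of_nat (n choose b) * (y 0 ^ b * y 1 ^ (n - b) * dform n a b))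
      = y 0 ^ (n - a) * y 1 ^ a * (-1) ^ a / ?s" .
    have m: "(- x 0 * y 1) ^ a = (-1) ^ a * x 0 ^ a * y 1 ^ a"
      by (simp flip: power_mult_distrib)
    show "of_nat (n choose a) * (x 0 ^ a * x 1 ^ (n - a)
      * (\<Sum>b\<le>n. of_nat (n choose b) * (y 0 ^ b * y 1 ^ (n - b) * dform n a b)))
      = of_nat (n choose a) * (- x 0 * y 1) ^ a * (x 1 * y 0) ^ (n - a) / ?s"
      unfolding e m by (simp add: power_mult_distrib mult_ac)
  qed
  also have "\<dots> = (- x 0 * y 1 + x 1 * y 0) ^ n / ?s"
    unfolding sum_divide_distrib[symmetric] binomial_ring ..
  finally show ?thesis by (simp add: add.commute)
qed

text \<open>The tensor powers of the vectors (s, 1) separate symmetric tensors: the pairing is a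
  polynomial in s whose coefficients are the values of \<open>H\<close> weighted by binomials, and
  it vanishes identically.\<close>

lemma sym_zero:
  assumes H: "\<And>u u'. u \<in> words n \<Longrightarrow> u' \<in> words n \<Longrightarrow> zc u = zc u' \<Longrightarrow> H u = H u'"
    and 0: "\<And>s. (\<Sum>u\<in>words n. s ^ zc u * H u) = (0::complex)"
    and w: "w \<in> words n"
  shows "H w = 0"
proof -
  define h where "h k = H (SOME u. u \<in> words n \<and> zc u = k)" for k
  have h: "H u = h (zc u)" if "u \<in> words n" for u
  proof -
    have "(SOME v. v \<in> words n \<and> zc v = zc u) \<in> words n \<and> zc (SOME v. v \<in> words n \<and> zc v = zc u) = zc u"
      by (rule someI[of _ u]) (use that in simp)
    then show ?thesis unfolding h_def using that by (intro H) auto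
  qed
  have "(\<Sum>k\<le>n. (of_nat (n choose k) * h k) * s ^ k) = 0" for s
  proof -
    have "(\<Sum>k\<le>n. (of_nat (n choose k) * h k) * s ^ k) = (\<Sum>k\<le>n. of_nat (n choose k) * (s ^ k * h k))"
      by (simp add: mult_ac)
    also have "\<dots> = (\<Sum>u\<in>words n. s ^ zc u * h (zc u))" by (rule sum_words_zc[symmetric])
    also have "\<dots> = (\<Sum>u\<in>words n. s ^ zc u * H u)"
      by (intro sum.cong refl arg_cong2[where f = "(*)"] h[symmetric])
    finally show ?thesis using 0 by simp
  qed
  then have "\<forall>k\<le>n. of_nat (n choose k) * h k = 0"
    by (intro polyfun_eq_0[THEN iffD1] allI)
  then have "h (zc w) = 0" using zc_le[OF w] by auto
  then show ?thesis using h[OF w] by simp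
qed

text \<open>The difference \<open>H\<close> is symmetric in each of its two blocks, so
  \<open>sym_zero\<close> applies once per block. The hypothesis is phrased through the determinant
  so that the result can also be applied to the transpose of U.\<close>

lemma delta_invariant:
  assumes U: "U 0 0 * U 1 1 - U 0 1 * U 1 0 = 1"
  shows "act U (2 * n) (delta n) = delta n"
proof (rule Vec_eqI[OF act_Vec delta_Vec])
  let ?d = "act U (2 * n) (delta n)"
  define H where "H w = ?d w - delta n w" for w
  have ds: "?d \<in> slots n 2" using act_slots[OF delta_slots] by (simp add: mult.commute)
  have "H \<in> slots n 2" unfolding H_def by (rule csub_diff[OF csub_slots ds delta_slots])
  then have sH: "symat n 0 H" "symat n n H" by (auto simp: slots_def dest: spec[of _ 0] spec[of _ 1])
  have app: "?d (u @ v) = (\<Sum>u'\<in>words n. \<Sum>v'\<in>words n. kr U u u' * kr U v v' * delta n (u' @ v'))"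
    if "u \<in> words n" "v \<in> words n" for u v
    unfolding mult_2 by (rule act_app2[OF that])
  have gen: "(\<Sum>u\<in>words n. \<Sum>v\<in>words n. Pr x u * Pr y v * ?d (u @ v))
      = (\<Sum>u\<in>words n. \<Sum>v\<in>words n. Pr x u * Pr y v * delta n (u @ v))" for x y
  proof -
    let ?x = "\<lambda>b. x 0 * U 0 b + x 1 * U 1 b" and ?y = "\<lambda>b. y 0 * U 0 b + y 1 * U 1 b"
    have "(\<Sum>u\<in>words n. \<Sum>v\<in>words n. Pr x u * Pr y v * ?d (u @ v))
       = (\<Sum>u\<in>words n. \<Sum>v\<in>words n. \<Sum>u'\<in>words n. \<Sum>v'\<in>words n.
            (Pr x u * kr U u u') * ((Pr y v * kr U v v') * delta n (u' @ v')))"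
    proof (intro sum.cong refl)
      fix u v assume "u \<in> words n" "v \<in> words n"
      from app[OF this] show "Pr x u * Pr y v * ?d (u @ v) = (\<Sum>u'\<in>words n. \<Sum>v'\<in>words n.
            (Pr x u * kr U u u') * ((Pr y v * kr U v v') * delta n (u' @ v')))"
        by (simp only: sum_distrib_left mult_ac)
    qed
    also have "\<dots> = (\<Sum>u\<in>words n. \<Sum>u'\<in>words n. \<Sum>v\<in>words n. \<Sum>v'\<in>words n.
            (Pr x u * kr U u u') * ((Pr y v * kr U v v') * delta n (u' @ v')))"
      by (intro sum.cong refl sum.swap)
    also have "\<dots> = (\<Sum>u'\<in>words n. \<Sum>u\<in>words n. \<Sum>v\<in>words n. \<Sum>v'\<in>words n.
            (Pr x u * kr U u u') * ((Pr y v * kr U v v') * delta n (u' @ v')))"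
      by (rule sum.swap)
    also have "\<dots> = (\<Sum>u'\<in>words n. \<Sum>u\<in>words n. \<Sum>v'\<in>words n. \<Sum>v\<in>words n.
            (Pr x u * kr U u u') * ((Pr y v * kr U v v') * delta n (u' @ v')))"
      by (intro sum.cong refl sum.swap)
    also have "\<dots> = (\<Sum>u'\<in>words n. \<Sum>v'\<in>words n. \<Sum>u\<in>words n. \<Sum>v\<in>words n.
            (Pr x u * kr U u u') * ((Pr y v * kr U v v') * delta n (u' @ v')))"
      by (intro sum.cong refl sum.swap)
    also have "\<dots> = (\<Sum>u'\<in>words n. \<Sum>v'\<in>words n. Pr ?x u' * Pr ?y v' * delta n (u' @ v'))"
    proof (intro sum.cong refl)
      fix u' v' assume w: "u' \<in> words n" "v' \<in> words n"
      show "(\<Sum>u\<in>words n. \<Sum>v\<in>words n. (Pr x u * kr U u u') * ((Pr y v * kr U v v') * delta n (u' @ v')))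
          = Pr ?x u' * Pr ?y v' * delta n (u' @ v')"
        unfolding sum_distrib_left[symmetric] sum_distrib_right[symmetric] Pr_kr_sum[OF w(1)] Pr_kr_sum[OF w(2)]
        by simp
    qed
    also have "\<dots> = (?x 1 * ?y 0 - ?x 0 * ?y 1) ^ n / of_real (sqrt (n + 1))"
      by (rule delta_generating)
    \<comment> \<open>Multiplicativity of the determinant for the transformed pair of
      vectors.\<close>
    also have "?x 1 * ?y 0 - ?x 0 * ?y 1 = (U 0 0 * U 1 1 - U 0 1 * U 1 0) * (x 1 * y 0 - x 0 * y 1)"
      by (simp add: algebra_simps)
    finally show ?thesis unfolding U delta_generating by simp
  qed
  define \<xi> where "\<xi> s = (\<lambda>a::nat. if a = 0 then s else (1::complex))" for s
  have P: "Pr (\<xi> s) w = s ^ zc w" if "w \<in> words n" for s w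
    using Pr_word[OF that, of "\<xi> s"] by (simp add: \<xi>_def)
  have z: "(\<Sum>u\<in>words n. s ^ zc u * (\<Sum>v\<in>words n. t ^ zc v * H (u @ v))) = 0" for s t
  proof -
    have "(\<Sum>u\<in>words n. s ^ zc u * (\<Sum>v\<in>words n. t ^ zc v * H (u @ v)))
        = (\<Sum>u\<in>words n. \<Sum>v\<in>words n. Pr (\<xi> s) u * Pr (\<xi> t) v * ?d (u @ v))
        - (\<Sum>u\<in>words n. \<Sum>v\<in>words n. Pr (\<xi> s) u * Pr (\<xi> t) v * delta n (u @ v))"
      unfolding sum_subtractf[symmetric] sum_distrib_left
      by (intro sum.cong refl) (simp add: P H_def algebra_simps)
    then show ?thesis unfolding gen by simp
  qed
  fix w assume "w \<in> words (2 * n)"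
  then obtain u v where w: "w = u @ v" "u \<in> words n" "v \<in> words n"
    unfolding mult_2 by (rule split_word_at)
  have "(\<Sum>v\<in>words n. t ^ zc v * H (u @ v)) = 0" for t
  proof (rule sym_zero[OF _ z w(2)])
    fix u u' assume u: "u \<in> words n" "u' \<in> words n" "zc u = zc u'"
    have "H ([] @ u @ v) = H ([] @ u' @ v)" for v
      by (rule symatD[OF sH(1) _ u]) simp
    then show "(\<Sum>v\<in>words n. t ^ zc v * H (u @ v)) = (\<Sum>v\<in>words n. t ^ zc v * H (u' @ v))"
      by (intro sum.cong refl) simp
  qed
  then have "H (u @ v) = 0"
  proof (rule sym_zero[OF _ _ w(3), rotated])
    fix v v' assume v: "v \<in> words n" "v' \<in> words n" "zc v = zc v'"
    show "H (u @ v) = H (u @ v')"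
      using symatD[OF sH(2) wordsD[OF w(2)] v, of "[]"] by simp
  qed
  then show "?d w = delta n w" by (simp add: H_def w(1))
qed

section \<open>Compatibility of the group action with insertions, contractions and \<sigma>\<close>

context
  fixes U :: "nat \<Rightarrow> nat \<Rightarrow> complex"
  assumes U: "U 0 0 * U 1 1 - U 0 1 * U 1 0 = 1"
begin

lemma kr_delta: "u \<in> words (2 * n) \<Longrightarrow> (\<Sum>v\<in>words (2 * n). kr U u v * delta n v) = delta n u"
  using fun_cong[OF delta_invariant[OF U, of n], of u] by (simp add: act_eq)

text \<open>A contraction sums \<delta> against the row index of U, so it calls for invariance under
  the transpose, which has the same determinant.\<close>

lemma delta_kr:
  assumes "v \<in> words (2 * n)"
  shows "(\<Sum>u\<in>words (2 * n). delta n u * kr U u v) = delta n v"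
proof -
  have "act (\<lambda>i j. U j i) (2 * n) (delta n) v = delta n v"
    using U by (subst delta_invariant) (simp_all add: mult.commute)
  moreover have "act (\<lambda>i j. U j i) (2 * n) (delta n) v = (\<Sum>u\<in>words (2 * n). delta n u * kr U u v)"
    unfolding act_eq[OF assms]
  proof (intro sum.cong refl)
    fix u assume "u \<in> words (2 * n)"
    then have "length u = length v" using assms by (simp add: wordsD)
    from kr_transpose[OF this, of U]
    show "kr (\<lambda>i j. U j i) v u * delta n u = delta n u * kr U u v" by (simp only: mult.commute)
  qed
  ultimately show ?thesis by simp
qed

lemma act_ins:
  assumes f: "f \<in> Vec (n * m)" and i: "i \<le> m"
  shows "act U (n * (m + 2)) (ins n i f) = ins n i (act U (n * m) f)"
proof (rule Vec_eqI[OF act_Vec ins_Vec[OF act_Vec i]])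
  note l = slot_lengths[OF i, of n]
  fix w assume "w \<in> words (n * (m + 2))"
  then obtain x z where xz: "w = x @ z" "x \<in> words (n * i)" "z \<in> words (2 * n + n * (m - i))"
    unfolding l by (rule split_word_at)
  obtain u y where uy: "z = u @ y" "u \<in> words (2 * n)" "y \<in> words (n * (m - i))"
    using xz(3) by (rule split_word_at)
  have "act U (n * (m + 2)) (ins n i f) w = (\<Sum>x'\<in>words (n * i). \<Sum>u'\<in>words (2 * n). \<Sum>y'\<in>words (n * (m - i)).
      kr U x x' * kr U u u' * kr U y y' * ins n i f (x' @ u' @ y'))"
    unfolding xz(1) uy(1) l by (rule act_app3[OF xz(2) uy(2,3)])
  also have "\<dots> = (\<Sum>x'\<in>words (n * i). \<Sum>u'\<in>words (2 * n). \<Sum>y'\<in>words (n * (m - i)).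
      (kr U u u' * delta n u') * (kr U x x' * kr U y y' * f (x' @ y')))"
    by (intro sum.cong refl) (simp add: ins_app wordsD[of _ "n * i"] wordsD[of _ "2 * n"])
  also have "\<dots> = (\<Sum>x'\<in>words (n * i). delta n u * (\<Sum>y'\<in>words (n * (m - i)). kr U x x' * kr U y y' * f (x' @ y')))"
    unfolding sum_distrib_left[symmetric] sum_distrib_right[symmetric] kr_delta[OF uy(2)] ..
  also have "\<dots> = act U (n * m) f (x @ y) * delta n u"
    unfolding l(2) act_app2[OF xz(2) uy(3)] sum_distrib_left[symmetric] by (rule mult.commute)
  also have "\<dots> = ins n i (act U (n * m) f) w"
    unfolding xz(1) uy(1) by (rule ins_app[symmetric, OF wordsD[OF xz(2)] wordsD[OF uy(2)]])
  finally show "act U (n * (m + 2)) (ins n i f) w = ins n i (act U (n * m) f) w" .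
qed

lemma con_act:
  assumes i: "i \<le> m"
  shows "con n i (act U (n * (m + 2)) f) = act U (n * m) (con n i f)"
proof (rule Vec_eqI[OF con_Vec[OF act_Vec i] act_Vec])
  note l = slot_lengths[OF i, of n]
  fix w assume "w \<in> words (n * m)"
  then obtain x y where w: "w = x @ y" "x \<in> words (n * i)" "y \<in> words (n * (m - i))"
    unfolding l by (rule split_word_at)
  have "con n i (act U (n * (m + 2)) f) w = (\<Sum>u\<in>words (2 * n). delta n u * act U (n * (m + 2)) f (x @ u @ y))"
    unfolding w(1) by (rule con_app[OF wordsD[OF w(2)]])
  also have "\<dots> = (\<Sum>u\<in>words (2 * n). \<Sum>x'\<in>words (n * i). \<Sum>u'\<in>words (2 * n). \<Sum>y'\<in>words (n * (m - i)).
      (delta n u * kr U u u') * (kr U x x' * kr U y y' * f (x' @ u' @ y')))"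
  proof (intro sum.cong refl)
    fix u assume "u \<in> words (2 * n)"
    from act_app3[OF w(2) this w(3), of U f]
    show "delta n u * act U (n * (m + 2)) f (x @ u @ y) = (\<Sum>x'\<in>words (n * i). \<Sum>u'\<in>words (2 * n). \<Sum>y'\<in>words (n * (m - i)).
      (delta n u * kr U u u') * (kr U x x' * kr U y y' * f (x' @ u' @ y')))"
      unfolding l by (simp add: sum_distrib_left mult_ac)
  qed
  also have "\<dots> = (\<Sum>x'\<in>words (n * i). \<Sum>u\<in>words (2 * n). \<Sum>u'\<in>words (2 * n). \<Sum>y'\<in>words (n * (m - i)).
      (delta n u * kr U u u') * (kr U x x' * kr U y y' * f (x' @ u' @ y')))"
    by (rule sum.swap)
  also have "\<dots> = (\<Sum>x'\<in>words (n * i). \<Sum>u'\<in>words (2 * n). \<Sum>u\<in>words (2 * n). \<Sum>y'\<in>words (n * (m - i)).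
      (delta n u * kr U u u') * (kr U x x' * kr U y y' * f (x' @ u' @ y')))"
    by (intro sum.cong refl sum.swap)
  also have "\<dots> = (\<Sum>x'\<in>words (n * i). \<Sum>u'\<in>words (2 * n). \<Sum>y'\<in>words (n * (m - i)).
      delta n u' * (kr U x x' * kr U y y' * f (x' @ u' @ y')))"
    unfolding sum_distrib_left[symmetric] sum_distrib_right[symmetric]
    by (intro sum.cong refl) (simp add: delta_kr)
  also have "\<dots> = (\<Sum>x'\<in>words (n * i). \<Sum>y'\<in>words (n * (m - i)). \<Sum>u'\<in>words (2 * n).
      delta n u' * (kr U x x' * kr U y y' * f (x' @ u' @ y')))"
    by (intro sum.cong refl sum.swap)
  also have "\<dots> = (\<Sum>x'\<in>words (n * i). \<Sum>y'\<in>words (n * (m - i)). kr U x x' * kr U y y' * con n i f (x' @ y'))"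
  proof (intro sum.cong refl)
    fix x' y' assume "x' \<in> words (n * i)"
    from con_app[OF wordsD[OF this], of f y']
    show "(\<Sum>u'\<in>words (2 * n). delta n u' * (kr U x x' * kr U y y' * f (x' @ u' @ y')))
        = kr U x x' * kr U y y' * con n i f (x' @ y')"
      by (simp add: sum_distrib_left mult_ac)
  qed
  also have "\<dots> = act U (n * m) (con n i f) w"
    unfolding w(1) l(2) by (rule act_app2[OF w(2,3), symmetric])
  finally show "con n i (act U (n * (m + 2)) f) w = act U (n * m) (con n i f) w" .
qed

lemma act_TT:
  assumes "f \<in> TT n k m"
  shows "act U (n * (k + m)) f \<in> TT n k m"
proof -
  have "con n i (act U (n * (k + m)) f) = (\<lambda>w. 0)" if i: "i + 1 < k + m" "i + 1 \<noteq> k" for i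
  proof -
    have e: "k + m - 2 + 2 = k + m" using i by simp
    have "con n i (act U (n * (k + m - 2 + 2)) f) = act U (n * (k + m - 2)) (con n i f)"
      by (rule con_act) (use i in simp)
    then show ?thesis unfolding e TTD[OF assms i] act_0 .
  qed
  then show ?thesis using act_slots[OF TT_slotsD[OF assms]] by (simp add: TT_def)
qed

lemma act_lin_ins:
  assumes "f \<in> Vec (n * M)"
  shows "act U (n * (M + 2)) (lin n M a f) = lin n M a (act U (n * M) f)"
  unfolding lin_def act_sum
  by (intro ext sum.cong refl arg_cong2[where f = "(*)"] fun_cong[OF act_ins[OF assms]]) simp

text \<open>The closed form is built from insertions and contractions alone, so equivariance is
  checked on these instead of on the orthogonal projection in \<open>sigma\<close>.\<close>

lemma act_sg:
  assumes f: "f \<in> TT n k m"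
  shows "act U (n * (k + m + 2)) (sg n k m f) = sg n k m (act U (n * (k + m)) f)"
proof -
  have fV: "f \<in> Vec (n * (k + m))" using f TT_Vec by blast
  have g: "act U (n * (k + m + 2)) (gg n k m f) = gg n k m (act U (n * (k + m)) f)"
    unfolding gg_def by (rule act_lin_ins[OF fV])
  show ?thesis
  proof (cases m)
    case 0
    then show ?thesis using g by (simp add: sg_no_right)
  next
    case (Suc m')
    have gV: "gg n k m f \<in> Vec (n * (k + m + 2))"
      using gg_slots[OF TT_slotsD[OF f]] slots_Vec by blast
    have k: "Suc k \<le> k + m" using Suc by simp
    have c: "con n (Suc k) (gg n k m (act U (n * (k + m)) f)) = act U (n * (k + m)) (con n (Suc k) (gg n k m f))"
      unfolding g[symmetric] by (rule con_act[OF k])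
    show ?thesis
      unfolding sg_def act_diff g c act_lin_ins[OF con_Vec[OF gV k]] ..
  qed
qed

lemma act_sp:
  assumes n: "n \<ge> 1" and f: "f \<in> TT n p q"
  shows "act U (n * (p + i + (q + i))) (sp n p q i f) = sp n p q i (act U (n * (p + q)) f)"
proof (induction i)
  case (Suc i)
  have e: "p + Suc i + (q + Suc i) = p + i + (q + i) + 2" by simp
  show ?case unfolding e sp.simps act_sg[OF sp_TT[OF n f]] Suc.IH ..
qed simp

end

section \<open>The unitary\<close>

text \<open>The separate case j = 0 in \<open>Wj\<close> fits the general formula because
  \<open>Wcoef\<close> is then an empty product.\<close>

lemma Wj_eq:
  assumes n: "n \<ge> 1" and j: "j \<le> k" "j \<le> m" and f: "f \<in> E n (k + m - 2 * j)"
  shows "Wj n k m j f = (\<lambda>w. complex_of_real (Wcoef n k m j) * sp n (k - j) (m - j) j f w)"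
proof (cases "j = 0")
  case True
  then show ?thesis by (simp add: Wj_def Wcoef_def)
next
  case False
  have e: "k + m - 2 * j = k - j + (m - j)" using j by simp
  have "f \<in> TT n (k - j) (m - j)" using f unfolding E_eq_TT e by (rule E_TT)
  from sigpow_eq[OF n this, of j] j False show ?thesis by (simp add: Wj_def)
qed

theorem theorem3p21:
  fixes n k m :: nat
  assumes "n \<ge> 1"
  shows "bij_betw (Wmap n k m) (DS n k m) (tensS (n * k) (E n k) (E n m))
    \<and> (\<forall>x\<in>DS n k m. \<forall>y\<in>DS n k m. \<forall>a b :: complex.
          Wmap n k m (\<lambda>j w. a * x j w + b * y j w) = (\<lambda>w. a * Wmap n k m x w + b * Wmap n k m y w))
    \<and> (\<forall>x\<in>DS n k m. \<forall>y\<in>DS n k m. ip (Wmap n k m x) (Wmap n k m y) = DSip k m x y)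
    \<and> (\<forall>U x. SU2 U \<and> x \<in> DS n k m \<longrightarrow>
          Wmap n k m (\<lambda>j. act U (n * (k + m - 2 * j)) (x j)) = act U (n * (k + m)) (Wmap n k m x))"
proof -
  let ?l = "min k m"
  define c where "c j = complex_of_real (Wcoef n k m j)" for j
  define S where "S j = sp n (k - j) (m - j) j" for j
  have size: "k - j + (m - j) = k + m - 2 * j" "k - j + j = k" "m - j + j = m" if "j \<le> ?l" for j
    using that by auto
  have cnz: "c j \<noteq> 0" if "j \<le> ?l" for j
    using Wcoef_sq(2)[OF assms, of "k - j" j "m - j"] size[OF that] by (simp add: c_def)
  have xE: "x j \<in> TT n 0 (k - j + (m - j))" if "x \<in> DS n k m" "j \<le> ?l" for x j
    using that size[OF that(2)] by (simp add: DS_def E_eq_TT)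
  have xV: "x j \<in> Vec (n * (k - j + (m - j)))" if "x \<in> DS n k m" "j \<le> ?l" for x j
    using xE[OF that] TT_Vec[of n 0 "k - j + (m - j)"] by auto
  have ST: "S j (x j) \<in> TT n k m" if "x \<in> DS n k m" "j \<le> ?l" for x j
    using sp_TT[OF assms E_TT[OF xE[OF that]], of j] size[OF that(2)] by (simp add: S_def)
  have SV: "S j (x j) \<in> Vec (n * (k + m))" if "x \<in> DS n k m" "j \<le> ?l" for x j
    using ST[OF that] TT_Vec by blast
  have W: "Wmap n k m x = (\<lambda>w. \<Sum>j\<le>?l. c j * S j (x j) w)" if "x \<in> DS n k m" for x
    unfolding Wmap_def c_def S_def
    using that by (intro ext sum.cong refl) (simp add: Wj_eq[OF assms] DS_def)
  have DSlin: "(\<lambda>j w. a * x j w + b * y j w) \<in> DS n k m" if "x \<in> DS n k m" "y \<in> DS n k m" for x y a b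
    using that csub_lin[OF csub_TT] by (simp add: DS_def E_eq_TT)
  have lin: "Wmap n k m (\<lambda>j w. a * x j w + b * y j w) = (\<lambda>w. a * Wmap n k m x w + b * Wmap n k m y w)"
    if "x \<in> DS n k m" "y \<in> DS n k m" for x y a b
    unfolding W[OF that(1)] W[OF that(2)] W[OF DSlin[OF that]]
    by (simp add: S_def sp_lin sum_distrib_left sum.distrib[symmetric] algebra_simps)
  have iso: "ip (Wmap n k m x) (Wmap n k m y) = DSip k m x y"
    if x: "x \<in> DS n k m" and y: "y \<in> DS n k m" for x y
  proof -
    have "ip (Wmap n k m x) (Wmap n k m y) = (\<Sum>j\<le>?l. c j * ip (S j (x j)) (Wmap n k m y))"
      unfolding W[OF x] by (rule ip_sum_left[OF SV[OF x]]) simp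
    also have "\<dots> = (\<Sum>j\<le>?l. ip (x j) (y j))"
    proof (rule sum.cong[OF refl])
      fix j assume "j \<in> {..?l}"
      then have j: "j \<le> ?l" by simp
      \<comment> \<open>The sum in the second argument is expanded by exchanging the arguments with
        \<open>ip_cnj\<close>; the coefficients \<open>c\<close> are real, so conjugation leaves
        them unchanged.\<close>
      have "ip (Wmap n k m y) (S j (x j)) = (\<Sum>i\<le>?l. c i * ip (S i (y i)) (S j (x j)))"
        unfolding W[OF y] by (rule ip_sum_left[OF SV[OF y]]) simp
      also have "\<dots> = (\<Sum>i\<le>?l. if i = j then c j * ip (S j (y j)) (S j (x j)) else 0)"
      proof (rule sum.cong[OF refl])
        fix i assume "i \<in> {..?l}"
        then have i: "i \<le> ?l" by simp
        have "ip (S i (y i)) (S j (x j)) = 0" if "i \<noteq> j"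
          unfolding S_def using size[OF i] size[OF j] that
          by (intro ip_sp_orth[OF assms xE[OF y i] xE[OF x j]]) auto
        then show "c i * ip (S i (y i)) (S j (x j)) = (if i = j then c j * ip (S j (y j)) (S j (x j)) else 0)"
          by simp
      qed
      also have "\<dots> = c j * ip (S j (y j)) (S j (x j))" using j by simp
      finally have 1: "ip (Wmap n k m y) (S j (x j)) = c j * ip (S j (y j)) (S j (x j))" .
      have WV: "Wmap n k m y \<in> Vec (n * (k + m))"
        unfolding W[OF y] by (intro csub_sum[OF csub_Vec] SV[OF y]) simp
      have "ip (S j (x j)) (Wmap n k m y) = c j * ip (S j (x j)) (S j (y j))"
        using ip_cnj[OF WV SV[OF x j]] ip_cnj[OF SV[OF x j] SV[OF y j]] 1 by (simp add: c_def)
      also have "ip (S j (x j)) (S j (y j)) = (\<Prod>r\<in>{1..j}. dc n (k - j + r) * bb n (k - j) (m - j) r) * ip (x j) (y j)"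
        unfolding S_def by (rule ip_sp_eq[OF assms xE[OF x j] xE[OF y j]])
      finally show "c j * ip (S j (x j)) (Wmap n k m y) = ip (x j) (y j)"
        using Wcoef_sq(1)[OF assms, of "k - j" j "m - j"] size[OF j]
        by (simp add: c_def mult.assoc[symmetric])
    qed
    finally show ?thesis by (simp add: DSip_def)
  qed
  have inj: "inj_on (Wmap n k m) (DS n k m)"
  proof (rule inj_onI)
    fix x y assume x: "x \<in> DS n k m" and y: "y \<in> DS n k m" and e: "Wmap n k m x = Wmap n k m y"
    define z where "z = (\<lambda>j w. 1 * x j w + (-1) * y j w)"
    have z: "z \<in> DS n k m" unfolding z_def by (rule DSlin[OF x y])
    have "Wmap n k m z = (\<lambda>w. 0)" unfolding z_def lin[OF x y] e by simp
    then have D0: "DSip k m z z = 0" using iso[OF z z] by simp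
    \<comment> \<open>Each complex summand is rewritten as a real sum of squares, so that the
      vanishing of the total forces every component to vanish.\<close>
    have re: "ip (z j) (z j) = of_real (\<Sum>w\<in>words (n * (k - j + (m - j))). (cmod (z j w))\<^sup>2)" if "j \<le> ?l" for j
      unfolding ip_eq[OF xV[OF z that]] of_real_sum by (intro sum.cong refl) (rule complex_norm_square[symmetric])
    have "(\<Sum>j\<le>?l. ip (z j) (z j)) = (\<Sum>j\<le>?l. complex_of_real (\<Sum>w\<in>words (n * (k - j + (m - j))). (cmod (z j w))\<^sup>2))"
      by (intro sum.cong refl re) simp
    with D0 have "(\<Sum>j\<le>?l. complex_of_real (\<Sum>w\<in>words (n * (k - j + (m - j))). (cmod (z j w))\<^sup>2)) = 0"
      unfolding DSip_def by (simp only:)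
    then have "(\<Sum>j\<le>?l. \<Sum>w\<in>words (n * (k - j + (m - j))). (cmod (z j w))\<^sup>2) = 0"
      unfolding of_real_sum[symmetric] of_real_eq_0_iff .
    then have "\<forall>j\<in>{..?l}. (\<Sum>w\<in>words (n * (k - j + (m - j))). (cmod (z j w))\<^sup>2) = 0"
      by (subst (asm) sum_nonneg_eq_0_iff) (auto intro: sum_nonneg)
    then have z0: "(\<Sum>w\<in>words (n * (k - j + (m - j))). (cmod (z j w))\<^sup>2) = 0" if "j \<le> ?l" for j
      using that by blast
    have "ip (z j) (z j) = 0" if "j \<le> ?l" for j
      unfolding re[OF that] z0[OF that] by (rule of_real_0)
    then have "z j = (\<lambda>w. 0)" if "j \<le> ?l" for j
      by (rule ip_self_eq_0[OF xV[OF z that]]) (rule that)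
    then have "x j = y j" if "j \<le> ?l" for j using that by (fastforce simp: z_def fun_eq_iff)
    \<comment> \<open>Components beyond \<open>min k m\<close> are 0 by the definition of
      \<open>DS\<close>, so they cannot spoil injectivity.\<close>
    moreover have "x j = y j" if "\<not> j \<le> ?l" for j
    proof -
      have "?l < j" using that by (simp only: not_le)
      then show ?thesis using x y unfolding DS_def by simp
    qed
    ultimately show "x = y" by blast
  qed
  have img: "Wmap n k m ` DS n k m = TT n k m"
  proof (intro equalityI subsetI)
    fix f assume "f \<in> Wmap n k m ` DS n k m"
    then obtain x where x: "x \<in> DS n k m" "f = Wmap n k m x" by blast
    show "f \<in> TT n k m" unfolding x(2) W[OF x(1)] by (intro csub_sum[OF csub_TT] ST[OF x(1)]) simp
  next
    fix f assume "f \<in> TT n k m"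
    then obtain y where y: "\<forall>j\<le>?l. y j \<in> TT n 0 (k + m - 2 * j)" "f = (\<lambda>w. \<Sum>j\<le>?l. S j (y j) w)"
      using TT_decompose[OF assms, of f k m] unfolding S_def by blast
    \<comment> \<open>\<open>TT_decompose\<close> uses the powers of \<sigma> without normalization;
      dividing by \<open>c j\<close> compensates for the coefficient in \<open>Wj\<close>.\<close>
    define x where "x j = (if j \<le> ?l then \<lambda>w. (1 / c j) * y j w else (\<lambda>w. 0))" for j
    have x: "x \<in> DS n k m"
      using y(1) csub_scale[OF csub_TT, of _ n 0] by (auto simp: DS_def x_def E_eq_TT simp del: times_divide_eq_left)
    have "S j (\<lambda>w. (1 / c j) * y j w) = (\<lambda>w. (1 / c j) * S j (y j) w)" for j
      using sp_lin[of n "k - j" "m - j" j "1 / c j" "y j" 0 "y j"] by (simp add: S_def)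
    then have "Wmap n k m x = f"
      unfolding W[OF x] y(2) x_def using cnz by (intro ext sum.cong refl) simp
    then show "f \<in> Wmap n k m ` DS n k m" using x by blast
  qed
  have equi: "Wmap n k m (\<lambda>j. act U (n * (k + m - 2 * j)) (x j)) = act U (n * (k + m)) (Wmap n k m x)"
    if U: "SU2 U" and x: "x \<in> DS n k m" for U x
  proof -
    have det: "U 0 0 * U 1 1 - U 0 1 * U 1 0 = 1" using U by (simp add: SU2_def)
    let ?x = "\<lambda>j. act U (n * (k + m - 2 * j)) (x j)"
    have x': "?x \<in> DS n k m"
      using x act_TT[OF det, of _ n 0] by (simp add: DS_def E_eq_TT act_0)
    have "act U (n * (k + m)) (S j (x j)) = S j (?x j)" if j: "j \<le> ?l" for j
      using act_sp[OF det assms E_TT[OF xE[OF x j]], of j] size[OF j] by (simp add: S_def)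
    then show ?thesis unfolding W[OF x'] W[OF x] act_sum by (intro ext sum.cong refl) simp
  qed
  show ?thesis
    unfolding bij_betw_def tensS_E img using inj lin iso equi by blast
qed

end
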